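(* Let $X$ be a locally compact Hausdorff space and $\kappa$ a perfect kernel on $X$. Let $f=\psi+U^\vartheta$ with $\psi\in\Phi(X)$ and $\vartheta\in\mathcal E$, and let $A\subset X$ satisfy $-\infty<w_f(A)<\infty$. Assume that the solution $\lambda_{A,f}$ to the minimum problem for $A$ and $f$ exists, i.e. $\lambda_{A,f}\in\breve{\mathcal E}^+_f(A)$ and $I_f(\lambda_{A,f})=w_f(A)$. Then for all compact $K\subset A$ large enough there exists the (unique) $\lambda_{K,f}\in\breve{\mathcal E}^+_f(K)$ with $I_f(\lambda_{K,f})=w_f(K)$, and $$\lambda_{K,f}\to\lambda_{A,f}\ \text{ strongly and vaguely in }\mathcal E^+\text{ as }K\uparrow A.$$ If moreover $f=U^\vartheta$ with $\vartheta\in\mathcal E$, then also $$\lim_{K\uparrow A}c_{K,f}=c_{A,f},$$ where $c_{Q,f}:=\int U_f^{\lambda_{Q,f}}\,d\lambda_{Q,f}=w_f(Q)-\int f\,d\lambda_{Q,f}$ for $Q=A$ and for $Q=K$.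
   Context: Measures: $\mathfrak M$ is the space of real-valued (signed) Radon measures on $X$ with the vague (weak$^*$) topology of pointwise convergence on continuous functions of compact support; $\mathfrak M^+$ is the cone of positive ones. A measure $\mu\in\mathfrak M^+$ is concentrated on $A\subset X$ if $X\setminus A$ is locally $\mu$-negligible. $\Phi(Y)$ is the set of lower semicontinuous functions $g:Y\to(-\infty,\infty]$ which are $\geqslant0$ unless the topological space $Y$ is compact. A kernel is a symmetric function $\kappa\in\Phi(X\times X)$. For $\mu\in\mathfrak M$, $U^\mu(x)=\int\kappa(x,y)\,d\mu(y)$ is the potential, $I(\mu,\nu)=\int\kappa\,d(\mu\otimes\nu)$ the mutual energy, $I(\mu)=I(\mu,\mu)$ the energy, whenever well defined. Energy principle: $I(\mu)\geqslant0$ for all $\mu\in\mathfrak M$ for which $I(\mu)$ is well defined, and $I(\mu)=0$ only for $\mu=0$. Then $\mathcal E=\{\mu\in\mathfrak M: I(\mu)\text{ well defined},\ I(\mu)<\infty\}$ is a pre-Hilbert space with inner product $I(\mu,\nu)$ and norm $\|\mu\|=\sqrt{I(\mu)}$; the norm topology is called strong. $\mathcal E^+=\mathcal E\cap\mathfrak M^+$. The kernel is perfect if it satisfies the energy principle, $\mathcal E^+$ is strongly complete, and the strong topology on $\mathcal E^+$ is finer than the vague topology. For $Q\subset X$, $\mathcal E^+(Q)$ is the set of $\mu\in\mathcal E^+$ concentrated on $Q$; $\breve{\mathcal E}^+(Q)=\{\mu\in\mathcal E^+(Q):\mu(X)=1\}$. The inner capacity is ${\rm cap}_*(Q)=1/\inf_{\mu\in\breve{\mathcal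 E}^+(Q)}I(\mu)$ ($\inf\varnothing=+\infty$, $1/(+\infty)=0$, $1/0=+\infty$). The function $f=\psi+U^\vartheta$ is well defined with values in $(-\infty,\infty]$ except on a set of inner capacity zero (such sets, when $\mu$-measurable, are negligible for bounded $\mu\in\mathcal E^+$). $\breve{\mathcal E}^+_f(Q)$ is the set of $\mu\in\breve{\mathcal E}^+(Q)$ for which $f$ is $\mu$-integrable; $I_f(\mu)=I(\mu)+2\int f\,d\mu$; $w_f(Q)=\inf_{\mu\in\breve{\mathcal E}^+_f(Q)}I_f(\mu)$; $U_f^\mu=U^\mu+f$. Minimizers of $I_f$ over $\breve{\mathcal E}^+_f(Q)$ are unique when they exist. "$K\uparrow A$" denotes convergence of nets indexed by the set $\mathfrak C_A$ of all compact subsets $K$ of $A$, directed upward by inclusion; "for all $K$ large enough" means for all $K\in\mathfrak C_A$ containing some fixed $K_0\in\mathfrak C_A$. *)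

theory Defs
  imports "HOL-Analysis.Analysis"
begin

section \<open>Function classes\<close>

definition Cc :: "('b::topological_space \<Rightarrow> real) set" where
  "Cc = {\<phi>. continuous_on UNIV \<phi> \<and> compact (closure {y. \<phi> y \<noteq> 0})}"

definition lsc_class :: "('b::topological_space \<Rightarrow> ereal) set" where
  "lsc_class = {g. (\<forall>y. g y \<noteq> - \<infinity>) \<and> (\<forall>c. open {y. c < g y}) \<and>
                   (compact (UNIV :: 'b set) \<or> (\<forall>y. 0 \<le> g y))}"

definition kernel :: "('a::topological_space \<times> 'a \<Rightarrow> ereal) \<Rightarrow> bool" where
  "kernel \<kappa> \<longleftrightarrow> \<kappa> \<in> lsc_class \<and> (\<forall>x y. \<kappa> (x, y) = \<kappa> (y, x))"


section \<open>Radon measures\<close>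

text \<open>Positive Radon measures (positive linear functionals on \<open>Cc\<close>) are represented by the
  Borel measures that the Riesz representation theorem attaches to them.\<close>

definition radon :: "'a::topological_space measure \<Rightarrow> bool" where
  "radon M \<longleftrightarrow> sets M = sets borel \<and>
     (\<forall>K. compact K \<longrightarrow> emeasure M K < \<infinity>) \<and>
     (\<forall>B \<in> sets borel. emeasure M B = (INF U \<in> {U. open U \<and> B \<subseteq> U}. emeasure M U)) \<and>
     (\<forall>U. open U \<longrightarrow> emeasure M U = (SUP K \<in> {K. compact K \<and> K \<subseteq> U}. emeasure M K))"

text \<open>A pair \<open>(P, N)\<close> of positive Radon measures stands for the signed functional \<open>P - N\<close>. On a
  space that is not compact both parts may be infinite, so that \<open>P - N\<close> need not be a set function.
  Every signed Radon measure has exactly one representative that is its Jordan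
  decomposition, i.e. whose two parts are mutually singular on each compact set.\<close>

type_synonym 'a mpair = "'a measure \<times> 'a measure"

definition signed_radon :: "'a::topological_space mpair set" where
  "signed_radon = {(P, N). radon P \<and> radon N \<and>
     (\<forall>K. compact K \<longrightarrow> (\<exists>B \<in> sets borel. emeasure P (K \<inter> B) = 0 \<and> emeasure N (K - B) = 0))}"

abbreviation pos :: "'a::topological_space measure \<Rightarrow> 'a mpair" where
  "pos M \<equiv> (M, null_measure borel)"

definition concentrated_on :: "'a::topological_space measure \<Rightarrow> 'a set \<Rightarrow> bool" where
  "concentrated_on M A \<longleftrightarrow> (\<forall>K. compact K \<longrightarrow> (\<exists>Z \<in> null_sets M. K - A \<subseteq> Z))"

definition vague_topology :: "'a::topological_space measure topology" where
  "vague_topology = pullback_topology {M. radon M}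
     (\<lambda>M. \<lambda>\<phi>\<in>Cc. integral\<^sup>L M \<phi>) (product_topology (\<lambda>_. euclideanreal) Cc)"


section \<open>Potentials and energies\<close>

text \<open>In \<open>ereal\<close>, \<open>\<infinity> - \<infinity> = \<infinity>\<close>. Hence a combination of potentials is infinite at each point
  where it is not well defined, and \<open>eintegrable\<close> forces the set of such points to be
  negligible.\<close>

definition eintegrable :: "'a measure \<Rightarrow> ('a \<Rightarrow> ereal) \<Rightarrow> bool" where
  "eintegrable M g \<longleftrightarrow> (AE x in M. \<bar>g x\<bar> \<noteq> \<infinity>) \<and> integrable M (\<lambda>x. real_of_ereal (g x))"

definition eintegral :: "'a measure \<Rightarrow> ('a \<Rightarrow> ereal) \<Rightarrow> real" where
  "eintegral M g = (\<integral>x. real_of_ereal (g x) \<partial>M)"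

text \<open>The subtrahend is finite for a kernel: it vanishes unless the space is compact, in which
  case \<open>\<kappa>\<close> is bounded below and \<open>M\<close> is finite.\<close>

definition pos_potential :: "('a::topological_space \<times> 'a \<Rightarrow> ereal) \<Rightarrow> 'a measure \<Rightarrow> 'a \<Rightarrow> ereal" where
  "pos_potential \<kappa> M x = enn2ereal (\<integral>\<^sup>+ y. e2ennreal (\<kappa> (x, y)) \<partial>M)
                       - enn2ereal (\<integral>\<^sup>+ y. e2ennreal (- \<kappa> (x, y)) \<partial>M)"

definition potential :: "('a::topological_space \<times> 'a \<Rightarrow> ereal) \<Rightarrow> 'a mpair \<Rightarrow> 'a \<Rightarrow> ereal" where
  "potential \<kappa> s x = pos_potential \<kappa> (fst s) x - pos_potential \<kappa> (snd s) x"

text \<open>The integral of \<open>\<kappa>\<close> with respect to the Radon product of \<open>M\<close> and \<open>N\<close>. That product is the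
  functional sending \<open>\<phi> \<in> Cc\<close> to the iterated integral of \<open>\<phi>\<close>, and the integral of a lower
  semicontinuous function is (Bourbaki) the supremum over its minorants in \<open>Cc\<close>. The measure
  \<open>M \<Otimes>\<^sub>M N\<close> is not adequate, because \<open>\<kappa>\<close> need not be measurable for the product of the two
  Borel algebras.\<close>

definition pos_energy ::
  "('a::topological_space \<times> 'a \<Rightarrow> ereal) \<Rightarrow> 'a measure \<Rightarrow> 'a measure \<Rightarrow> ereal" where
  "pos_energy \<kappa> M N = (SUP \<phi> \<in> {\<phi> \<in> Cc. \<forall>z. ereal (\<phi> z) \<le> \<kappa> z}.
                          ereal (\<integral>x. (\<integral>y. \<phi> (x, y) \<partial>N) \<partial>M))"

definition energy_defined :: "('a::topological_space \<times> 'a \<Rightarrow> ereal) \<Rightarrow> 'a mpair \<Rightarrow> 'a mpair \<Rightarrow> bool" where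
  "energy_defined \<kappa> s t \<longleftrightarrow>
     pos_energy \<kappa> (fst s) (fst t) + pos_energy \<kappa> (snd s) (snd t) < \<infinity> \<or>
     pos_energy \<kappa> (fst s) (snd t) + pos_energy \<kappa> (snd s) (fst t) < \<infinity>"

definition energy :: "('a::topological_space \<times> 'a \<Rightarrow> ereal) \<Rightarrow> 'a mpair \<Rightarrow> 'a mpair \<Rightarrow> ereal" where
  "energy \<kappa> s t =
     (pos_energy \<kappa> (fst s) (fst t) + pos_energy \<kappa> (snd s) (snd t)) -
     (pos_energy \<kappa> (fst s) (snd t) + pos_energy \<kappa> (snd s) (fst t))"

definition energy_principle :: "('a::topological_space \<times> 'a \<Rightarrow> ereal) \<Rightarrow> bool" where
  "energy_principle \<kappa> \<longleftrightarrow> (\<forall>s \<in> signed_radon. energy_defined \<kappa> s s \<longrightarrow>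
     0 \<le> energy \<kappa> s s \<and> (energy \<kappa> s s = 0 \<longrightarrow> s = pos (null_measure borel)))"

definition fin_energy :: "('a::topological_space \<times> 'a \<Rightarrow> ereal) \<Rightarrow> 'a mpair set" where
  "fin_energy \<kappa> = {s \<in> signed_radon. energy_defined \<kappa> s s \<and> energy \<kappa> s s < \<infinity>}"

definition fin_energy_pos :: "('a::topological_space \<times> 'a \<Rightarrow> ereal) \<Rightarrow> 'a measure set" where
  "fin_energy_pos \<kappa> = {M. pos M \<in> fin_energy \<kappa>}"


section \<open>The strong topology and perfect kernels\<close>

text \<open>The norm of \<open>M - N\<close>, with its energy expanded by bilinearity: \<open>(M, N)\<close> represents \<open>M - N\<close>
  but need not be its Jordan decomposition. The value outside the cone is irrelevant; it makes
  the function symmetric and nonnegative everywhere, as \<open>Metric_space\<close> requires.\<close>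

definition strong_dist ::
  "('a::topological_space \<times> 'a \<Rightarrow> ereal) \<Rightarrow> 'a measure \<Rightarrow> 'a measure \<Rightarrow> real" where
  "strong_dist \<kappa> M N =
     (if M \<in> fin_energy_pos \<kappa> \<and> N \<in> fin_energy_pos \<kappa>
      then sqrt (real_of_ereal (energy \<kappa> (M, N) (M, N))) else 0)"

definition strong_topology :: "('a::topological_space \<times> 'a \<Rightarrow> ereal) \<Rightarrow> 'a measure topology" where
  "strong_topology \<kappa> = Metric_space.mtopology (fin_energy_pos \<kappa>) (strong_dist \<kappa>)"

definition perfect_kernel :: "('a::topological_space \<times> 'a \<Rightarrow> ereal) \<Rightarrow> bool" where
  "perfect_kernel \<kappa> \<longleftrightarrow> kernel \<kappa> \<and> energy_principle \<kappa> \<and>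
     Metric_space.mcomplete (fin_energy_pos \<kappa>) (strong_dist \<kappa>) \<and>
     (\<forall>S. openin (subtopology vague_topology (fin_energy_pos \<kappa>)) S \<longrightarrow>
          openin (strong_topology \<kappa>) S)"


section \<open>The minimum problem\<close>

definition unit_class ::
  "('a::topological_space \<times> 'a \<Rightarrow> ereal) \<Rightarrow> ('a \<Rightarrow> ereal) \<Rightarrow> 'a set \<Rightarrow> 'a measure set" where
  "unit_class \<kappa> f Q = {M \<in> fin_energy_pos \<kappa>. concentrated_on M Q \<and> emeasure M UNIV = 1 \<and>
                                           eintegrable M f}"

definition gauss_functional ::
  "('a::topological_space \<times> 'a \<Rightarrow> ereal) \<Rightarrow> ('a \<Rightarrow> ereal) \<Rightarrow> 'a measure \<Rightarrow> ereal" where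
  "gauss_functional \<kappa> f M = energy \<kappa> (pos M) (pos M) + ereal (2 * eintegral M f)"

definition gauss_inf ::
  "('a::topological_space \<times> 'a \<Rightarrow> ereal) \<Rightarrow> ('a \<Rightarrow> ereal) \<Rightarrow> 'a set \<Rightarrow> ereal" where
  "gauss_inf \<kappa> f Q = (INF M \<in> unit_class \<kappa> f Q. gauss_functional \<kappa> f M)"

definition is_minimizer ::
  "('a::topological_space \<times> 'a \<Rightarrow> ereal) \<Rightarrow> ('a \<Rightarrow> ereal) \<Rightarrow> 'a set \<Rightarrow> 'a measure \<Rightarrow> bool" where
  "is_minimizer \<kappa> f Q M \<longleftrightarrow> M \<in> unit_class \<kappa> f Q \<and> gauss_functional \<kappa> f M = gauss_inf \<kappa> f Q"

definition minimizer ::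
  "('a::topological_space \<times> 'a \<Rightarrow> ereal) \<Rightarrow> ('a \<Rightarrow> ereal) \<Rightarrow> 'a set \<Rightarrow> 'a measure" where
  "minimizer \<kappa> f Q = (THE M. is_minimizer \<kappa> f Q M)"

definition weighted_potential ::
  "('a::topological_space \<times> 'a \<Rightarrow> ereal) \<Rightarrow> ('a \<Rightarrow> ereal) \<Rightarrow> 'a measure \<Rightarrow> 'a \<Rightarrow> ereal" where
  "weighted_potential \<kappa> f M x = potential \<kappa> (pos M) x + f x"

definition eq_const ::
  "('a::topological_space \<times> 'a \<Rightarrow> ereal) \<Rightarrow> ('a \<Rightarrow> ereal) \<Rightarrow> 'a measure \<Rightarrow> real" where
  "eq_const \<kappa> f M = eintegral M (weighted_potential \<kappa> f M)"

text \<open>The filter of \<open>K \<up> A\<close>, in analogy with \<^const>\<open>finite_subsets_at_top\<close>.\<close>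

definition compact_subsets_at_top :: "'a::topological_space set \<Rightarrow> 'a set filter" where
  "compact_subsets_at_top A = (INF K0 \<in> {K. compact K \<and> K \<subseteq> A}.
                                 principal {K. compact K \<and> K0 \<subseteq> K \<and> K \<subseteq> A})"

end

theory Submission
  imports Defs
begin

text \<open>Write \<open>G\<close> for the Gauss functional and \<open>w\<close> for its infimum over a class of measures. Such a
  class is convex, so that for two of its elements the parallelogram identity gives
  \<open>\<parallel>\<mu> - \<nu>\<parallel>\<^sup>2 = 2 G \<mu> + 2 G \<nu> - 4 G ((\<mu> + \<nu>) / 2) \<le> 2 G \<mu> + 2 G \<nu> - 4 w\<close>.
  For a compact set this makes minimizing sequences strongly Cauchy, and perfectness of the kernel
  provides a minimizer. Normalized restrictions of \<open>\<lambda>\<^sub>A\<close> to compact subsets of \<open>A\<close> show that the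
  minima for \<open>K\<close> tend to the minimum for \<open>A\<close>, and then the same estimate for \<open>\<lambda>\<^sub>K\<close> and \<open>\<lambda>\<^sub>A\<close> gives
  strong convergence. The constants are \<open>(G + \<parallel>\<lambda>\<parallel>\<^sup>2) / 2\<close>, so they converge as well.

  That \<open>\<parallel>\<mu> - \<nu>\<parallel>\<close> is a metric on all positive measures of finite energy follows from the energy
  principle, applied to the Jordan decomposition of \<open>\<mu> - \<nu>\<close>. As the measures need not be
  \<open>\<sigma>\<close>-finite, that decomposition is glued from Hahn decompositions on compact sets, and
  integrals of lower semicontinuous functions are computed as suprema over minorants in \<open>Cc\<close>.\<close>

section \<open>Lower semicontinuous functions on locally compact spaces\<close>

text \<open>Three obstacles shape the proof. On a compact space \<open>\<kappa>\<close> and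
  \<open>\<psi>\<close> may take negative values; constants \<open>c\<close> and \<open>b\<close>
  are added so that integrals can be formed in \<open>ennreal\<close>, and the finite corrections
  (\<open>c\<close> times a product of masses, \<open>b\<close> times the unit mass) are subtracted
  afterwards. The kernel need not be measurable for the product of the Borel algebras, so energies
  are iterated integrals, and the order of integration is exchanged for functions in
  \<open>Cc\<close> only and carried over to the kernel by directed suprema; inner regularity
  replaces the sequences of the usual monotone convergence theorem. Finally, the mutual energy of
  two positive measures of finite energy is not finite a priori; the energy principle excludes the
  value \<infinity>, which would make the energy of a signed measure equal to -\<infinity>.
  Compactness of \<open>K\<close> matters for existence because a vague limit can lose mass; a test
  function equal to 1 on \<open>K\<close> prevents this.\<close>

lemma compact_closure_subset:
  assumes "closure S \<subseteq> L" "compact L"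
  shows "compact (closure S)"
  using compact_Int_closed[OF assms(2) closed_closure, of S] assms(1) by (simp add: Int_absorb1)

text \<open>Local compactness puts an open set \<open>V\<close> between \<open>K\<close> and a
  compact set \<open>L\<close>. Separating \<open>K\<close> from the complement of
  \<open>U \<inter> V\<close>, rather than of \<open>U\<close>, confines the support to
  \<open>L\<close>.\<close>

lemma lc_Urysohn:
  fixes K U :: "'b::t2_space set"
  assumes lc: "locally_compact_space (euclidean :: 'b topology)"
    and "compact K" "open U" "K \<subseteq> U"
  obtains \<phi> where "\<phi> \<in> Cc" "\<And>z. 0 \<le> \<phi> z" "\<And>z. \<phi> z \<le> 1" "\<And>z. z \<in> K \<Longrightarrow> \<phi> z = 1"
    "\<And>z. z \<notin> U \<Longrightarrow> \<phi> z = (0::real)"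
proof -
  have haus: "Hausdorff_space (euclidean :: 'b topology)"
    unfolding Hausdorff_space_def disjnt_def open_openin[symmetric]
    using hausdorff by blast
  obtain V L where VL: "open V" "compact L" "K \<subseteq> V" "V \<subseteq> L"
    using lc assms(2) locally_compact_space_compact_closed_compact[OF disjI1[OF haus]]
    by (metis compactin_euclidean_iff open_openin)
  define W where "W = U \<inter> V"
  have W: "open W" "K \<subseteq> W" "W \<subseteq> L" "W \<subseteq> U"
    using VL assms by (auto simp: W_def)
  have cr: "completely_regular_space (euclidean :: 'b topology)"
    using lc haus locally_compact_regular_imp_completely_regular_space by blast
  have "closedin euclidean (- W)" "compactin euclidean K" "disjnt K (- W)"
    using W assms by (auto simp: compactin_euclidean_iff disjnt_def)
  then obtain \<phi> where \<phi>: "continuous_map euclidean (subtopology euclidean {0..1::real}) \<phi>"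
      "\<phi> ` (- W) \<subseteq> {0}" "\<phi> ` K \<subseteq> {1}"
    using Urysohn_completely_regular_closed_compact[OF zero_le_one cr] Urysohn_completely_regular_compact_closed[OF zero_le_one cr]
      disjnt_sym by (smt (verit))
  have "continuous_on UNIV \<phi>" "\<And>z. 0 \<le> \<phi> z \<and> \<phi> z \<le> 1"
    using \<phi>(1) by (auto simp: continuous_map_in_subtopology)
  moreover have "compact (closure {y. \<phi> y \<noteq> 0})"
  proof -
    have "{y. \<phi> y \<noteq> 0} \<subseteq> L" using \<phi>(2) W by blast
    then have "closure {y. \<phi> y \<noteq> 0} \<subseteq> L"
      by (simp add: VL(2) closure_minimal compact_imp_closed)
    then show ?thesis
      using VL(2) compact_closure_subset by blast
  qed
  ultimately show ?thesis
    using \<phi>(2,3) W(2,4) by (intro that[of \<phi>]) (auto simp: Cc_def image_subset_iff)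
qed

lemma locally_compact_prod:
  assumes lc: "locally_compact_space (euclidean :: 'b::t2_space topology)"
  shows "locally_compact_space (euclidean :: ('b \<times> 'b) topology)"
  using locally_compact_space_prod_topology[of "euclidean::'b topology" "euclidean :: 'b topology"] lc
  by simp

text \<open>The counterpart of \<open>lsc_class\<close> for nonnegative functions: the type already
  excludes negative values, on compact spaces as well.\<close>

definition lsc :: "('b::topological_space \<Rightarrow> ennreal) \<Rightarrow> bool" where
  "lsc g \<longleftrightarrow> (\<forall>r. open {x. r < g x})"

text \<open>Nonnegative minorants have integrals in \<open>ennreal\<close>, and maxima stay in the
  family, so that suprema over it are directed.\<close>

definition Cc_below :: "('b::topological_space \<Rightarrow> ennreal) \<Rightarrow> ('b \<Rightarrow> real) set" where
  "Cc_below g = {\<phi> \<in> Cc. \<forall>z. 0 \<le> \<phi> z \<and> ennreal (\<phi> z) \<le> g z}"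

lemma lsc_measurable:
  assumes "lsc g" "sets M = sets borel"
  shows "g \<in> borel_measurable M"
proof -
  have "g \<in> borel_measurable borel"
    using assms by (intro borel_measurableI_greater) (auto simp: lsc_def)
  then show ?thesis using assms(2) measurable_cong_sets by blast
qed

lemma lsc_SUP:
  assumes "\<And>i. i \<in> I \<Longrightarrow> lsc (f i)"
  shows "lsc (\<lambda>x. SUP i\<in>I. f i x)"
proof -
  have "{x. r < (SUP i\<in>I. f i x)} = (\<Union>i\<in>I. {x. r < f i x})" for r
    by (auto simp: less_SUP_iff)
  then show ?thesis using assms by (auto simp: lsc_def)
qed

lemma lsc_compose:
  assumes "lsc g" "continuous_on UNIV h"
  shows "lsc (\<lambda>x. g (h x))"
proof -
  have "{x. r < g (h x)} = h -` {y. r < g y}" for r by auto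
  then show ?thesis using assms open_vimage unfolding lsc_def by metis
qed

lemma lsc_indicator: "open U \<Longrightarrow> lsc (indicator U)"
proof -
  assume "open U"
  have "{x. r < indicator U x} = (if r < 1 then U else {})" for r :: ennreal
    by (auto split: split_indicator)
  then show ?thesis using \<open>open U\<close> by (auto simp: lsc_def)
qed

lemma lsc_continuous: "continuous_on UNIV \<phi> \<Longrightarrow> lsc (\<lambda>x. ennreal (\<phi> x))"
  unfolding lsc_def
  by (intro allI open_Collect_less continuous_on_const continuous_on_ennreal)

lemma Cc_continuous: "\<phi> \<in> Cc \<Longrightarrow> continuous_on UNIV \<phi>"
  by (simp add: Cc_def)

lemma Cc_max: "\<phi> \<in> Cc \<Longrightarrow> \<xi> \<in> Cc \<Longrightarrow> (\<lambda>z. max (\<phi> z) (\<xi> z)) \<in> Cc"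
proof -
  assume a: "\<phi> \<in> Cc" "\<xi> \<in> Cc"
  have "{y. max (\<phi> y) (\<xi> y) \<noteq> 0} \<subseteq> {y. \<phi> y \<noteq> 0} \<union> {y. \<xi> y \<noteq> 0}" by (auto simp: max_def)
  then have "closure {y. max (\<phi> y) (\<xi> y) \<noteq> 0} \<subseteq> closure {y. \<phi> y \<noteq> 0} \<union> closure {y. \<xi> y \<noteq> 0}"
    by (metis closure_Un closure_mono)
  moreover have "compact (closure {y. \<phi> y \<noteq> 0} \<union> closure {y. \<xi> y \<noteq> 0})"
    using a by (auto simp: Cc_def)
  ultimately have "compact (closure {y. max (\<phi> y) (\<xi> y) \<noteq> 0})"
    by (rule compact_closure_subset)
  then show ?thesis using a by (auto simp: Cc_def intro!: continuous_intros)
qed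

lemma Cc_subset_support:
  fixes \<phi> :: "'b::topological_space \<Rightarrow> real" and \<xi> :: "'b \<Rightarrow> real"
  assumes "\<phi> \<in> Cc" "continuous_on UNIV \<xi>" "\<And>z. \<phi> z = 0 \<Longrightarrow> \<xi> z = 0"
  shows "\<xi> \<in> Cc"
proof -
  have "closure {y. \<xi> y \<noteq> 0} \<subseteq> closure {y. \<phi> y \<noteq> 0}"
    using assms by (intro closure_mono) auto
  then have "compact (closure {y. \<xi> y \<noteq> 0})"
    using assms(1) by (intro compact_closure_subset) (auto simp: Cc_def)
  then show ?thesis using assms by (auto simp: Cc_def)
qed

lemma Cc_zero: "(\<lambda>_. 0) \<in> Cc"
  by (auto simp: Cc_def)

lemma Cc_below_directed:
  assumes "\<phi> \<in> Cc_below g" "\<xi> \<in> Cc_below g"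
  shows "\<exists>\<eta>\<in>Cc_below g. (\<forall>x. \<phi> x \<le> \<eta> x) \<and> (\<forall>x. \<xi> x \<le> \<eta> x)"
  using assms by (intro bexI[of _ "\<lambda>z. max (\<phi> z) (\<xi> z)"])
    (auto simp: Cc_below_def max_def intro: Cc_max[unfolded max_def])

lemma Cc_below_nonempty: "Cc_below g \<noteq> {}"
  using Cc_zero by (auto simp: Cc_below_def)

text \<open>If \<open>r < g x\<close>, then \<open>r\<close> times a Urysohn function for the point
  \<open>x\<close> inside the open set where \<open>g\<close> exceeds \<open>r\<close> is a minorant
  with value \<open>r\<close> at \<open>x\<close>.\<close>

lemma lsc_eq_SUP_Cc_below:
  fixes g :: "'b::t2_space \<Rightarrow> ennreal"
  assumes lc: "locally_compact_space (euclidean :: 'b topology)" and "lsc g"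
  shows "g x = (SUP \<phi>\<in>Cc_below g. ennreal (\<phi> x))"
proof (rule antisym)
  show "(SUP \<phi>\<in>Cc_below g. ennreal (\<phi> x)) \<le> g x"
    by (auto simp: Cc_below_def intro!: SUP_least)
  show "g x \<le> (SUP \<phi>\<in>Cc_below g. ennreal (\<phi> x))"
  proof (rule dense_le)
    fix r assume r: "r < g x"
    then have "r < top" using less_le_trans top_greatest by blast
    then obtain s where s: "r = ennreal s" "0 \<le> s" by (cases r) auto
    have "compact {x}" "open {y. r < g y}" "{x} \<subseteq> {y. r < g y}"
      using \<open>lsc g\<close> r by (auto simp: lsc_def)
    then obtain \<phi> where \<phi>: "\<phi> \<in> Cc" "\<And>z. 0 \<le> \<phi> z" "\<And>z. \<phi> z \<le> 1" "\<And>z. z \<in> {x} \<Longrightarrow> \<phi> z = 1"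
      "\<And>z. z \<notin> {y. r < g y} \<Longrightarrow> \<phi> z = (0::real)"
      using lc_Urysohn[OF lc] by metis
    have "(\<lambda>z. s * \<phi> z) \<in> Cc"
      using \<phi>(1) by (rule Cc_subset_support) (use \<phi>(1) in \<open>auto simp: Cc_def intro: continuous_on_mult_left\<close>)
    moreover have "ennreal (s * \<phi> z) \<le> g z" for z
    proof (cases "r < g z")
      case True
      have "ennreal (s * \<phi> z) \<le> ennreal s" using \<phi>(3)[of z] s by (intro ennreal_leI) (simp add: mult_left_le)
      also have "\<dots> \<le> g z" using True s by simp
      finally show ?thesis .
    qed (use \<phi>(5) in auto)
    ultimately have "(\<lambda>z. s * \<phi> z) \<in> Cc_below g"
      using \<phi> s by (auto simp: Cc_below_def)
    then show "r \<le> (SUP \<phi>\<in>Cc_below g. ennreal (\<phi> x))"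
      using \<phi>(4)[of x] s by (intro SUP_upper2[of "\<lambda>z. s * \<phi> z"]) auto
  qed
qed

section \<open>Integrals of lower semicontinuous functions\<close>

lemma radon_sets [simp, measurable_cong]: "radon M \<Longrightarrow> sets M = sets borel"
  by (simp add: radon_def)

lemma radon_space [simp]: "radon M \<Longrightarrow> space M = UNIV"
  using sets_eq_imp_space_eq[OF radon_sets, of M] by simp

lemma radon_compact_finite: "radon M \<Longrightarrow> compact K \<Longrightarrow> emeasure M K < \<infinity>"
  unfolding radon_def by (elim conjE) simp

lemma radon_eq_INF:
  "radon M \<Longrightarrow> B \<in> sets borel \<Longrightarrow> emeasure M B = (INF U \<in> {U. open U \<and> B \<subseteq> U}. emeasure M U)"
  unfolding radon_def by (elim conjE) (rule bspec)

lemma radon_eq_SUP: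
  "radon M \<Longrightarrow> open U \<Longrightarrow> emeasure M U = (SUP K \<in> {K. compact K \<and> K \<subseteq> U}. emeasure M K)"
  unfolding radon_def by (elim conjE) (rule mp, erule spec)

lemma radon_outer:
  assumes "radon M" "B \<in> sets borel" "emeasure M B < r"
  shows "\<exists>U. open U \<and> B \<subseteq> U \<and> emeasure M U < r"
  using radon_eq_INF[OF assms(1,2)] assms(3) by (auto simp: INF_less_iff)

lemma radon_inner:
  assumes "radon M" "open U" "r < emeasure M U"
  shows "\<exists>K. compact K \<and> K \<subseteq> U \<and> r < emeasure M K"
  using radon_eq_SUP[OF assms(1,2)] assms(3) by (auto simp: less_SUP_iff)

text \<open>Density of the order turns the weak bounds in \<open>outer\<close> and
  \<open>inner\<close> into the exact infimum and supremum, which spares the constructions below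
  from producing strict inequalities.\<close>

lemma radonI:
  assumes "sets M = sets borel" "\<And>K. compact K \<Longrightarrow> emeasure M K < \<infinity>"
    and outer: "\<And>B r. B \<in> sets borel \<Longrightarrow> emeasure M B < r \<Longrightarrow> \<exists>U. open U \<and> B \<subseteq> U \<and> emeasure M U \<le> r"
    and inner: "\<And>U r. open U \<Longrightarrow> r < emeasure M U \<Longrightarrow> \<exists>K. compact K \<and> K \<subseteq> U \<and> r \<le> emeasure M K"
  shows "radon M"
  unfolding radon_def
proof (intro conjI allI ballI impI)
  show "sets M = sets borel" "\<And>K. compact K \<Longrightarrow> emeasure M K < \<infinity>" by fact+
  fix B :: "'a set" assume B: "B \<in> sets borel"
  show "emeasure M B = (INF U \<in> {U. open U \<and> B \<subseteq> U}. emeasure M U)"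
  proof (rule antisym)
    show "emeasure M B \<le> (INF U \<in> {U. open U \<and> B \<subseteq> U}. emeasure M U)"
      using assms(1) by (auto intro!: INF_greatest emeasure_mono)
    show "(INF U \<in> {U. open U \<and> B \<subseteq> U}. emeasure M U) \<le> emeasure M B"
    proof (rule dense_ge)
      fix r assume "emeasure M B < r"
      then obtain U where "open U" "B \<subseteq> U" "emeasure M U \<le> r" using outer[OF B] by blast
      then show "(INF U \<in> {U. open U \<and> B \<subseteq> U}. emeasure M U) \<le> r" by (intro INF_lower2[of U]) auto
    qed
  qed
next
  fix U :: "'a set" assume U: "open U"
  show "emeasure M U = (SUP K \<in> {K. compact K \<and> K \<subseteq> U}. emeasure M K)"
  proof (rule antisym)
    show "(SUP K \<in> {K. compact K \<and> K \<subseteq> U}. emeasure M K) \<le> emeasure M U"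
      using assms(1) U by (auto intro!: SUP_least emeasure_mono)
    show "emeasure M U \<le> (SUP K \<in> {K. compact K \<and> K \<subseteq> U}. emeasure M K)"
    proof (rule dense_le)
      fix r assume "r < emeasure M U"
      then obtain K where "compact K" "K \<subseteq> U" "r \<le> emeasure M K" using inner[OF U] by blast
      then show "r \<le> (SUP K \<in> {K. compact K \<and> K \<subseteq> U}. emeasure M K)" by (intro SUP_upper2[of K]) auto
    qed
  qed
qed

text \<open>Compact sets determine the measure of open sets by inner regularity, and these determine
  all Borel sets by outer regularity.\<close>

lemma radon_eqI:
  assumes "radon M" "radon N" "\<And>K. compact K \<Longrightarrow> emeasure M K = emeasure N K"
  shows "M = N"
proof (rule measure_eqI)
  show "sets M = sets N" using assms by simp
  have "emeasure M U = emeasure N U" if "open U" for U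
    using radon_eq_SUP[OF assms(1) that] radon_eq_SUP[OF assms(2) that] assms(3) by simp
  then have "(INF U \<in> {U. open U \<and> B \<subseteq> U}. emeasure M U) = (INF U \<in> {U. open U \<and> B \<subseteq> U}. emeasure N U)" for B
    by (intro INF_cong) auto
  then show "emeasure M B = emeasure N B" if "B \<in> sets M" for B
    using that assms(1) by (simp only: radon_eq_INF[OF assms(1)] radon_eq_INF[OF assms(2)] radon_sets)
qed

lemma radon_null: "radon (null_measure borel)"
  by (rule radonI) (auto intro: exI[of _ UNIV])

text \<open>A compact subset of the union is covered by finitely many members, hence by a single
  one. This yields continuity from below for uncountable directed families, where countable
  additivity says nothing.\<close>

lemma radon_SUP_open:
  fixes U :: "'i \<Rightarrow> 'a::topological_space set"
  assumes M: "radon M" and "I \<noteq> {}" and op: "\<And>i. i \<in> I \<Longrightarrow> open (U i)"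
    and dir: "\<And>i j. i \<in> I \<Longrightarrow> j \<in> I \<Longrightarrow> \<exists>k\<in>I. U i \<subseteq> U k \<and> U j \<subseteq> U k"
  shows "emeasure M (\<Union>i\<in>I. U i) = (SUP i\<in>I. emeasure M (U i))"
proof (rule antisym)
  show "(SUP i\<in>I. emeasure M (U i)) \<le> emeasure M (\<Union>i\<in>I. U i)"
    using op M by (intro SUP_least emeasure_mono) (auto intro!: borel_open)
  show "emeasure M (\<Union>i\<in>I. U i) \<le> (SUP i\<in>I. emeasure M (U i))"
  proof (rule dense_le)
    fix r assume "r < emeasure M (\<Union>i\<in>I. U i)"
    moreover have "open (\<Union>i\<in>I. U i)" using op by auto
    ultimately obtain K where K: "compact K" "K \<subseteq> (\<Union>i\<in>I. U i)" "r < emeasure M K"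
      using radon_inner[OF M] by blast
    obtain J where J: "J \<subseteq> I" "finite J" "K \<subseteq> (\<Union>i\<in>J. U i)"
      using compactE_image[OF K(1) op K(2)] by metis
    have "\<exists>k\<in>I. \<forall>j\<in>J. U j \<subseteq> U k"
      using J(2,1)
    proof induction
      case empty then show ?case using \<open>I \<noteq> {}\<close> by blast
    next
      case (insert j J)
      then obtain k where k: "k \<in> I" "\<forall>j\<in>J. U j \<subseteq> U k" by auto
      then obtain l where "l \<in> I" "U k \<subseteq> U l" "U j \<subseteq> U l"
        using dir[OF k(1), of j] insert by auto
      then show ?case using k by (intro bexI[of _ l]) auto
    qed
    then obtain k where k: "k \<in> I" "\<forall>j\<in>J. U j \<subseteq> U k" ..
    have "emeasure M K \<le> emeasure M (U k)"
      using J k op M by (intro emeasure_mono) (auto intro!: borel_open)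
    then show "r \<le> (SUP i\<in>I. emeasure M (U i))"
      using K k by (intro SUP_upper2[of k]) auto
  qed
qed

text \<open>Lower approximation of \<open>g\<close> by a series of indicators of the superlevel sets
  \<open>{g > (k + 1) / (n + 1)}\<close>; in contrast to a simple function below \<open>g\<close>, it depends
  continuously on \<open>g\<close> along directed suprema.\<close>

definition level_approx :: "nat \<Rightarrow> ('b \<Rightarrow> ennreal) \<Rightarrow> 'b \<Rightarrow> ennreal" where
  "level_approx n g x = (\<Sum>k. ennreal (1 / (real n + 1)) * indicator {y. ennreal ((real k + 1) / (real n + 1)) < g y} x)"

text \<open>With \<open>d = 1 / (n + 1)\<close> the series counts the multiples
  \<open>(k + 1) * d\<close> strictly below \<open>g x\<close>, so it rounds a positive finite
  \<open>g x\<close> down to the largest multiple of \<open>d\<close> that is strictly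
  smaller.\<close>

lemma level_approx_bounds:
  shows "level_approx n g x \<le> g x" "g x \<le> level_approx n g x + ennreal (1 / (real n + 1))"
proof -
  define d where "d = 1 / (real n + 1)"
  have d: "0 < d" by (simp add: d_def)
  have eq: "level_approx n g x = (\<Sum>k. if ennreal ((real k + 1) * d) < g x then ennreal d else 0)"
    unfolding level_approx_def d_def by (intro suminf_cong) (auto simp: indicator_def)
  have "level_approx n g x \<le> g x \<and> g x \<le> level_approx n g x + ennreal d"
  proof (cases "g x")
    case (real r)
    \<comment> \<open>The strict inequality accounts for the subtraction of 1; at
      \<open>r = 0\<close> the integer is -1 and \<open>nat\<close> turns it into 0.\<close>
    define m where "m = nat (\<lceil>r / d\<rceil> - 1)"
    have lt: "ennreal ((real k + 1) * d) < g x \<longleftrightarrow> k < m" for k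
    proof -
      have "ennreal ((real k + 1) * d) < g x \<longleftrightarrow> (real k + 1) * d < r"
        using real d by (simp add: ennreal_less_iff)
      also have "\<dots> \<longleftrightarrow> real k + 1 < r / d" using d by (simp add: pos_less_divide_eq)
      also have "\<dots> \<longleftrightarrow> int k + 1 < \<lceil>r / d\<rceil>" by (simp add: less_ceiling_iff)
      also have "\<dots> \<longleftrightarrow> k < m" by (auto simp: m_def)
      finally show ?thesis .
    qed
    have "level_approx n g x = (\<Sum>k. if k < m then ennreal d else 0)"
      by (simp add: eq lt)
    also have "\<dots> = (\<Sum>k<m. if k < m then ennreal d else 0)"
      by (rule suminf_finite) auto
    also have "\<dots> = ennreal (real m * d)"
      using d by (simp add: ennreal_of_nat_eq_real_of_nat ennreal_mult')
    finally have la: "level_approx n g x = ennreal (real m * d)" .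
    have "real m \<le> r / d"
    proof -
      have "real m \<le> max 0 (real_of_int \<lceil>r / d\<rceil> - 1)" by (auto simp: m_def)
      also have "\<dots> \<le> r / d"
        using real d ceiling_correct[of "r / d"] by (simp add: max_def) 
      finally show ?thesis .
    qed
    then have 1: "real m * d \<le> r" using d by (simp add: pos_le_divide_eq)
    have "r / d \<le> real m + 1" unfolding m_def by linarith
    then have 2: "r \<le> real m * d + d" using d by (simp add: pos_divide_le_eq algebra_simps)
    show ?thesis
      using 1 2 d real by (auto simp: la ennreal_plus[symmetric] simp del: ennreal_plus intro!: ennreal_leI)
  next
    case top
    have "level_approx n g x = (\<Sum>k. ennreal d)" using top by (simp add: eq)
    \<comment> \<open>The series of a positive constant is read as its integral for the counting
      measure, whose total mass is infinite.\<close>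
    also have "\<dots> = top"
      using d by (subst nn_integral_count_space_nat[symmetric]) (simp add: ennreal_mult_top)
    finally show ?thesis using top by simp
  qed
  then show "level_approx n g x \<le> g x" "g x \<le> level_approx n g x + ennreal (1 / (real n + 1))"
    by (auto simp: d_def)
qed

lemma level_approx_tendsto: "(\<lambda>n. level_approx n g x) \<longlonglongrightarrow> g x"
proof (rule tendsto_sandwich)
  have "(\<lambda>n. 1 / (real n + 1)) \<longlonglongrightarrow> 0"
    using LIMSEQ_inverse_real_of_nat by (simp add: inverse_eq_divide add.commute)
  then have "(\<lambda>n. ennreal (1 / (real n + 1))) \<longlonglongrightarrow> ennreal 0" by (intro tendsto_ennrealI)
  then have "(\<lambda>n. g x - ennreal (1 / (real n + 1))) \<longlonglongrightarrow> g x - 0"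
    by (intro tendsto_diff_ennreal_general tendsto_const) auto
  then show "(\<lambda>n. g x - ennreal (1 / (real n + 1))) \<longlonglongrightarrow> g x" by simp
  show "\<forall>\<^sub>F n in sequentially. g x - ennreal (1 / (real n + 1)) \<le> level_approx n g x"
    using level_approx_bounds(2)[of g x] by (auto simp: ennreal_minus_le_iff add.commute)
  show "\<forall>\<^sub>F n in sequentially. level_approx n g x \<le> g x"
    by (intro always_eventually allI level_approx_bounds(1))
qed auto

lemma nn_integral_level_approx:
  assumes "lsc g" "sets M = sets borel"
  shows "(\<integral>\<^sup>+x. level_approx n g x \<partial>M) =
    (\<Sum>k. ennreal (1 / (real n + 1)) * emeasure M {y. ennreal ((real k + 1) / (real n + 1)) < g y})"
proof -
  have [measurable]: "{y. r < g y} \<in> sets M" for r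
    using assms by (auto simp: lsc_def)
  show ?thesis unfolding level_approx_def
    by (subst nn_integral_suminf) (simp_all add: nn_integral_cmult_indicator del: ennreal_suminf_cmult)
qed

text \<open>The superlevel sets of the supremum are directed unions of open sets, so
  \<open>radon_SUP_open\<close> applies to each term of the level series. The error of the level
  approximation is uniform but the measure may be infinite, hence the passage to the limit by
  Fatou's lemma.\<close>

lemma nn_integral_SUP_directed:
  fixes f :: "'i \<Rightarrow> 'a::topological_space \<Rightarrow> ennreal"
  assumes M: "radon M" and ne: "I \<noteq> {}" and lsc: "\<And>i. i \<in> I \<Longrightarrow> lsc (f i)"
    and dir: "\<And>i j. i \<in> I \<Longrightarrow> j \<in> I \<Longrightarrow> \<exists>k\<in>I. (\<forall>x. f i x \<le> f k x) \<and> (\<forall>x. f j x \<le> f k x)"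
  shows "(\<integral>\<^sup>+x. (SUP i\<in>I. f i x) \<partial>M) = (SUP i\<in>I. \<integral>\<^sup>+x. f i x \<partial>M)"
proof (rule antisym)
  show "(SUP i\<in>I. \<integral>\<^sup>+x. f i x \<partial>M) \<le> (\<integral>\<^sup>+x. (SUP i\<in>I. f i x) \<partial>M)"
    by (intro SUP_least nn_integral_mono SUP_upper)
  define g where "g = (\<lambda>x. SUP i\<in>I. f i x)"
  have g: "lsc g" unfolding g_def using lsc by (rule lsc_SUP)
  have sets: "sets M = sets borel" using M by simp
  have lev: "emeasure M {y. r < g y} = (SUP i\<in>I. emeasure M {y. r < f i y})" for r
  proof -
    have "{y. r < g y} = (\<Union>i\<in>I. {y. r < f i y})" by (auto simp: g_def less_SUP_iff)
    moreover have "\<exists>k\<in>I. {y. r < f i y} \<subseteq> {y. r < f k y} \<and> {y. r < f j y} \<subseteq> {y. r < f k y}"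
      if "i \<in> I" "j \<in> I" for i j
      using dir[OF that] by (auto intro: less_le_trans)
    ultimately show ?thesis
      using radon_SUP_open[OF M ne, of "\<lambda>i. {y. r < f i y}"] lsc by (auto simp: lsc_def)
  qed
  have la: "(\<integral>\<^sup>+x. level_approx n g x \<partial>M) \<le> (SUP i\<in>I. \<integral>\<^sup>+x. f i x \<partial>M)" for n
  proof -
    let ?t = "\<lambda>i k. ennreal (1 / (real n + 1)) * emeasure M {y. ennreal ((real k + 1) / (real n + 1)) < f i y}"
    have "(\<integral>\<^sup>+x. level_approx n g x \<partial>M) = (\<Sum>k. SUP i\<in>I. ?t i k)"
      by (simp add: nn_integral_level_approx[OF g sets] lev SUP_mult_left_ennreal)
    \<comment> \<open>Series and supremum commute because one index of the directed family dominates
      two given ones in all terms simultaneously.\<close>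
    also have "\<dots> = (SUP i\<in>I. \<Sum>k. ?t i k)"
    proof (rule ennreal_suminf_SUP_eq_directed)
      fix N :: "nat set" and i j assume ij: "i \<in> I" "j \<in> I"
      obtain k where k: "k \<in> I" "\<forall>x. f i x \<le> f k x" "\<forall>x. f j x \<le> f k x" using dir[OF ij] by auto
      have "{y. r < f k y} \<in> sets M" for r using lsc[OF k(1)] sets by (auto simp: lsc_def)
      then have "?t i n \<le> ?t k n \<and> ?t j n \<le> ?t k n" for n
        using k by (intro conjI mult_left_mono emeasure_mono) (auto intro: less_le_trans)
      then show "\<exists>k\<in>I. \<forall>n\<in>N. ?t i n \<le> ?t k n \<and> ?t j n \<le> ?t k n" using k(1) by blast
    qed
    also have "\<dots> = (SUP i\<in>I. \<integral>\<^sup>+x. level_approx n (f i) x \<partial>M)"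
      using lsc sets by (auto intro!: SUP_cong simp: nn_integral_level_approx)
    also have "\<dots> \<le> (SUP i\<in>I. \<integral>\<^sup>+x. f i x \<partial>M)"
      by (intro SUP_mono') (auto intro!: nn_integral_mono level_approx_bounds)
    finally show ?thesis .
  qed
  have meas: "level_approx n g \<in> borel_measurable M" for n
  proof -
    have [measurable]: "{y. r < g y} \<in> sets M" for r
      using g sets by (auto simp: lsc_def)
    show ?thesis unfolding level_approx_def[abs_def] by measurable
  qed
  \<comment> \<open>The approximations need not increase with \<open>n\<close>; Fatou suffices
    because all their integrals have the same upper bound.\<close>
  have "(\<integral>\<^sup>+x. g x \<partial>M) = (\<integral>\<^sup>+x. liminf (\<lambda>n. level_approx n g x) \<partial>M)"
    by (intro nn_integral_cong lim_imp_Liminf[symmetric] level_approx_tendsto) simp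
  also have "\<dots> \<le> liminf (\<lambda>n. \<integral>\<^sup>+x. level_approx n g x \<partial>M)"
    by (rule nn_integral_liminf) (rule meas)
  also have "\<dots> \<le> liminf (\<lambda>n. (SUP i\<in>I. \<integral>\<^sup>+x. f i x \<partial>M))"
    using la by (intro Liminf_mono) auto
  also have "\<dots> = (SUP i\<in>I. \<integral>\<^sup>+x. f i x \<partial>M)" by (simp add: Liminf_const)
  finally show "(\<integral>\<^sup>+x. (SUP i\<in>I. f i x) \<partial>M) \<le> (SUP i\<in>I. \<integral>\<^sup>+x. f i x \<partial>M)"
    by (simp add: g_def)
qed

lemma nn_integral_SUP_Cc_below:
  assumes M: "radon M" and lsc: "\<And>\<phi>. \<phi> \<in> Cc_below g \<Longrightarrow> lsc (F \<phi>)"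
    and mono: "\<And>\<phi> \<eta> x. (\<And>z. \<phi> z \<le> \<eta> z) \<Longrightarrow> F \<phi> x \<le> F \<eta> x"
  shows "(\<integral>\<^sup>+x. (SUP \<phi>\<in>Cc_below g. F \<phi> x) \<partial>M) = (SUP \<phi>\<in>Cc_below g. \<integral>\<^sup>+x. F \<phi> x \<partial>M)"
  by (rule nn_integral_SUP_directed[OF M Cc_below_nonempty lsc]) (assumption, meson Cc_below_directed mono)

lemma nn_integral_lsc_eq_SUP:
  fixes g :: "'a::t2_space \<Rightarrow> ennreal"
  assumes lc: "locally_compact_space (euclidean :: 'a topology)" and M: "radon M" and g: "lsc g"
  shows "(\<integral>\<^sup>+x. g x \<partial>M) = (SUP \<phi>\<in>Cc_below g. \<integral>\<^sup>+x. ennreal (\<phi> x) \<partial>M)"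
proof -
  have "(\<integral>\<^sup>+x. g x \<partial>M) = (\<integral>\<^sup>+x. (SUP \<phi>\<in>Cc_below g. ennreal (\<phi> x)) \<partial>M)"
    by (intro nn_integral_cong lsc_eq_SUP_Cc_below lc g)
  also have "\<dots> = (SUP \<phi>\<in>Cc_below g. \<integral>\<^sup>+x. ennreal (\<phi> x) \<partial>M)"
    by (rule nn_integral_SUP_Cc_below[OF M])
      (auto simp: Cc_below_def intro: lsc_continuous Cc_continuous ennreal_leI)
  finally show ?thesis .
qed

section \<open>Iterated integrals and Fubini's theorem\<close>

lemma Cc_support:
  assumes "\<phi> \<in> Cc"
  obtains K where "compact K" "\<And>x. x \<notin> K \<Longrightarrow> \<phi> x = 0"
  using assms closure_subset[of "{y. \<phi> y \<noteq> 0}"] by (auto simp: Cc_def)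

lemma Cc_bounded:
  assumes "\<phi> \<in> Cc"
  obtains B where "0 < B" "\<And>x. \<bar>\<phi> x\<bar> \<le> B"
proof -
  obtain K where K: "compact K" "\<And>x. x \<notin> K \<Longrightarrow> \<phi> x = 0" using Cc_support[OF assms] by blast
  have "bounded (\<phi> ` K)"
    using K(1) Cc_continuous[OF assms] compact_continuous_image compact_imp_bounded continuous_on_subset
    by (metis subset_UNIV)
  then obtain B where "0 < B" "\<forall>y\<in>\<phi> ` K. norm y \<le> B" unfolding bounded_pos by auto
  then show ?thesis using K(2) by (intro that[of B]) (force)+
qed

lemma continuous_borel_measurable_radon:
  "continuous_on UNIV (\<phi> :: 'a::topological_space \<Rightarrow> real) \<Longrightarrow> radon M \<Longrightarrow> \<phi> \<in> borel_measurable M"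
  using borel_measurable_continuous_onI measurable_cong_sets radon_sets by blast

lemma compact_borel: "compact (K :: 'a::t2_space set) \<Longrightarrow> K \<in> sets borel"
  by (simp add: borel_closed compact_imp_closed)

lemma radon_compact_sets: "radon (M :: 'a::t2_space measure) \<Longrightarrow> compact K \<Longrightarrow> K \<in> sets M"
  by (simp add: compact_borel)

lemma Cc_integrable:
  fixes M :: "'a::t2_space measure"
  assumes "\<phi> \<in> Cc" "radon M"
  shows "integrable M \<phi>"
proof (rule integrableI_bounded)
  show "\<phi> \<in> borel_measurable M"
    using assms continuous_borel_measurable_radon Cc_continuous by blast
  obtain K where K: "compact K" "\<And>x. x \<notin> K \<Longrightarrow> \<phi> x = 0" using Cc_support[OF assms(1)] by blast
  obtain B where B: "0 < B" "\<And>x. \<bar>\<phi> x\<bar> \<le> B" using Cc_bounded[OF assms(1)] by blast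
  have "(\<integral>\<^sup>+x. ennreal (norm (\<phi> x)) \<partial>M) \<le> (\<integral>\<^sup>+x. ennreal B * indicator K x \<partial>M)"
    using K B by (intro nn_integral_mono) (auto split: split_indicator simp: ennreal_leI)
  also have "\<dots> = ennreal B * emeasure M K"
    using radon_compact_sets[OF assms(2) K(1)] by (simp add: nn_integral_cmult_indicator)
  also have "\<dots> < \<infinity>"
    using radon_compact_finite[OF assms(2) K(1)] by (simp add: ennreal_mult_less_top)
  finally show "(\<integral>\<^sup>+x. ennreal (norm (\<phi> x)) \<partial>M) < \<infinity>" .
qed

lemma Cc_pair_support:
  assumes "(\<phi> :: 'a::topological_space \<times> 'a \<Rightarrow> real) \<in> Cc"
  obtains K where "compact K" "\<And>x y. \<phi> (x, y) \<noteq> 0 \<Longrightarrow> x \<in> K \<and> y \<in> K"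
proof -
  obtain S where S: "compact S" "\<And>x. x \<notin> S \<Longrightarrow> \<phi> x = 0" using Cc_support[OF assms] by blast
  have "compact (fst ` S \<union> snd ` S)"
    using S(1) by (intro compact_Un compact_continuous_image continuous_on_fst continuous_on_snd continuous_on_id)
  then show ?thesis using S(2) by (intro that[of "fst ` S \<union> snd ` S"]) force+
qed

lemma Cc_compose:
  fixes h :: "'a::t2_space \<Rightarrow> 'b::topological_space"
  assumes "\<phi> \<in> Cc" "continuous_on UNIV h" "compact K" "\<And>y. \<phi> (h y) \<noteq> 0 \<Longrightarrow> y \<in> K"
  shows "(\<lambda>y. \<phi> (h y)) \<in> Cc"
proof -
  have "closure {y. \<phi> (h y) \<noteq> 0} \<subseteq> K"
    using assms(3,4) by (intro closure_minimal) (auto simp: compact_imp_closed)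
  then have "compact (closure {y. \<phi> (h y) \<noteq> 0})" using assms(3) by (rule compact_closure_subset)
  moreover have "continuous_on UNIV (\<lambda>y. \<phi> (h y))"
    using continuous_on_compose2[OF Cc_continuous[OF assms(1)] assms(2)] by auto
  ultimately show ?thesis by (simp add: Cc_def)
qed

lemma Cc_section:
  fixes \<phi> :: "'a::t2_space \<times> 'a \<Rightarrow> real"
  assumes "\<phi> \<in> Cc"
  shows "(\<lambda>y. \<phi> (x, y)) \<in> Cc" "(\<lambda>y. \<phi> (y, x)) \<in> Cc" "(\<lambda>z. \<phi> (snd z, fst z)) \<in> Cc"
proof -
  obtain K where K: "compact K" "\<And>x y. \<phi> (x, y) \<noteq> 0 \<Longrightarrow> x \<in> K \<and> y \<in> K"
    using Cc_pair_support[OF assms] by blast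
  show "(\<lambda>y. \<phi> (x, y)) \<in> Cc" "(\<lambda>y. \<phi> (y, x)) \<in> Cc"
    using K(2) by (intro Cc_compose[OF assms _ K(1)] continuous_on_Pair continuous_on_const continuous_on_id; blast)+
  have "continuous_on UNIV (\<lambda>z. (snd z, fst z) :: 'a \<times> 'a)"
    by (intro continuous_on_Pair continuous_on_fst continuous_on_snd continuous_on_id)
  from Cc_compose[OF assms this compact_Times[OF K(1,1)]]
  show "(\<lambda>z. \<phi> (snd z, fst z)) \<in> Cc" using K(2) by (auto simp: mem_Times_iff)
qed

abbreviation nn_row :: "('a \<times> 'a \<Rightarrow> real) \<Rightarrow> 'a measure \<Rightarrow> 'a \<Rightarrow> ennreal" where
  "nn_row \<phi> N x \<equiv> \<integral>\<^sup>+y. ennreal (\<phi> (x, y)) \<partial>N"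

text \<open>Compactness of \<open>K\<close> makes the sections at \<open>x\<close> and
  \<open>x0\<close> uniformly close on \<open>K\<close>, outside which both vanish; since
  \<open>K\<close> has finite measure, the integral drops only a little.\<close>

lemma lsc_nn_integral_Cc:
  fixes \<phi> :: "'a::t2_space \<times> 'a \<Rightarrow> real"
  assumes \<phi>: "\<phi> \<in> Cc" "\<And>z. 0 \<le> \<phi> z" and N: "radon N"
  shows "lsc (\<lambda>x. nn_row \<phi> N x)"
  unfolding lsc_def
proof (intro allI)
  fix r
  obtain K where K: "compact K" "\<And>x y. \<phi> (x, y) \<noteq> 0 \<Longrightarrow> x \<in> K \<and> y \<in> K"
    using Cc_pair_support[OF \<phi>(1)] by blast
  define m where "m = measure N K"
  have m: "emeasure N K = ennreal m" "0 \<le> m"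
    using radon_compact_finite[OF N K(1)] by (auto simp: m_def emeasure_eq_ennreal_measure)
  have meas: "(\<lambda>y. ennreal (\<phi> (x, y))) \<in> borel_measurable N" for x
    using continuous_borel_measurable_radon[OF Cc_continuous[OF Cc_section(1)[OF \<phi>(1)]] N] by simp
  show "open {x. r < nn_row \<phi> N x}"
  proof (subst open_subopen, intro ballI, clarify)
    fix x0 assume r: "r < nn_row \<phi> N x0"
    have "nn_row \<phi> N x0 < \<infinity>"
      using Cc_integrable[OF Cc_section(1)[OF \<phi>(1)] N, of x0] \<phi>(2) by (simp add: integrable_iff_bounded)
    then obtain a where a: "nn_row \<phi> N x0 = ennreal a" "0 \<le> a"
      by (cases "nn_row \<phi> N x0") auto
    obtain s where s: "r = ennreal s" "0 \<le> s" "s < a"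
      using r a by (cases r) (auto simp: ennreal_less_iff)
    \<comment> \<open>Chosen so that \<open>e * m + e = a - s\<close>; the extra \<open>e\<close>
      leaves a strict inequality even when \<open>m = 0\<close>.\<close>
    define e where "e = (a - s) / (m + 1)"
    have "0 < e" using s m by (simp add: e_def)
    moreover have "e * (m + 1) = a - s" using m by (simp add: e_def)
    then have "e * m + e = a - s" by (simp add: algebra_simps)
    ultimately have e: "0 < e" "s + e * m < a" by linarith+
    have "continuous_on (UNIV \<times> K) \<phi>" using Cc_continuous[OF \<phi>(1)] continuous_on_subset by blast
    then obtain X0 where X0: "x0 \<in> X0" "open X0" "\<forall>x\<in>X0 \<inter> UNIV. \<forall>t\<in>K. dist (\<phi> (x, t)) (\<phi> (x0, t)) \<le> e"
      using continuous_on_prod_compactE[OF _ K(1) UNIV_I e(1)] by metis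
    have "r < nn_row \<phi> N x" if x: "x \<in> X0" for x
    proof -
      have "nn_row \<phi> N x0 \<le> (\<integral>\<^sup>+y. ennreal (\<phi> (x, y)) + ennreal e * indicator K y \<partial>N)"
      proof (intro nn_integral_mono)
        fix y
        show "ennreal (\<phi> (x0, y)) \<le> ennreal (\<phi> (x, y)) + ennreal e * indicator K y"
        proof (cases "y \<in> K")
          case True
          then have "\<phi> (x0, y) \<le> \<phi> (x, y) + e" using X0(3)[rule_format, of x y] x by (simp add: dist_real_def abs_le_iff)
          then show ?thesis using True \<phi>(2)[of "(x,y)"] e(1) by (auto simp: ennreal_plus[symmetric] simp del: ennreal_plus intro!: ennreal_leI)
        next
          case False
          then have "\<phi> (x0, y) = 0" using K(2)[of x0 y] by blast
          then show ?thesis by simp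
        qed
      qed
      also have "\<dots> = nn_row \<phi> N x + ennreal e * ennreal m"
        using radon_compact_sets[OF N K(1)] meas by (simp add: nn_integral_add nn_integral_cmult_indicator m)
      finally have le: "ennreal a \<le> nn_row \<phi> N x + ennreal (e * m)"
        using e m a by (simp add: ennreal_mult)
      show ?thesis
      proof (rule ccontr)
        assume "\<not> r < nn_row \<phi> N x"
        then have "ennreal a \<le> ennreal s + ennreal (e * m)"
          using le s(1) by (metis add_right_mono leI order_trans)
        then show False using e m s by (simp add: ennreal_plus[symmetric] del: ennreal_plus)
      qed
    qed
    then show "\<exists>T. open T \<and> x0 \<in> T \<and> T \<subseteq> {x. r < nn_row \<phi> N x}"
      using X0 by blast
  qed
qed

text \<open>The Borel algebra of the square can be larger than the product of the Borel algebras,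
  but each superlevel set of a function in \<open>Cc\<close> is a countable union of open rectangles.\<close>

lemma Cc_product_measurable:
  fixes \<phi> :: "'a::t2_space \<times> 'a \<Rightarrow> real"
  assumes \<phi>: "\<phi> \<in> Cc" "\<And>z. 0 \<le> \<phi> z"
  shows "\<phi> \<in> borel_measurable (borel \<Otimes>\<^sub>M borel)"
proof (rule borel_measurableI_greater)
  fix r :: real
  have "{z. r < \<phi> z} \<in> sets (borel \<Otimes>\<^sub>M borel)"
  proof (cases "r < 0")
    case True
    then have "{z. r < \<phi> z} = UNIV \<times> UNIV" using \<phi>(2) by (auto intro: less_le_trans)
    moreover have "UNIV \<times> UNIV \<in> sets (borel \<Otimes>\<^sub>M borel :: ('a \<times> 'a) measure)"
      by (intro pair_measureI) auto
    ultimately show ?thesis by simp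
  next
    case False
    have op: "open {z. r < \<phi> z}" using Cc_continuous[OF \<phi>(1)] by (intro open_Collect_less continuous_on_const)
    obtain S where S: "compact S" "\<And>x. x \<notin> S \<Longrightarrow> \<phi> x = 0" using Cc_support[OF \<phi>(1)] by blast
    have "\<exists>R. R \<in> sets (borel \<Otimes>\<^sub>M borel) \<and> {z. r + 1 / (real n + 1) \<le> \<phi> z} \<subseteq> R \<and> R \<subseteq> {z. r < \<phi> z}" for n
    proof -
      define C where "C = {z. r + 1 / (real n + 1) \<le> \<phi> z}"
      have pos: "0 < 1 / (real n + 1)" by simp
      have "closed C" unfolding C_def
        using Cc_continuous[OF \<phi>(1)] by (intro closed_Collect_le continuous_on_const)
      \<comment> \<open>Here \<open>0 \<le> r\<close> makes \<open>\<phi>\<close> positive on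
        \<open>C\<close>, so that \<open>C\<close> is compact and finitely many rectangles cover it;
        for negative \<open>r\<close> the superlevel set is the whole square.\<close>
      moreover have "C \<subseteq> S" 
      proof
        fix z assume "z \<in> C"
        then have "0 < \<phi> z" using False pos less_le_trans[OF add_nonneg_pos[of r "1 / (real n + 1)"], of "\<phi> z"] unfolding C_def by simp
        then show "z \<in> S" using S(2)[of z] by auto
      qed
      ultimately have C: "compact C" using S(1) by (metis compact_Int_closed inf.absorb_iff2)
      define \<R> where "\<R> = {A \<times> B | A B. open A \<and> open B \<and> A \<times> B \<subseteq> {z. r < \<phi> z}}"
      have "C \<subseteq> \<Union>\<R>"
      proof
        fix z assume "z \<in> C"
        then have "z \<in> {z. r < \<phi> z}"
          using less_le_trans[of r "r + 1 / (real n + 1)" "\<phi> z"] unfolding C_def by simp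
        then obtain A B where "open A" "open B" "z \<in> A \<times> B" "A \<times> B \<subseteq> {z. r < \<phi> z}"
          using open_prod_elim[OF op] by metis
        then show "z \<in> \<Union>\<R>" unfolding \<R>_def by blast
      qed
      moreover have "\<And>R. R \<in> \<R> \<Longrightarrow> open R" unfolding \<R>_def by (auto intro: open_Times)
      ultimately obtain \<F> where \<F>: "\<F> \<subseteq> \<R>" "finite \<F>" "C \<subseteq> \<Union>\<F>"
        using compactE[OF C] by metis
      have "\<R> \<subseteq> sets (borel \<Otimes>\<^sub>M borel)" unfolding \<R>_def by auto
      then have "\<Union>\<F> \<in> sets (borel \<Otimes>\<^sub>M borel)" using \<F> by (intro sets.finite_Union) auto
      moreover have "\<Union>\<F> \<subseteq> {z. r < \<phi> z}" using \<F>(1) unfolding \<R>_def by blast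
      ultimately show ?thesis using \<F>(3) unfolding C_def by blast
    qed
    then obtain R where R: "\<And>n. R n \<in> sets (borel \<Otimes>\<^sub>M borel)"
      "\<And>n. {z. r + 1 / (real n + 1) \<le> \<phi> z} \<subseteq> R n" "\<And>n. R n \<subseteq> {z. r < \<phi> z}" by metis
    have "{z. r < \<phi> z} = (\<Union>n. R n)"
    proof
      show "{z. r < \<phi> z} \<subseteq> (\<Union>n. R n)"
      proof
        fix z assume "z \<in> {z. r < \<phi> z}"
        then obtain n where "inverse (real (Suc n)) < \<phi> z - r"
          using reals_Archimedean[of "\<phi> z - r"] by auto
        then have "z \<in> {z. r + 1 / (real n + 1) \<le> \<phi> z}" by (auto simp: inverse_eq_divide add.commute)
        then show "z \<in> (\<Union>n. R n)" using R(2) by blast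
      qed
    qed (use R(3) in blast)
    then show ?thesis using R(1) by auto
  qed
  then show "{x \<in> space (borel \<Otimes>\<^sub>M borel). r < \<phi> x} \<in> sets (borel \<Otimes>\<^sub>M borel)"
    by (simp add: space_pair_measure)
qed

lemma nn_integral_density_compact:
  fixes M :: "'a::t2_space measure"
  assumes "radon M" "compact K" "g \<in> borel_measurable M" "\<And>x. x \<notin> K \<Longrightarrow> g x = 0"
  shows "(\<integral>\<^sup>+x. g x \<partial>density M (indicator K)) = (\<integral>\<^sup>+x. g x \<partial>M)"
proof -
  have "(\<integral>\<^sup>+x. g x \<partial>density M (indicator K)) = (\<integral>\<^sup>+x. indicator K x * g x \<partial>M)"
    using radon_compact_sets[OF assms(1,2)] assms(3) by (intro nn_integral_density) auto
  also have "\<dots> = (\<integral>\<^sup>+x. g x \<partial>M)"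
    using assms(4) by (intro nn_integral_cong) (auto split: split_indicator)
  finally show ?thesis .
qed

lemma finite_density_compact:
  fixes M :: "'a::t2_space measure"
  assumes "radon M" "compact K"
  shows "finite_measure (density M (indicator K))"
proof (rule finite_measureI)
  have "emeasure (density M (indicator K)) (space (density M (indicator K))) = (\<integral>\<^sup>+x. indicator K x \<partial>M)"
    using radon_compact_sets[OF assms] by (subst emeasure_density) (auto intro!: nn_integral_cong)
  also have "\<dots> = emeasure M K"
    using radon_compact_sets[OF assms] by simp
  finally show "emeasure (density M (indicator K)) (space (density M (indicator K))) \<noteq> \<infinity>"
    using radon_compact_finite[OF assms] by simp
qed

text \<open>Both measures can be cut down to a compact set whose square carries
  \<open>\<phi>\<close>. There they are finite, and the theorem for sigma-finite measures applies
  thanks to \<open>Cc_product_measurable\<close>.\<close>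

lemma Cc_Fubini:
  fixes \<phi> :: "'a::t2_space \<times> 'a \<Rightarrow> real"
  assumes \<phi>: "\<phi> \<in> Cc" "\<And>z. 0 \<le> \<phi> z" and M: "radon M" and N: "radon N"
  shows "(\<integral>\<^sup>+x. nn_row \<phi> N x \<partial>M) = (\<integral>\<^sup>+y. \<integral>\<^sup>+x. ennreal (\<phi> (x, y)) \<partial>M \<partial>N)"
proof -
  obtain K where K: "compact K" "\<And>x y. \<phi> (x, y) \<noteq> 0 \<Longrightarrow> x \<in> K \<and> y \<in> K"
    using Cc_pair_support[OF \<phi>(1)] by blast
  let ?M = "density M (indicator K)" and ?N = "density N (indicator K)"
  interpret M: finite_measure ?M using M K(1) by (rule finite_density_compact)
  interpret N: finite_measure ?N using N K(1) by (rule finite_density_compact)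
  interpret pair_sigma_finite ?N ?M ..
  have sec: "(\<lambda>y. ennreal (\<phi> (x, y))) \<in> borel_measurable L" "(\<lambda>y. ennreal (\<phi> (y, x))) \<in> borel_measurable L"
    if "radon L" for x L
    using continuous_borel_measurable_radon[OF Cc_continuous[OF Cc_section(1)[OF \<phi>(1)]] that]
      continuous_borel_measurable_radon[OF Cc_continuous[OF Cc_section(2)[OF \<phi>(1)]] that] by simp_all
  have out: "(\<lambda>x. nn_row \<phi> L x) \<in> borel_measurable L'"
    "(\<lambda>x. \<integral>\<^sup>+y. ennreal (\<phi> (y, x)) \<partial>L) \<in> borel_measurable L'" if "radon L" "radon L'" for L L'
    using lsc_measurable[OF lsc_nn_integral_Cc[OF \<phi> that(1)] radon_sets[OF that(2)]]
      lsc_measurable[OF lsc_nn_integral_Cc[OF Cc_section(3)[OF \<phi>(1)] \<phi>(2) that(1)] radon_sets[OF that(2)]]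
    by simp_all
  have z: "\<phi> (x, y) = 0" if "x \<notin> K \<or> y \<notin> K" for x y using K(2) that by blast
  have "(\<integral>\<^sup>+x. nn_row \<phi> N x \<partial>M) = (\<integral>\<^sup>+x. nn_row \<phi> ?N x \<partial>M)"
    using z by (intro nn_integral_cong nn_integral_density_compact[symmetric] N K sec) auto
  also have "\<dots> = (\<integral>\<^sup>+x. nn_row \<phi> ?N x \<partial>?M)"
  proof (rule nn_integral_density_compact[symmetric, OF M K(1)])
    have "(\<lambda>x. nn_row \<phi> ?N x) = (\<lambda>x. nn_row \<phi> N x)"
      using z by (intro ext nn_integral_density_compact N K sec) auto
    then show "(\<lambda>x. nn_row \<phi> ?N x) \<in> borel_measurable M" using out(1)[OF N M] by simp
  qed (use z in simp)
  also have "\<dots> = (\<integral>\<^sup>+y. \<integral>\<^sup>+x. ennreal (\<phi> (x, y)) \<partial>?M \<partial>?N)"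
  proof (rule Fubini')
    have "(\<lambda>z. \<phi> (snd z, fst z)) \<in> borel_measurable (borel \<Otimes>\<^sub>M borel)"
      by (rule Cc_product_measurable[OF Cc_section(3)[OF \<phi>(1)]]) (rule \<phi>(2))
    then have "(\<lambda>z. \<phi> (snd z, fst z)) \<in> borel_measurable (?N \<Otimes>\<^sub>M ?M)"
      by (rule measurable_cong_sets[OF sets_pair_measure_cong refl, THEN equalityD2, THEN subsetD, rotated -1])
        (use M N in simp_all)
    then show "(\<lambda>(x, y). ennreal (\<phi> (y, x))) \<in> borel_measurable (?N \<Otimes>\<^sub>M ?M)"
      by (simp add: case_prod_beta')
  qed
  also have "\<dots> = (\<integral>\<^sup>+y. \<integral>\<^sup>+x. ennreal (\<phi> (x, y)) \<partial>?M \<partial>N)"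
  proof (rule nn_integral_density_compact[OF N K(1)])
    have "(\<lambda>x. \<integral>\<^sup>+y. ennreal (\<phi> (y, x)) \<partial>?M) = (\<lambda>x. \<integral>\<^sup>+y. ennreal (\<phi> (y, x)) \<partial>M)"
      using z by (intro ext nn_integral_density_compact M K sec) auto
    then show "(\<lambda>x. \<integral>\<^sup>+y. ennreal (\<phi> (y, x)) \<partial>?M) \<in> borel_measurable N" using out(2)[OF M N] by simp
  qed (use z in simp)
  also have "\<dots> = (\<integral>\<^sup>+y. \<integral>\<^sup>+x. ennreal (\<phi> (x, y)) \<partial>M \<partial>N)"
    using z by (intro nn_integral_cong nn_integral_density_compact M K sec) auto
  finally show ?thesis .
qed

section \<open>Potentials and energies of nonnegative kernels\<close>

definition npot :: "('a \<times> 'a \<Rightarrow> ennreal) \<Rightarrow> 'a measure \<Rightarrow> 'a \<Rightarrow> ennreal" where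
  "npot k M x = (\<integral>\<^sup>+y. k (x, y) \<partial>M)"

text \<open>An iterated integral, as the kernel need not be measurable for the product algebra; its
  symmetry is therefore a theorem, \<open>nenergy_commute\<close>.\<close>

definition nenergy :: "('a \<times> 'a \<Rightarrow> ennreal) \<Rightarrow> 'a measure \<Rightarrow> 'a measure \<Rightarrow> ennreal" where
  "nenergy k M N = (\<integral>\<^sup>+x. npot k N x \<partial>M)"

lemma npot_eq_SUP:
  fixes k :: "'a::t2_space \<times> 'a \<Rightarrow> ennreal"
  assumes lc: "locally_compact_space (euclidean :: 'a topology)" and k: "lsc k" and N: "radon N"
  shows "npot k N x = (SUP \<phi>\<in>Cc_below k. nn_row \<phi> N x)"
proof -
  have "npot k N x = (\<integral>\<^sup>+y. (SUP \<phi>\<in>Cc_below k. ennreal (\<phi> (x, y))) \<partial>N)"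
    unfolding npot_def
    by (intro nn_integral_cong lsc_eq_SUP_Cc_below[OF locally_compact_prod[OF lc] k])
  also have "\<dots> = (SUP \<phi>\<in>Cc_below k. nn_row \<phi> N x)"
    by (rule nn_integral_SUP_Cc_below[OF N])
      (auto simp: Cc_below_def intro: lsc_continuous Cc_continuous[OF Cc_section(1)] ennreal_leI)
  finally show ?thesis .
qed

lemma lsc_npot:
  fixes k :: "'a::t2_space \<times> 'a \<Rightarrow> ennreal"
  assumes lc: "locally_compact_space (euclidean :: 'a topology)" and k: "lsc k" and N: "radon N"
  shows "lsc (npot k N)"
proof -
  have "lsc (\<lambda>x. SUP \<phi>\<in>Cc_below k. nn_row \<phi> N x)"
    using N by (intro lsc_SUP lsc_nn_integral_Cc) (auto simp: Cc_below_def)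
  then show ?thesis using npot_eq_SUP[OF assms] by (metis (no_types, lifting) ext)
qed

text \<open>The supremum over minorants is pulled out of the inner and then of the outer integral,
  which brings the energy into the form used to define \<open>pos_energy\<close>.\<close>

lemma nenergy_eq_SUP:
  fixes k :: "'a::t2_space \<times> 'a \<Rightarrow> ennreal"
  assumes lc: "locally_compact_space (euclidean :: 'a topology)" and k: "lsc k" and M: "radon M" and N: "radon N"
  shows "nenergy k M N = (SUP \<phi>\<in>Cc_below k. \<integral>\<^sup>+x. nn_row \<phi> N x \<partial>M)"
proof -
  have "nenergy k M N = (\<integral>\<^sup>+x. (SUP \<phi>\<in>Cc_below k. nn_row \<phi> N x) \<partial>M)"
    unfolding nenergy_def by (intro nn_integral_cong npot_eq_SUP[OF lc k N])
  also have "\<dots> = (SUP \<phi>\<in>Cc_below k. \<integral>\<^sup>+x. nn_row \<phi> N x \<partial>M)"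
    by (rule nn_integral_SUP_Cc_below[OF M])
      (auto simp: Cc_below_def intro: lsc_nn_integral_Cc N nn_integral_mono ennreal_leI)
  finally show ?thesis .
qed

text \<open>Exchanging the coordinates maps minorants of a symmetric kernel to minorants, so Fubini
  for each minorant gives one inequality, and symmetry of the argument gives the other.\<close>

lemma nenergy_commute:
  fixes k :: "'a::t2_space \<times> 'a \<Rightarrow> ennreal"
  assumes lc: "locally_compact_space (euclidean :: 'a topology)" and k: "lsc k"
    and sym: "\<And>x y. k (x, y) = k (y, x)" and M: "radon M" and N: "radon N"
  shows "nenergy k M N = nenergy k N M"
proof -
  have le: "nenergy k M N \<le> nenergy k N M" if "radon M" "radon N" for M N
    unfolding nenergy_eq_SUP[OF lc k that] nenergy_eq_SUP[OF lc k that(2,1)]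
  proof (rule SUP_least)
    fix \<phi> assume \<phi>: "\<phi> \<in> Cc_below k"
    then have "(\<lambda>z. \<phi> (snd z, fst z)) \<in> Cc_below k"
      using sym by (auto simp: Cc_below_def intro: Cc_section(3)) (metis sym)
    then show "(\<integral>\<^sup>+x. nn_row \<phi> N x \<partial>M) \<le>
        (SUP \<phi>\<in>Cc_below k. \<integral>\<^sup>+x. nn_row \<phi> M x \<partial>N)"
      using Cc_Fubini[of \<phi> M N] \<phi> that by (intro SUP_upper2[of "\<lambda>z. \<phi> (snd z, fst z)"]) (auto simp: Cc_below_def)
  qed
  show ?thesis using le[OF M N] le[OF N M] by simp
qed

section \<open>Operations on Radon measures\<close>

definition add_measure :: "'a::topological_space measure \<Rightarrow> 'a measure \<Rightarrow> 'a measure" where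
  "add_measure M N = measure_of UNIV (sets borel) (\<lambda>B. emeasure M B + emeasure N B)"

lemma sets_add_measure [simp]: "sets (add_measure M N) = sets borel"
  unfolding add_measure_def using sets.sigma_sets_eq[of borel] by simp

lemma space_add_measure [simp]: "space (add_measure M N) = UNIV"
  unfolding add_measure_def by simp

lemma emeasure_add_measure:
  assumes "sets M = sets borel" "sets N = sets borel" "B \<in> sets borel"
  shows "emeasure (add_measure M N) B = emeasure M B + emeasure N B"
proof (rule emeasure_measure_of[OF add_measure_def])
  show "countably_additive (sets (add_measure M N)) (\<lambda>B. emeasure M B + emeasure N B)"
  proof (rule countably_additiveI)
    fix B :: "nat \<Rightarrow> 'a set"
    assume B: "range B \<subseteq> sets (add_measure M N)" "disjoint_family B"
    have "(\<Sum>i. emeasure M (B i) + emeasure N (B i)) = (\<Sum>i. emeasure M (B i)) + (\<Sum>i. emeasure N (B i))"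
      by (intro suminf_add[symmetric] summableI)
    then show "(\<Sum>i. emeasure M (B i) + emeasure N (B i)) = emeasure M (\<Union> (range B)) + emeasure N (\<Union> (range B))"
      using B assms by (simp add: suminf_emeasure)
  qed
qed (use assms in \<open>auto simp: positive_def\<close>)

lemma measurable_borel_sets:
  "g \<in> borel_measurable borel \<Longrightarrow> sets M = sets borel \<Longrightarrow> g \<in> borel_measurable M"
  using measurable_cong_sets by blast

lemma nn_integral_add_measure:
  assumes M: "sets M = sets borel" and N: "sets N = sets borel" and g: "g \<in> borel_measurable borel"
  shows "(\<integral>\<^sup>+x. g x \<partial>add_measure M N) = (\<integral>\<^sup>+x. g x \<partial>M) + (\<integral>\<^sup>+x. g x \<partial>N)"
  using g
proof (induction g rule: borel_measurable_induct)
  case (cong f g)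
  then have "f = g" by auto
  then show ?case using cong by simp
next
  case (set A)
  then show ?case using M N by (simp add: emeasure_add_measure)
next
  case (mult u c)
  have "u \<in> borel_measurable M" "u \<in> borel_measurable N" "u \<in> borel_measurable (add_measure M N)"
    using mult(2) M N by (simp_all add: measurable_borel_sets)
  then show ?case using mult by (simp add: nn_integral_cmult distrib_left)
next
  case (add u v)
  have "u \<in> borel_measurable M" "u \<in> borel_measurable N" "u \<in> borel_measurable (add_measure M N)"
     "v \<in> borel_measurable M" "v \<in> borel_measurable N" "v \<in> borel_measurable (add_measure M N)"
    using add(1,3) M N by (simp_all add: measurable_borel_sets)
  then show ?case using add by (simp add: nn_integral_add ac_simps)
next
  case (seq U)
  have m: "U i \<in> borel_measurable M" "U i \<in> borel_measurable N" "U i \<in> borel_measurable (add_measure M N)" for i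
    using seq(1) M N by (simp_all add: measurable_borel_sets)
  have "incseq (\<lambda>i. \<integral>\<^sup>+x. U i x \<partial>M)" "incseq (\<lambda>i. \<integral>\<^sup>+x. U i x \<partial>N)"
    using seq by (auto simp: incseq_def le_fun_def intro!: nn_integral_mono)
  then show ?case using seq m
    by (simp add: nn_integral_monotone_convergence_SUP[OF _ m(1)] nn_integral_monotone_convergence_SUP[OF _ m(2)]
        nn_integral_monotone_convergence_SUP[OF _ m(3)] image_comp ennreal_SUP_add)
qed

text \<open>The slack is shared equally between the two summands, so that in
  \<open>radon_add\<close> each measure can choose its own open superset.\<close>

lemma ennreal_split_add:
  fixes a b r :: ennreal
  assumes "a + b < r"
  shows "\<exists>a' b'. a < a' \<and> b < b' \<and> a' + b' \<le> r"
proof -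
  have "a < top" "b < top" using assms by (auto simp: top.not_eq_extremum[symmetric])
  then obtain x y where xy: "a = ennreal x" "0 \<le> x" "b = ennreal y" "0 \<le> y"
    by (cases a; cases b) auto
  \<comment> \<open>An infinite \<open>r\<close> is replaced by a finite number above
    \<open>x + y\<close>, so that the slack can be halved.\<close>
  define z where "z = (if r = top then x + y + 1 else enn2real r)"
  have z: "ennreal z \<le> r" "x + y < z"
  proof -
    show "ennreal z \<le> r" by (cases r) (auto simp: z_def)
    show "x + y < z" using assms xy
      by (cases r) (auto simp: z_def ennreal_plus[symmetric] ennreal_less_iff simp del: ennreal_plus)
  qed
  define d where "d = (z - x - y) / 2"
  have d: "0 < d" "(x + d) + (y + d) = z" using z by (auto simp: d_def field_simps)
  have "ennreal (x + d) + ennreal (y + d) \<le> r"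
    using z d xy by (simp add: ennreal_plus[symmetric] del: ennreal_plus)
  then show ?thesis using d xy by (intro exI[of _ "ennreal (x + d)"] exI[of _ "ennreal (y + d)"]) (auto simp: ennreal_less_iff)
qed

text \<open>Intersecting open supersets and uniting compact subsets yields sets that serve both
  measures at once.\<close>

lemma radon_add:
  fixes M N :: "'a::t2_space measure"
  assumes M: "radon M" and N: "radon N"
  shows "radon (add_measure M N)"
proof (rule radonI)
  note em = emeasure_add_measure[OF radon_sets[OF M] radon_sets[OF N]]
  show "sets (add_measure M N) = sets borel" by simp
  show "emeasure (add_measure M N) K < \<infinity>" if "compact K" for K
  proof (cases "K \<in> sets borel")
    case True
    then show ?thesis using radon_compact_finite[OF M that] radon_compact_finite[OF N that] em by simp
  next
    case False
    then show ?thesis by (simp add: emeasure_notin_sets)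
  qed
  fix r
  show "\<exists>U. open U \<and> B \<subseteq> U \<and> emeasure (add_measure M N) U \<le> r"
    if B: "B \<in> sets borel" "emeasure (add_measure M N) B < r" for B
  proof -
    have lt: "emeasure M B + emeasure N B < r" using B em by simp
    obtain a b where ab: "emeasure M B < a" "emeasure N B < b" "a + b \<le> r"
      using ennreal_split_add[OF lt] by blast
    obtain U V where U: "open U" "B \<subseteq> U" "emeasure M U < a" and V: "open V" "B \<subseteq> V" "emeasure N V < b"
      using radon_outer[OF M B(1) ab(1)] radon_outer[OF N B(1) ab(2)] by blast
    have "emeasure (add_measure M N) (U \<inter> V) = emeasure M (U \<inter> V) + emeasure N (U \<inter> V)"
      using U V by (intro em) auto
    also have "\<dots> \<le> emeasure M U + emeasure N V"
      using U V M N by (intro add_mono emeasure_mono) auto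
    also have "\<dots> \<le> a + b"
      using U V by (intro add_mono) auto
    also have "\<dots> \<le> r" by fact
    finally show ?thesis using U V by (intro exI[of _ "U \<inter> V"]) auto
  qed
  show "\<exists>K. compact K \<and> K \<subseteq> U \<and> r \<le> emeasure (add_measure M N) K"
    if U: "open U" "r < emeasure (add_measure M N) U" for U
  proof -
    have "emeasure M U + emeasure N U = (SUP K\<in>{K. compact K \<and> K \<subseteq> U}. emeasure M K + emeasure N K)"
      unfolding radon_eq_SUP[OF M U(1)] radon_eq_SUP[OF N U(1)]
    proof (rule SUP_add_directed_ennreal[symmetric])
      fix K L assume "K \<in> {K. compact K \<and> K \<subseteq> U}" "L \<in> {K. compact K \<and> K \<subseteq> U}"
      then show "\<exists>C\<in>{K. compact K \<and> K \<subseteq> U}. emeasure M K + emeasure N L \<le> emeasure M C + emeasure N C"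
        using radon_compact_sets[OF M] radon_compact_sets[OF N]
        by (intro bexI[of _ "K \<union> L"] add_mono emeasure_mono) auto
    qed
    then have "r < (SUP K\<in>{K. compact K \<and> K \<subseteq> U}. emeasure M K + emeasure N K)"
      using U em by simp
    then show ?thesis using em radon_compact_sets[OF M] M
      by (auto simp: less_SUP_iff intro: less_imp_le)
  qed
qed

lemma radon_scale:
  assumes M: "radon M" and "0 < c"
  shows "radon (scale_measure (ennreal c) M)"
proof (rule radonI)
  have inv: "ennreal (1 / c) * (ennreal c * x) = x" "ennreal c * (ennreal (1 / c) * x) = x" for x
    using \<open>0 < c\<close> by (simp_all add: mult.assoc[symmetric] ennreal_mult'[symmetric])
  have mono: "ennreal (1 / c) * x < ennreal (1 / c) * y" if "x < y" for x y
    using that inv(2)[of x] inv(2)[of y] by (metis leD linorder_not_less mult_left_mono zero_le)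
  show "sets (scale_measure (ennreal c) M) = sets borel" using M by simp
  show "emeasure (scale_measure (ennreal c) M) K < \<infinity>" if "compact K" for K
    using radon_compact_finite[OF M that] by (simp add: ennreal_mult_less_top)
  fix r
  show "\<exists>U. open U \<and> B \<subseteq> U \<and> emeasure (scale_measure (ennreal c) M) U \<le> r"
    if B: "B \<in> sets borel" "emeasure (scale_measure (ennreal c) M) B < r" for B
  proof -
    have "emeasure M B < ennreal (1 / c) * r" using mono[OF B(2)] inv(1) by simp
    then obtain U where U: "open U" "B \<subseteq> U" "emeasure M U < ennreal (1 / c) * r"
      using radon_outer[OF M B(1)] by blast
    then have "ennreal c * emeasure M U \<le> ennreal c * (ennreal (1 / c) * r)"
      by (intro mult_left_mono) auto
    then show ?thesis using U inv(2) by auto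
  qed
  show "\<exists>K. compact K \<and> K \<subseteq> U \<and> r \<le> emeasure (scale_measure (ennreal c) M) K"
    if U: "open U" "r < emeasure (scale_measure (ennreal c) M) U" for U
  proof -
    have "ennreal (1 / c) * r < emeasure M U" using mono[OF U(2)] inv(1) by simp
    then obtain K where K: "compact K" "K \<subseteq> U" "ennreal (1 / c) * r < emeasure M K"
      using radon_inner[OF M U(1)] by blast
    then have "ennreal c * (ennreal (1 / c) * r) \<le> ennreal c * emeasure M K"
      by (intro mult_left_mono) auto
    then show ?thesis using K inv(2) by auto
  qed
qed

section \<open>Energies and potentials as iterated integrals\<close>

text \<open>On a compact space finitely many of the open sets where \<open>g\<close> exceeds
  \<open>- n\<close> cover everything. This is the origin of the shifts of \<open>\<kappa>\<close>
  and \<open>\<psi>\<close>.\<close>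

lemma lsc_class_bounded_below:
  fixes g :: "'b::topological_space \<Rightarrow> ereal"
  assumes "g \<in> lsc_class"
  obtains c :: real where "0 \<le> c" "c = 0 \<or> compact (UNIV :: 'b set)" "\<And>y. 0 \<le> g y + ereal c"
proof (cases "\<forall>y. 0 \<le> g y")
  case True
  then show ?thesis by (intro that[of 0]) auto
next
  case False
  then have cpt: "compact (UNIV :: 'b set)" using assms by (auto simp: lsc_class_def)
  have ninf: "g y \<noteq> - \<infinity>" for y using assms by (auto simp: lsc_class_def)
  have op: "open {y. ereal (- real n) < g y}" for n :: nat
    using assms by (auto simp: lsc_class_def)
  have cov: "UNIV \<subseteq> (\<Union>n\<in>UNIV. {y. ereal (- real n) < g y})"
  proof
    fix y
    have "- g y \<noteq> \<infinity>" using ninf[of y] by (metis ereal_uminus_uminus uminus_ereal.simps(2))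
    then obtain n where "- g y < ereal (real n)" using less_PInf_Ex_of_nat[of "- g y"] by auto
    then have "ereal (- real n) < g y" by (metis ereal_uminus_less_reorder uminus_ereal.simps(1))
    then show "y \<in> (\<Union>n\<in>UNIV. {y. ereal (- real n) < g y})" by auto
  qed
  obtain D where D: "finite D" "UNIV \<subseteq> (\<Union>n\<in>D. {y. ereal (- real n) < g y})"
    by (rule compactE_image[OF cpt op cov])
  define c where "c = real (Max (insert 0 D))"
  have "0 \<le> g y + ereal c" for y
  proof -
    obtain n where "n \<in> D" "ereal (- real n) < g y" using D by blast
    moreover have "real n \<le> c" using D(1) \<open>n \<in> D\<close> by (simp add: c_def)
    ultimately show ?thesis by (cases "g y") auto
  qed
  then show ?thesis using cpt by (intro that[of c]) (auto simp: c_def)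
qed

text \<open>Truncation at zero does not affect the superlevel sets at nonnegative levels, so they
  are superlevel sets of \<open>g\<close> itself at the level lowered by \<open>c\<close>.\<close>

lemma lsc_e2ennreal_shift:
  assumes "g \<in> lsc_class"
  shows "lsc (\<lambda>z. e2ennreal (g z + ereal c))"
  unfolding lsc_def
proof
  fix r :: ennreal
  show "open {z. r < e2ennreal (g z + ereal c)}"
  proof (cases r)
    case (real s)
    have "r < e2ennreal (g z + ereal c) \<longleftrightarrow> ereal (s - c) < g z" for z
      using real assms by (cases "g z") (auto simp: lsc_class_def ennreal_less_iff)
    then show ?thesis using assms by (simp add: lsc_class_def)
  qed simp
qed

lemma lsc_class_measurable: "g \<in> lsc_class \<Longrightarrow> g \<in> borel_measurable borel"
  by (intro borel_measurableI_greater) (auto simp: lsc_class_def)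

lemma Cc_nn_iterated_finite:
  fixes \<phi> :: "'a::t2_space \<times> 'a \<Rightarrow> real"
  assumes \<phi>: "\<phi> \<in> Cc" "\<And>z. 0 \<le> \<phi> z" and M: "radon M" and N: "radon N"
  shows "(\<integral>\<^sup>+x. nn_row \<phi> N x \<partial>M) < top"
proof -
  obtain K where K: "compact K" "\<And>x y. \<phi> (x, y) \<noteq> 0 \<Longrightarrow> x \<in> K \<and> y \<in> K"
    using Cc_pair_support[OF \<phi>(1)] by blast
  obtain B where B: "0 < B" "\<And>x. \<bar>\<phi> x\<bar> \<le> B" using Cc_bounded[OF \<phi>(1)] by blast
  have le: "ennreal (\<phi> (x, y)) \<le> ennreal B * indicator K y * indicator K x" for x y
    using K(2)[of x y] B(2)[of "(x, y)"] by (cases "\<phi> (x, y) = 0") (auto intro!: ennreal_leI)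
  have "(\<integral>\<^sup>+x. nn_row \<phi> N x \<partial>M) \<le> (\<integral>\<^sup>+x. \<integral>\<^sup>+y. ennreal B * indicator K y * indicator K x \<partial>N \<partial>M)"
    by (intro nn_integral_mono le)
  also have "\<dots> = (\<integral>\<^sup>+x. ennreal B * emeasure N K * indicator K x \<partial>M)"
    using radon_compact_sets[OF N K(1)]
    by (intro nn_integral_cong) (simp add: nn_integral_multc nn_integral_cmult_indicator)
  also have "\<dots> = ennreal B * emeasure N K * emeasure M K"
    using radon_compact_sets[OF M K(1)] by (simp add: nn_integral_cmult_indicator)
  also have "\<dots> < top"
    using radon_compact_finite[OF M K(1)] radon_compact_finite[OF N K(1)] by (simp add: ennreal_mult_less_top)
  finally show ?thesis .
qed

lemma Cc_iterated_nonneg: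
  fixes \<phi> :: "'a::t2_space \<times> 'a \<Rightarrow> real"
  assumes \<phi>: "\<phi> \<in> Cc" "\<And>z. 0 \<le> \<phi> z" and M: "radon M" and N: "radon N"
  shows "integrable M (\<lambda>x. \<integral>y. \<phi> (x, y) \<partial>N)"
    "ennreal (\<integral>x. (\<integral>y. \<phi> (x, y) \<partial>N) \<partial>M) = (\<integral>\<^sup>+x. nn_row \<phi> N x \<partial>M)"
proof -
  have en: "ennreal (\<integral>y. \<phi> (x, y) \<partial>N) = nn_row \<phi> N x" for x
    using Cc_integrable[OF Cc_section(1)[OF \<phi>(1)] N] \<phi>(2) by (intro nn_integral_eq_integral[symmetric]) auto
  have nn: "0 \<le> (\<integral>y. \<phi> (x, y) \<partial>N)" for x using \<phi>(2) by (intro Bochner_Integration.integral_nonneg) auto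
  \<comment> \<open>Measurability of the Bochner inner integral is inherited from the lower
    semicontinuous function \<open>nn_row \<phi> N\<close>.\<close>
  have "(\<lambda>x. nn_row \<phi> N x) \<in> borel_measurable M"
    using lsc_measurable[OF lsc_nn_integral_Cc[OF \<phi> N] radon_sets[OF M]] .
  then have "(\<lambda>x. ennreal (\<integral>y. \<phi> (x, y) \<partial>N)) \<in> borel_measurable M" by (simp add: en)
  then have "(\<lambda>x. enn2real (ennreal (\<integral>y. \<phi> (x, y) \<partial>N))) \<in> borel_measurable M" by measurable
  then have m: "(\<lambda>x. \<integral>y. \<phi> (x, y) \<partial>N) \<in> borel_measurable M" using nn by simp
  show i: "integrable M (\<lambda>x. \<integral>y. \<phi> (x, y) \<partial>N)"
    using Cc_nn_iterated_finite[OF assms] nn m by (simp add: integrable_iff_bounded en)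
  show "ennreal (\<integral>x. (\<integral>y. \<phi> (x, y) \<partial>N) \<partial>M) = (\<integral>\<^sup>+x. nn_row \<phi> N x \<partial>M)"
    using nn_integral_eq_integral[OF i] nn en by simp
qed

lemma Cc_iterated_integrable:
  fixes \<phi> :: "'a::t2_space \<times> 'a \<Rightarrow> real"
  assumes \<phi>: "\<phi> \<in> Cc" and M: "radon M" and N: "radon N"
  shows "integrable M (\<lambda>x. \<integral>y. \<phi> (x, y) \<partial>N)"
proof -
  let ?p = "\<lambda>z. max (\<phi> z) 0" and ?n = "\<lambda>z. max (- \<phi> z) 0"
  have p: "?p \<in> Cc" "?n \<in> Cc"
    using Cc_continuous[OF \<phi>] by (auto intro!: Cc_subset_support[OF \<phi>] continuous_on_max continuous_on_const continuous_on_minus)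
  have "(\<integral>y. \<phi> (x, y) \<partial>N) = (\<integral>y. ?p (x, y) \<partial>N) - (\<integral>y. ?n (x, y) \<partial>N)" for x
  proof -
    have "(\<integral>y. ?p (x, y) \<partial>N) - (\<integral>y. ?n (x, y) \<partial>N) = (\<integral>y. ?p (x, y) - ?n (x, y) \<partial>N)"
      by (intro Bochner_Integration.integral_diff[symmetric] Cc_integrable Cc_section p N)
    also have "(\<lambda>y. ?p (x, y) - ?n (x, y)) = (\<lambda>y. \<phi> (x, y))" by (auto simp: max_def)
    finally show ?thesis by simp
  qed
  then show ?thesis
    using Cc_iterated_nonneg(1)[OF p(1) _ M N] Cc_iterated_nonneg(1)[OF p(2) _ M N] by simp
qed

text \<open>The constant \<open>c\<close> compensates the possible negative values of the kernel; it vanishes unless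
  the space is compact, and then all Radon measures are finite.\<close>

locale kernel_space =
  fixes \<kappa> :: "'a::t2_space \<times> 'a \<Rightarrow> ereal" and c :: real
  assumes lc: "locally_compact_space (euclidean :: 'a topology)"
    and kernel: "kernel \<kappa>"
    and c_nonneg: "0 \<le> c" and c_cases: "c = 0 \<or> compact (UNIV :: 'a set)"
    and kernel_plus_c: "\<And>z. 0 \<le> \<kappa> z + ereal c"
begin

text \<open>By \<open>kernel_plus_c\<close> the conversion truncates nothing.\<close>

definition k :: "'a \<times> 'a \<Rightarrow> ennreal" where
  "k z = e2ennreal (\<kappa> z + ereal c)"

lemma lsc_k: "lsc k"
  using lsc_e2ennreal_shift[of \<kappa> c] kernel unfolding kernel_def k_def[abs_def] by blast

lemma k_commute: "k (x, y) = k (y, x)"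
  using kernel by (simp add: kernel_def k_def)

lemma ennreal_le_k_iff: "0 \<le> r \<Longrightarrow> ennreal r \<le> k z \<longleftrightarrow> ereal r \<le> \<kappa> z + ereal c"
  using kernel_plus_c[of z] unfolding k_def by (cases "\<kappa> z") auto

text \<open>A nonzero constant has compact support only if the space is compact, and
  \<open>c \<noteq> 0\<close> signals that case.\<close>

lemma Cc_shift:
  assumes \<phi>: "\<phi> \<in> (Cc :: ('a \<times> 'a \<Rightarrow> real) set)" and "b = 0 \<or> c \<noteq> 0"
  shows "(\<lambda>z. \<phi> z + b) \<in> Cc"
proof (cases "b = 0")
  case False
  then have "compact (UNIV \<times> UNIV :: ('a \<times> 'a) set)" using assms(2) c_cases by (intro compact_Times) auto
  then show ?thesis
    using Cc_continuous[OF \<phi>] compact_closure_subset[of _ UNIV]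
    by (auto simp: Cc_def intro!: continuous_on_add continuous_on_const)
qed (use \<phi> in simp)

abbreviation mass :: "'a measure \<Rightarrow> real" where
  "mass M \<equiv> measure M UNIV"

lemma radon_finite: "radon (M :: 'a measure) \<Longrightarrow> c \<noteq> 0 \<Longrightarrow> finite_measure M"
  using c_cases radon_compact_finite[of M UNIV] by (intro finite_measureI) auto

lemma integral_const_mass: "radon M \<Longrightarrow> (\<integral>x. b \<partial>M) = mass M * b"
  by (simp add: lebesgue_integral_const)

lemma iterated_shift:
  assumes \<phi>: "\<phi> \<in> Cc" and b: "b = 0 \<or> c \<noteq> 0" and M: "radon M" and N: "radon N"
  shows "(\<integral>x. (\<integral>y. \<phi> (x, y) + b \<partial>N) \<partial>M) = (\<integral>x. (\<integral>y. \<phi> (x, y) \<partial>N) \<partial>M) + b * mass M * mass N"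
proof (cases "b = 0")
  case False
  then interpret M: finite_measure M using radon_finite M b by blast
  interpret N: finite_measure N using radon_finite N b False by blast
  have "(\<integral>y. \<phi> (x, y) + b \<partial>N) = (\<integral>y. \<phi> (x, y) \<partial>N) + mass N * b" for x
    using Cc_integrable[OF Cc_section(1)[OF \<phi>] N] integral_const_mass[OF N] by simp
  then show ?thesis
    using Cc_iterated_integrable[OF \<phi> M N] integral_const_mass[OF M] by simp
qed simp

text \<open>Adding \<open>c\<close> turns minorants of \<open>\<kappa>\<close> into minorants of the
  shifted kernel and changes the iterated integral by exactly
  \<open>c * mass M * mass N\<close>.\<close>

lemma pos_energy_eq:
  assumes M: "radon M" and N: "radon N"
  shows "pos_energy \<kappa> M N = enn2ereal (nenergy k M N) - ereal (c * mass M * mass N)"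
proof -
  let ?I = "\<lambda>\<phi> :: 'a \<times> 'a \<Rightarrow> real. \<integral>x. (\<integral>y. \<phi> (x, y) \<partial>N) \<partial>M"
  define d where "d = c * mass M * mass N"
  have J: "nenergy k M N = (SUP \<phi>\<in>Cc_below k. \<integral>\<^sup>+x. nn_row \<phi> N x \<partial>M)"
    by (rule nenergy_eq_SUP[OF lc lsc_k M N])
  have below: "ennreal (?I \<phi>) \<le> nenergy k M N" if "\<phi> \<in> Cc_below k" for \<phi>
    unfolding J using that Cc_iterated_nonneg(2)[OF _ _ M N, of \<phi>]
    by (intro SUP_upper2[OF that]) (auto simp: Cc_below_def)
  have nn: "0 \<le> ?I \<phi>" if "\<And>z. 0 \<le> \<phi> z" for \<phi>
    using that by (intro Bochner_Integration.integral_nonneg) auto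
  show ?thesis unfolding d_def[symmetric]
  proof (rule antisym)
    show "pos_energy \<kappa> M N \<le> enn2ereal (nenergy k M N) - ereal d"
      unfolding pos_energy_def
    proof (rule SUP_least)
      fix \<phi> assume "\<phi> \<in> {\<phi> \<in> Cc. \<forall>z. ereal (\<phi> z) \<le> \<kappa> z}"
      then have \<phi>: "\<phi> \<in> Cc" "\<And>z. ereal (\<phi> z) \<le> \<kappa> z" by auto
      \<comment> \<open>Truncation at 0 keeps a minorant, because the shifted kernel is nonnegative,
        and can only increase the integral.\<close>
      let ?p = "\<lambda>z. max 0 (\<phi> z + c)"
      have sh: "(\<lambda>z. \<phi> z + c) \<in> Cc" using Cc_shift[OF \<phi>(1)] by blast
      have p: "?p \<in> Cc" by (rule Cc_max[OF Cc_zero sh])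
      have "ereal (?p z) \<le> \<kappa> z + ereal c" for z
        using \<phi>(2)[of z] kernel_plus_c[of z] add_right_mono[OF \<phi>(2)[of z], of "ereal c"] by (auto simp: max_def zero_ereal_def[symmetric])
      then have pk: "?p \<in> Cc_below k" using p ennreal_le_k_iff by (auto simp: Cc_below_def)
      have "?I \<phi> + d = ?I (\<lambda>z. \<phi> z + c)"
        using iterated_shift[OF \<phi>(1) _ M N, of c] by (auto simp: d_def)
      also have "\<dots> \<le> ?I ?p"
        using Cc_integrable[OF Cc_section(1)[OF sh] N] Cc_integrable[OF Cc_section(1)[OF p] N]
        by (intro integral_mono Cc_iterated_integrable[OF sh M N] Cc_iterated_integrable[OF p M N]) auto
      finally have "ereal (?I \<phi> + d) \<le> enn2ereal (ennreal (?I ?p))"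
        using nn[of ?p] by simp
      also have "\<dots> \<le> enn2ereal (nenergy k M N)" using below[OF pk] by (simp add: less_eq_ennreal.rep_eq)
      finally show "ereal (?I \<phi>) \<le> enn2ereal (nenergy k M N) - ereal d"
        by (simp add: ereal_le_minus)
    qed
    have up: "ereal (?I \<phi>) \<le> pos_energy \<kappa> M N + ereal d" if "\<phi> \<in> Cc_below k" for \<phi>
    proof -
      have \<phi>: "\<phi> \<in> Cc" "\<And>z. 0 \<le> \<phi> z" "\<And>z. ereal (\<phi> z) \<le> \<kappa> z + ereal c"
        using that by (auto simp: Cc_below_def ennreal_le_k_iff[symmetric])
      have "(\<lambda>z. \<phi> z + - c) \<in> Cc" using Cc_shift[OF \<phi>(1), of "-c"] by simp
      moreover have "ereal (\<phi> z + - c) \<le> \<kappa> z" for z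
        using \<phi>(3)[of z] by (cases "\<kappa> z") auto
      ultimately have "ereal (?I (\<lambda>z. \<phi> z + - c)) \<le> pos_energy \<kappa> M N"
        unfolding pos_energy_def by (intro SUP_upper) auto
      moreover have "?I (\<lambda>z. \<phi> z + - c) = ?I \<phi> - d"
        using iterated_shift[OF \<phi>(1) _ M N, of "-c"] by (auto simp: d_def)
      ultimately have "ereal (?I \<phi> - d) \<le> pos_energy \<kappa> M N" by simp
      from add_right_mono[OF this, of "ereal d"] show ?thesis by simp
    qed
    \<comment> \<open>The zero minorant shows that the shifted supremum is nonnegative, so
      \<open>e2ennreal\<close> loses nothing below.\<close>
    have "(\<lambda>_. 0) \<in> Cc_below k" using Cc_zero by (auto simp: Cc_below_def)
    from up[OF this] have S: "0 \<le> pos_energy \<kappa> M N + ereal d" by (simp add: zero_ereal_def)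
    have "nenergy k M N \<le> e2ennreal (pos_energy \<kappa> M N + ereal d)"
      unfolding J
    proof (rule SUP_least)
      fix \<phi> assume \<phi>: "\<phi> \<in> Cc_below k"
      then have "(\<integral>\<^sup>+x. nn_row \<phi> N x \<partial>M) = ennreal (?I \<phi>)"
        by (intro Cc_iterated_nonneg(2)[symmetric] M N) (auto simp: Cc_below_def)
      also have "\<dots> \<le> e2ennreal (pos_energy \<kappa> M N + ereal d)"
        using e2ennreal_mono[OF up[OF \<phi>]] by simp
      finally show "(\<integral>\<^sup>+x. nn_row \<phi> N x \<partial>M) \<le> e2ennreal (pos_energy \<kappa> M N + ereal d)" .
    qed
    then have "enn2ereal (nenergy k M N) \<le> pos_energy \<kappa> M N + ereal d"
      using S by (simp add: less_eq_ennreal.rep_eq enn2ereal_e2ennreal)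
    then show "enn2ereal (nenergy k M N) - ereal d \<le> pos_energy \<kappa> M N"
      by (simp add: ereal_minus_le)
  qed
qed

text \<open>Pointwise, the shifted kernel plus the negative part of \<open>\<kappa>\<close> equals
  its positive part plus \<open>c\<close>. Integrating this sum avoids subtraction until the
  negative part is known to have finite integral.\<close>

lemma pos_potential_eq:
  assumes M: "radon M"
  shows "pos_potential \<kappa> M x = enn2ereal (npot k M x) - ereal (c * mass M)"
proof -
  let ?a = "\<integral>\<^sup>+y. e2ennreal (\<kappa> (x, y)) \<partial>M" and ?b = "\<integral>\<^sup>+y. e2ennreal (- \<kappa> (x, y)) \<partial>M"
  have "\<kappa> \<in> borel_measurable borel" using kernel by (intro lsc_class_measurable) (simp add: kernel_def)
  then have "(\<lambda>y. \<kappa> (x, y)) \<in> borel_measurable borel"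
    by (rule measurable_compose[rotated]) (intro borel_measurable_continuous_onI continuous_on_Pair continuous_on_const continuous_on_id)
  then have m[measurable]: "(\<lambda>y. \<kappa> (x, y)) \<in> borel_measurable M"
    by (rule measurable_borel_sets[OF _ radon_sets[OF M]])
  have fin: "?b < top" "ennreal c * emeasure M UNIV = ennreal (c * mass M)"
  proof -
    have "e2ennreal (- \<kappa> (x, y)) \<le> ennreal c" for y
      using kernel_plus_c[of "(x, y)"] by (cases "\<kappa> (x, y)") (auto intro!: ennreal_leI simp: e2ennreal_neg)
    then have "?b \<le> (\<integral>\<^sup>+y. ennreal c \<partial>M)" by (intro nn_integral_mono)
    also have "\<dots> = ennreal c * emeasure M UNIV" using M by simp
    also have "\<dots> < top"
    proof (cases "c = 0")
      case False
      then interpret finite_measure M using radon_finite M by blast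
      show ?thesis by (simp add: emeasure_eq_measure ennreal_mult_less_top)
    qed simp
    finally show "?b < top" .
    show "ennreal c * emeasure M UNIV = ennreal (c * mass M)"
    proof (cases "c = 0")
      case False
      then interpret finite_measure M using radon_finite M by blast
      show ?thesis using c_nonneg by (simp add: emeasure_eq_measure ennreal_mult)
    qed simp
  qed
  have pt: "k (x, y) + e2ennreal (- \<kappa> (x, y)) = e2ennreal (\<kappa> (x, y)) + ennreal c" for y
    using kernel_plus_c[of "(x, y)"] c_nonneg
  proof (cases "\<kappa> (x, y)")
    case (real r)
    then show ?thesis using kernel_plus_c[of "(x, y)"] c_nonneg
      by (cases "0 \<le> r") (auto simp: k_def ennreal_neg ennreal_plus[symmetric] simp del: ennreal_plus)
  qed (auto simp: k_def)
  have "(\<lambda>y. k (x, y)) \<in> borel_measurable M" unfolding k_def by measurable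
  moreover have "(\<lambda>y. e2ennreal (- \<kappa> (x, y))) \<in> borel_measurable M"
    using m by (intro measurable_compose[OF _ measurable_e2ennreal] borel_measurable_uminus_ereal)
  ultimately have "npot k M x + ?b = (\<integral>\<^sup>+y. k (x, y) + e2ennreal (- \<kappa> (x, y)) \<partial>M)"
    unfolding npot_def by (intro nn_integral_add[symmetric])
  also have "\<dots> = ?a + ennreal c * emeasure M UNIV"
    unfolding pt using M by (simp add: nn_integral_add)
  finally have eq: "npot k M x + ?b = ?a + ennreal (c * mass M)" using fin(2) by simp
  have "0 \<le> c * mass M" using c_nonneg by simp
  then show ?thesis unfolding pos_potential_def
    using eq fin(1)
    by (cases "npot k M x"; cases ?a; cases ?b) (auto simp: ennreal_plus[symmetric] simp del: ennreal_plus)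
qed

end

section \<open>Regularity and the Jordan decomposition\<close>

text \<open>The sets that can be squeezed between a compact and an open set up to \<open>e\<close>
  inside \<open>W\<close> form a sigma-algebra containing the open sets; \<open>W\<close> having
  finite measure allows complements and continuity from above. Inner regularity is assumed for open
  sets only, so the lemma also serves measures not yet known to be Radon.\<close>

lemma finite_open_approx:
  fixes M :: "'a::t2_space measure"
  assumes sets: "sets M = sets borel" and cfin: "\<And>K. compact K \<Longrightarrow> emeasure M K < \<infinity>"
    and inner: "\<And>U r. open U \<Longrightarrow> r < emeasure M U \<Longrightarrow> \<exists>K. compact K \<and> K \<subseteq> U \<and> r < emeasure M K"
    and W: "open W" "emeasure M W < top" and B: "B \<in> sets borel" and e: "0 < (e::real)"
  shows "\<exists>K V. compact K \<and> open V \<and> K \<subseteq> B \<inter> W \<and> B \<inter> W \<subseteq> V \<and> V \<subseteq> W \<and> emeasure M (V - K) \<le> ennreal e"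
proof -
  have Ws: "W \<in> sets M" using W sets by simp
  have cs: "K \<in> sets M" if "compact K" for K using that sets by (simp add: compact_borel)
  have op: "\<exists>K. compact K \<and> K \<subseteq> U \<and> emeasure M (U - K) \<le> ennreal e" if U: "open U" "U \<subseteq> W" and e: "0 < e" for U e
  proof (cases "emeasure M U \<le> ennreal e")
    case True then show ?thesis by (intro exI[of _ "{}"]) auto
  next
    case False
    have finU: "emeasure M U < top" using emeasure_mono[OF U(2) Ws] W(2) by (rule le_less_trans)
    then have "emeasure M U - ennreal e < emeasure M U"
      using False e by (cases "emeasure M U") (auto simp: ennreal_minus ennreal_less_iff)
    then obtain K where K: "compact K" "K \<subseteq> U" "emeasure M U - ennreal e < emeasure M K"
      using inner[OF U(1)] by blast
    have "emeasure M (U - K) = emeasure M U - emeasure M K"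
      using K(2) U cs[OF K(1)] cfin[OF K(1)] sets by (intro emeasure_Diff) auto
    also have "\<dots> \<le> ennreal e" using less_imp_le[OF K(3)] finU by (auto simp: ennreal_minus_le_iff add.commute)
    finally show ?thesis using K by blast
  qed
  have "B \<in> sigma_sets UNIV {S. open S}" using B by (simp add: borel_def)
  then show ?thesis using e
  proof (induction arbitrary: e)
    case (Basic U)
    then have "open (U \<inter> W)" using W by auto
    from op[OF this _ Basic(2)] show ?case using \<open>open (U \<inter> W)\<close> by blast
  next
    case Empty
    then show ?case by (intro exI[of _ "{}"]) auto
  next
    case (Compl B)
    obtain K V where KV: "compact K" "open V" "K \<subseteq> B \<inter> W" "B \<inter> W \<subseteq> V" "V \<subseteq> W" "emeasure M (V - K) \<le> ennreal (e / 2)"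
      using Compl.IH[of "e / 2"] Compl.prems by auto
    \<comment> \<open>\<open>L\<close> exhausts \<open>W\<close> up to \<open>e / 2\<close>; the
      complement of \<open>B\<close> in \<open>W\<close> then lies between \<open>L - V\<close> and
      \<open>W - K\<close>.\<close>
    obtain L where L: "compact L" "L \<subseteq> W" "emeasure M (W - L) \<le> ennreal (e / 2)"
      using op[OF W(1) order_refl, of "e / 2"] Compl.prems by auto
    have "emeasure M ((W - K) - (L - V)) \<le> emeasure M ((V - K) \<union> (W - L))"
      using cs[OF KV(1)] cs[OF L(1)] KV(2) Ws sets by (intro emeasure_mono) auto
    also have "\<dots> \<le> emeasure M (V - K) + emeasure M (W - L)"
      using cs[OF KV(1)] cs[OF L(1)] KV(2) Ws sets by (intro emeasure_subadditive) auto
    also have "\<dots> \<le> ennreal (e / 2) + ennreal (e / 2)" using KV L by (intro add_mono) auto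
    also have "\<dots> = ennreal e" using Compl.prems by (simp add: ennreal_plus[symmetric] del: ennreal_plus)
    finally have "emeasure M ((W - K) - (L - V)) \<le> ennreal e" .
    moreover have "compact (L - V)" using L KV by (simp add: compact_diff)
    moreover have "open (W - K)" using W KV by (simp add: open_Diff compact_imp_closed)
    moreover have "L - V \<subseteq> (UNIV - B) \<inter> W" "(UNIV - B) \<inter> W \<subseteq> W - K" using KV L by blast+
    ultimately show ?case by blast
  next
    case (Union B)
    \<comment> \<open>These errors sum to \<open>e / 2\<close>; the other half pays for cutting the
      infinite union of the \<open>K n\<close> to a finite one, which is compact.\<close>
    have ep: "0 < e / 2 * (1 / 2) ^ Suc n" for n using Union.prems by simp
    have "\<forall>n. \<exists>K V. compact K \<and> open V \<and> K \<subseteq> B n \<inter> W \<and> B n \<inter> W \<subseteq> V \<and> V \<subseteq> W \<and> emeasure M (V - K) \<le> ennreal (e / 2 * (1 / 2) ^ Suc n)"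
      using Union.IH[OF ep] by blast
    then obtain K V where KV: "\<And>n. compact (K n)" "\<And>n. open (V n)" "\<And>n. K n \<subseteq> B n \<inter> W" "\<And>n. B n \<inter> W \<subseteq> V n"
      "\<And>n. V n \<subseteq> W" "\<And>n. emeasure M (V n - K n) \<le> ennreal (e / 2 * (1 / 2) ^ Suc n)" by metis
    let ?V = "\<Union>n. V n" and ?L = "\<lambda>m. \<Union>n\<le>m. K n"
    have s: "K n \<in> sets M" "V n \<in> sets M" for n using cs KV sets by auto
    have "emeasure M (?V - (\<Union>n. K n)) \<le> emeasure M (\<Union>n. V n - K n)"
      using s by (intro emeasure_mono) auto
    also have "\<dots> \<le> (\<Sum>n. emeasure M (V n - K n))"
      using s by (intro emeasure_subadditive_countably) auto
    also have "\<dots> \<le> (\<Sum>n. ennreal (e / 2 * (1 / 2) ^ Suc n))"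
      by (intro suminf_le KV summableI)
    also have "\<dots> = ennreal (e / 2)"
    proof -
      have "(\<lambda>n. e / 2 * (1 / 2) ^ Suc n) sums (e / 2 * 1)" by (intro sums_mult power_half_series)
      then show ?thesis using Union.prems by (intro sums_unique[symmetric]) (simp add: sums_ennreal)
    qed
    finally have le: "emeasure M (?V - (\<Union>n. K n)) \<le> ennreal (e / 2)" .
    have "(\<lambda>m. emeasure M (?V - ?L m)) \<longlonglongrightarrow> emeasure M (\<Inter>m. ?V - ?L m)"
    proof (rule Lim_emeasure_decseq)
      show "range (\<lambda>m. ?V - ?L m) \<subseteq> sets M" using s by auto
      show "decseq (\<lambda>m. ?V - ?L m)" by (auto simp: decseq_def)
      show "emeasure M (?V - ?L m) \<noteq> \<infinity>" for m
      proof -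
        have "emeasure M (?V - ?L m) \<le> emeasure M W" using KV(5) Ws by (intro emeasure_mono) auto
        then show ?thesis using W(2) by (auto simp: top_unique)
      qed
    qed
    then have lim: "(\<lambda>m. emeasure M (?V - ?L m)) \<longlonglongrightarrow> emeasure M (\<Inter>m. ?V - ?L m)" .
    have "(\<Inter>m. ?V - ?L m) = ?V - (\<Union>n. K n)" by auto
    then have "emeasure M (\<Inter>m. ?V - ?L m) \<le> ennreal (e / 2)" using le by simp
    also have "ennreal (e / 2) < ennreal e" using Union.prems by (simp add: ennreal_less_iff)
    finally have "\<forall>\<^sub>F m in sequentially. emeasure M (?V - ?L m) < ennreal e"
      by (rule order_tendstoD(2)[OF lim])
    then obtain m where "emeasure M (?V - ?L m) < ennreal e"
      by (auto simp: eventually_sequentially)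
    then have "emeasure M (?V - ?L m) \<le> ennreal e" by (rule less_imp_le)
    moreover have "compact (?L m)" using KV(1) by auto
    moreover have "open ?V" using KV(2) by auto
    moreover have "?L m \<subseteq> (\<Union>n. B n) \<inter> W" "(\<Union>n. B n) \<inter> W \<subseteq> ?V" "?V \<subseteq> W" using KV(3,4,5) by blast+
    ultimately show ?case
      by (intro exI[of _ "?L m"] exI[of _ ?V] conjI)
  qed
qed

lemma radon_inner_finite:
  fixes M :: "'a::t2_space measure"
  assumes M: "radon M" and C: "compact C" and B: "B \<in> sets borel" "B \<subseteq> C" and e: "0 < (e::real)"
  shows "\<exists>K. compact K \<and> K \<subseteq> B \<and> emeasure M (B - K) \<le> ennreal e"
proof -
  obtain W where W: "open W" "C \<subseteq> W" "emeasure M W < top"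
    using radon_outer[OF M compact_borel[OF C], of top] radon_compact_finite[OF M C] by auto
  have "B \<inter> W = B" using B W by auto
  then obtain K V where KV: "compact K" "open V" "K \<subseteq> B" "B \<subseteq> V" "emeasure M (V - K) \<le> ennreal e"
    using finite_open_approx[OF radon_sets[OF M] radon_compact_finite[OF M] radon_inner[OF M] W(1,3) B(1) e] by auto
  have "emeasure M (B - K) \<le> emeasure M (V - K)"
    using KV M compact_borel[OF KV(1)] by (intro emeasure_mono) auto
  then show ?thesis using KV order_trans by blast
qed

text \<open>Domination transfers the two-sided approximation from \<open>M\<close> to
  \<open>N\<close>, and with it both regularity properties.\<close>

lemma radon_dominated:
  fixes M N :: "'a::t2_space measure"
  assumes M: "radon M" and fin: "emeasure M UNIV < top" and N: "sets N = sets borel" and c: "0 \<le> (c::real)"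
    and le: "\<And>B. B \<in> sets borel \<Longrightarrow> emeasure N B \<le> ennreal c * emeasure M B"
  shows "radon N"
proof -
  have approx: "\<exists>K V. compact K \<and> open V \<and> K \<subseteq> B \<and> B \<subseteq> V \<and> emeasure N (V - K) \<le> ennreal e"
    if B: "B \<in> sets borel" and e: "0 < e" for B e
  proof -
    \<comment> \<open>The denominator \<open>c + 1\<close> covers the case
      \<open>c = 0\<close>.\<close>
    have "0 < e / (c + 1)" using e c by simp
    from finite_open_approx[OF radon_sets[OF M] radon_compact_finite[OF M] radon_inner[OF M] open_UNIV fin B this]
    obtain K V where KV: "compact K" "open V" "K \<subseteq> B" "B \<subseteq> V" "emeasure M (V - K) \<le> ennreal (e / (c + 1))"
      by auto
    have "emeasure N (V - K) \<le> ennreal c * ennreal (e / (c + 1))"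
      using KV compact_borel[OF KV(1)] by (intro order_trans[OF le] mult_left_mono) auto
    also have "\<dots> = ennreal (c * (e / (c + 1)))" by (rule ennreal_mult'[OF c, symmetric])
    also have "\<dots> \<le> ennreal e" using c e by (intro ennreal_leI) (simp add: field_simps)
    finally show ?thesis using KV by blast
  qed
  \<comment> \<open>A strict inequality in \<open>ennreal\<close> leaves room for a positive real
    number, also when the larger side is infinite.\<close>
  have gap: "\<exists>e>0. x + ennreal e \<le> y" if lt: "x < y" for x y
  proof -
    obtain d where d: "0 < d" "x + d \<le> y"
      using ennreal_split_add[of x 0 y] lt by (auto intro: order_trans[OF add_right_mono] less_imp_le)
    obtain e where "0 < e" "ennreal e \<le> d"
    proof (cases d)
      case (real r) then show ?thesis using d(1) that[of r] by simp
    next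
      case top then show ?thesis using that[of 1] by simp
    qed
    then show ?thesis using d(2) by (meson add_left_mono order_trans)
  qed
  show ?thesis
  proof (rule radonI[OF N])
    show "emeasure N K < \<infinity>" if "compact K" for K
      using le[OF compact_borel[OF that]] radon_compact_finite[OF M that]
      by (auto intro: le_less_trans simp: ennreal_mult_less_top)
    fix r
    show "\<exists>U. open U \<and> B \<subseteq> U \<and> emeasure N U \<le> r" if B: "B \<in> sets borel" "emeasure N B < r" for B
    proof -
      obtain e where e: "0 < e" "emeasure N B + ennreal e \<le> r" using gap[OF B(2)] by blast
      obtain K V where KV: "compact K" "open V" "K \<subseteq> B" "B \<subseteq> V" "emeasure N (V - K) \<le> ennreal e"
        using approx[OF B(1) e(1)] by blast
      have "emeasure N V \<le> emeasure N (B \<union> (V - K))"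
        using KV B(1) N compact_borel[OF KV(1)] by (intro emeasure_mono) auto
      also have "\<dots> \<le> emeasure N B + emeasure N (V - K)"
        using KV B(1) N compact_borel[OF KV(1)] by (intro emeasure_subadditive) auto
      also have "\<dots> \<le> emeasure N B + ennreal e" by (intro add_left_mono KV)
      finally show ?thesis using KV e(2) order_trans by blast
    qed
    show "\<exists>K. compact K \<and> K \<subseteq> U \<and> r \<le> emeasure N K" if U: "open U" "r < emeasure N U" for U
    proof -
      obtain e where e: "0 < e" "r + ennreal e \<le> emeasure N U" using gap[OF U(2)] by blast
      obtain K V where KV: "compact K" "open V" "K \<subseteq> U" "U \<subseteq> V" "emeasure N (V - K) \<le> ennreal e"
        using approx[OF borel_open[OF U(1)] e(1)] by blast
      have "emeasure N U \<le> emeasure N (K \<union> (V - K))"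
        using KV N compact_borel[OF KV(1)] by (intro emeasure_mono) auto
      also have "\<dots> \<le> emeasure N K + emeasure N (V - K)"
        using KV N compact_borel[OF KV(1)] by (intro emeasure_subadditive) auto
      also have "\<dots> \<le> emeasure N K + ennreal e" by (intro add_left_mono KV)
      finally have "r + ennreal e \<le> emeasure N K + ennreal e" by (rule order_trans[OF e(2)])
      then have "r \<le> emeasure N K" by (simp add: add.commute[of _ "ennreal e"] ennreal_add_left_cancel_le)
      then show ?thesis using KV by blast
    qed
  qed
qed

text \<open>\<open>A\<close> may fail to be Borel. Inside a compact \<open>C\<close> of almost full
  measure, \<open>C - A\<close> is covered by a null set \<open>Z\<close>, and the Borel set
  \<open>C - Z\<close>, which lies in \<open>A\<close>, is approximated from inside.\<close>

lemma concentrated_on_inner: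
  fixes M :: "'a::t2_space measure"
  assumes M: "radon M" and one: "emeasure M UNIV = 1" and conc: "concentrated_on M A" and e: "0 < (e::real)"
  shows "\<exists>K. compact K \<and> K \<subseteq> A \<and> emeasure M (- K) \<le> ennreal e"
proof -
  have fin: "emeasure M UNIV < top" using one by simp
  note approx = finite_open_approx[OF radon_sets[OF M] radon_compact_finite[OF M] radon_inner[OF M] open_UNIV fin,
      of _ "e / 2"]
  obtain C V where C: "compact C" "UNIV \<subseteq> V" "emeasure M (V - C) \<le> ennreal (e / 2)"
    using approx[of UNIV] e by auto
  then have Ce: "emeasure M (- C) \<le> ennreal (e / 2)" by (simp add: top_unique Compl_eq_Diff_UNIV)
  obtain Z where Z: "Z \<in> null_sets M" "C - A \<subseteq> Z" using conc C unfolding concentrated_on_def by blast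
  have s: "C \<in> sets M" "Z \<in> sets M" using radon_compact_sets[OF M C(1)] Z by auto
  then obtain K U where K: "compact K" "open U" "K \<subseteq> C - Z" "C - Z \<subseteq> U" "emeasure M (U - K) \<le> ennreal (e / 2)"
    using approx[of "C - Z"] e M by auto
  have Ks: "K \<in> sets M" "U \<in> sets M" using radon_compact_sets[OF M K(1)] K(2) M by auto
  have "emeasure M (- K) \<le> emeasure M ((- C \<union> (U - K)) \<union> Z)"
    using s Ks K M by (intro emeasure_mono) (auto simp: Compl_eq_Diff_UNIV)
  also have "\<dots> = emeasure M (- C \<union> (U - K))"
    using s Ks M Z(1) by (intro emeasure_Un_null_set) (auto simp: Compl_eq_Diff_UNIV)
  also have "\<dots> \<le> emeasure M (- C) + emeasure M (U - K)"
    using s Ks M by (intro emeasure_subadditive) (auto simp: Compl_eq_Diff_UNIV)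
  also have "\<dots> \<le> ennreal (e / 2) + ennreal (e / 2)"
    by (intro add_mono Ce K)
  also have "\<dots> = ennreal e" using e by (simp add: ennreal_plus[symmetric] del: ennreal_plus)
  finally show ?thesis using K Z by (intro exI[of _ K]) auto
qed

text \<open>A Borel measure that is finite on compact sets and inner regular on open sets need not be
  outer regular on sets of infinite measure; taking infima over open supersets repairs this
  without changing the measure inside open sets of finite measure.\<close>

definition outer_regularization :: "'a::topological_space measure \<Rightarrow> 'a measure" where
  "outer_regularization M =
    measure_of UNIV (sets borel) (\<lambda>B. INF U \<in> {U. open U \<and> B \<subseteq> U}. emeasure M U)"

text \<open>Inside an open set of finite measure \<open>finite_open_approx\<close> already gives
  outer regularity, so \<open>m\<close> agrees with \<open>M\<close> there. For countable additivity
  there remain unions of infinite \<open>m\<close>, where the sum is infinite as well by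
  \<open>fin_Un\<close>.\<close>

lemma outer_regularization:
  fixes M :: "'a::t2_space measure"
  assumes sets: "sets M = sets borel" and cfin: "\<And>K. compact K \<Longrightarrow> emeasure M K < \<infinity>"
    and inner: "\<And>U r. open U \<Longrightarrow> r < emeasure M U \<Longrightarrow> \<exists>K. compact K \<and> K \<subseteq> U \<and> r < emeasure M K"
    and lc: "locally_compact_space (euclidean :: 'a topology)"
  shows "radon (outer_regularization M)"
    "\<And>K B. compact K \<Longrightarrow> B \<in> sets borel \<Longrightarrow> B \<subseteq> K \<Longrightarrow> emeasure (outer_regularization M) B = emeasure M B"
proof -
  define m where "m B = (INF U \<in> {U. open U \<and> B \<subseteq> U}. emeasure M U)" for B
  have os: "U \<in> sets M" if "open U" for U using that sets by simp
  have cs: "K \<in> sets M" if "compact K" for K using that sets by (simp add: compact_borel)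
  have m_le: "m B \<le> emeasure M U" if "open U" "B \<subseteq> U" for B U
    unfolding m_def using that by (intro INF_lower) auto
  have le_m: "emeasure M B \<le> m B" for B
    unfolding m_def by (intro INF_greatest emeasure_mono) (auto simp: os)
  have m_open: "m U = emeasure M U" if "open U" for U
    using m_le[OF that order_refl] le_m by (intro antisym) auto
  have m_less: "\<exists>U. open U \<and> B \<subseteq> U \<and> emeasure M U < r" if "m B < r" for B r
    using that unfolding m_def by (auto simp: INF_less_iff)
  have m_fin: "m B = emeasure M B" if W: "open W" "emeasure M W < top" and B: "B \<in> sets borel" "B \<subseteq> W" for B W
  proof (rule antisym[OF _ le_m])
    show "m B \<le> emeasure M B"
    proof (rule ennreal_le_epsilon)
      fix e :: real assume "0 < e"
      from finite_open_approx[OF sets cfin inner W B(1) this]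
      obtain K V where KV: "compact K" "open V" "K \<subseteq> B" "B \<subseteq> V" "emeasure M (V - K) \<le> ennreal e"
        using B(2) by (auto simp: Int_absorb2)
      have "m B \<le> emeasure M V" using KV by (intro m_le)
      also have "\<dots> = emeasure M (K \<union> (V - K))" using KV by (intro arg_cong[of _ _ "emeasure M"]) auto
      also have "\<dots> \<le> emeasure M K + emeasure M (V - K)"
        using KV cs os by (intro emeasure_subadditive) auto
      also have "\<dots> \<le> emeasure M B + ennreal e"
        using KV B(1) sets by (intro add_mono emeasure_mono) auto
      finally show "m B \<le> emeasure M B + ennreal e" .
    qed
  qed
  \<comment> \<open>Only finiteness is claimed, so a total slack of 1, distributed as a geometric
    series, is good enough.\<close>
  have fin_Un: "m (\<Union>n. B n) < top" if fin: "(\<Sum>n. m (B n)) < top" for B :: "nat \<Rightarrow> 'a set"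
  proof -
    have "m (B n) < top" for n
      using ennreal_suminf_lessD[OF fin] by simp
    then have "m (B n) < m (B n) + ennreal ((1 / 2) ^ Suc n)" for n
      by (simp add: ennreal_add_left_cancel_less less_top)
    then have "\<exists>U. open U \<and> B n \<subseteq> U \<and> emeasure M U < m (B n) + ennreal ((1 / 2) ^ Suc n)" for n
      using m_less by blast
    then obtain U where U: "\<And>n. open (U n)" "\<And>n. B n \<subseteq> U n"
      "\<And>n. emeasure M (U n) < m (B n) + ennreal ((1 / 2) ^ Suc n)" by metis
    have "m (\<Union>n. B n) \<le> emeasure M (\<Union>n. U n)" using U by (intro m_le) auto
    also have "\<dots> \<le> (\<Sum>n. emeasure M (U n))" using U os by (intro emeasure_subadditive_countably) auto
    also have "\<dots> \<le> (\<Sum>n. m (B n) + ennreal ((1 / 2) ^ Suc n))"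
      by (intro suminf_le less_imp_le U summableI)
    also have "\<dots> = (\<Sum>n. m (B n)) + (\<Sum>n. ennreal ((1 / 2) ^ Suc n))"
      by (intro suminf_add[symmetric] summableI)
    also have "(\<Sum>n. ennreal ((1 / 2) ^ Suc n)) = 1"
      using power_half_series by (intro sums_unique[symmetric]) (simp flip: ennreal_1)
    finally show ?thesis using fin by (auto intro: le_less_trans simp: ennreal_add_less_top)
  qed
  have em: "emeasure (outer_regularization M) B = m B" if "B \<in> sets borel" for B
  proof (rule emeasure_measure_of[OF outer_regularization_def[of M, folded m_def]])
    have so: "sets (outer_regularization M) = sets borel"
      unfolding outer_regularization_def using sets.sigma_sets_eq[of borel] by simp
    show "B \<in> sets (outer_regularization M)" using that so by simp
    show "positive (sets (outer_regularization M)) m"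
      using m_open[of "{}"] by (simp add: positive_def)
    show "countably_additive (sets (outer_regularization M)) m"
    proof (rule countably_additiveI)
      fix B :: "nat \<Rightarrow> 'a set"
      assume B: "range B \<subseteq> sets (outer_regularization M)" "disjoint_family B"
      show "(\<Sum>i. m (B i)) = m (\<Union> (range B))"
      proof (cases "m (\<Union> (range B)) = top")
        case True
        then show ?thesis using fin_Un[of B] by (metis less_top)
      next
        case False
        then obtain W where W: "open W" "\<Union> (range B) \<subseteq> W" "emeasure M W < top"
          using m_less[of "\<Union> (range B)" top] by (auto simp: less_top)
        have "m (B i) = emeasure M (B i)" for i using B W so by (intro m_fin[OF W(1,3)]) auto
        moreover have "m (\<Union> (range B)) = emeasure M (\<Union> (range B))"
          using B W so by (intro m_fin[OF W(1,3)]) auto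
        ultimately show ?thesis using B sets so by (simp add: suminf_emeasure)
      qed
    qed
  qed auto
  have so: "sets (outer_regularization M) = sets borel"
    unfolding outer_regularization_def using sets.sigma_sets_eq[of borel] by simp
  show eq: "emeasure (outer_regularization M) B = emeasure M B"
    if K: "compact K" and B: "B \<in> sets borel" "B \<subseteq> K" for K B
  proof -
    \<comment> \<open>The set where \<open>\<phi>\<close> is positive is an open neighbourhood of
      \<open>K\<close> within a compact set, hence of finite measure.\<close>
    obtain \<phi> where \<phi>: "\<phi> \<in> Cc" "\<And>z. 0 \<le> \<phi> z" "\<And>z. \<phi> z \<le> 1" "\<And>z. z \<in> K \<Longrightarrow> \<phi> z = (1::real)"
      using lc_Urysohn[OF lc K open_UNIV] by auto
    define W where "W = {z. 0 < \<phi> z}"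
    obtain L where L: "compact L" "\<And>z. z \<notin> L \<Longrightarrow> \<phi> z = 0" using Cc_support[OF \<phi>(1)] by blast
    have "open W" unfolding W_def using Cc_continuous[OF \<phi>(1)] by (intro open_Collect_less continuous_on_const)
    moreover have "W \<subseteq> L" using L(2) unfolding W_def by force
    then have "emeasure M W < top" using emeasure_mono[of W L M] cs[OF L(1)] cfin[OF L(1)] by (auto intro: le_less_trans)
    moreover have "K \<subseteq> W" using \<phi>(4) unfolding W_def by auto
    ultimately have "m B = emeasure M B" using B by (intro m_fin[of W]) auto
    then show ?thesis using em B by simp
  qed
  show "radon (outer_regularization M)"
  proof (rule radonI)
    show "sets (outer_regularization M) = sets borel" by fact
    show "emeasure (outer_regularization M) K < \<infinity>" if "compact K" for K
      using eq[OF that _ order_refl] cfin[OF that] cs[OF that] sets by simp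
    fix r
    show "\<exists>U. open U \<and> B \<subseteq> U \<and> emeasure (outer_regularization M) U \<le> r"
      if "B \<in> sets borel" "emeasure (outer_regularization M) B < r" for B
    proof -
      have "m B < r" using that em by simp
      then obtain U where U: "open U" "B \<subseteq> U" "emeasure M U < r" using m_less by blast
      then have "emeasure (outer_regularization M) U \<le> r" using em[of U] m_open[OF U(1)] by (simp add: less_imp_le)
      then show ?thesis using U by blast
    qed
    show "\<exists>K. compact K \<and> K \<subseteq> U \<and> r \<le> emeasure (outer_regularization M) K"
      if U: "open U" "r < emeasure (outer_regularization M) U" for U
    proof -
      have "r < emeasure M U" using U em m_open by simp
      then obtain K where "compact K" "K \<subseteq> U" "r < emeasure M K" using inner[OF U(1)] by blast
      then show ?thesis using eq[OF _ _ order_refl, of K] cs[of K] sets by (intro exI[of _ K]) auto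
    qed
  qed
qed

text \<open>A set function that is additive within each compact set is glued to a measure by a
  supremum over compact sets. Domination by \<open>S\<close> makes it inner regular on open sets,
  and \<open>outer_regularization\<close> supplies the rest.\<close>

lemma radon_of_local:
  fixes q :: "'a::t2_space set \<Rightarrow> ennreal"
  assumes lc: "locally_compact_space (euclidean :: 'a topology)"
    and S: "radon S"
    and le: "\<And>K B. compact K \<Longrightarrow> B \<in> sets borel \<Longrightarrow> B \<subseteq> K \<Longrightarrow> q B \<le> emeasure S B"
    and add: "\<And>K. compact K \<Longrightarrow> countably_additive (sets borel) (\<lambda>B. q (B \<inter> K))"
  obtains P where "radon P" "\<And>K B. compact K \<Longrightarrow> B \<in> sets borel \<Longrightarrow> B \<subseteq> K \<Longrightarrow> emeasure P B = q B"
proof -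
  have cs: "K \<in> sets borel" if "compact K" for K :: "'a set" using that by (rule compact_borel)
  have q0: "q {} = 0" using le[of "{}" "{}"] by simp
  have sum2: "q A + q B = q (A \<union> B)" if "compact K" "A \<in> sets borel" "B \<in> sets borel" "A \<subseteq> K" "B \<subseteq> K" "A \<inter> B = {}" for A B K
  proof -
    have "additive (sets borel) (\<lambda>B. q (B \<inter> K))"
      using add[OF that(1)] q0 by (intro sets.countably_additive_additive) (simp_all add: positive_def)
    from additiveD[OF this that(6,2,3)] show ?thesis using that by (simp add: Int_absorb2 Int_Un_distrib2)
  qed
  have mono: "q A \<le> q B" if "compact K" "A \<in> sets borel" "B \<in> sets borel" "A \<subseteq> B" "B \<subseteq> K" for A B K
  proof -
    have "q A + q (B - A) = q (A \<union> (B - A))"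
      using that by (intro sum2[OF that(1)]) auto
    then show ?thesis using that by (metis Un_Diff_cancel le_iff_add sup.absorb2)
  qed
  \<comment> \<open>Monotonicity of \<open>q\<close> inside compact sets makes this supremum
    directed, which is why it commutes with countable sums.\<close>
  define p where "p B = (SUP K\<in>{K. compact K}. q (B \<inter> K))" for B
  define M where "M = measure_of UNIV (sets borel) p"
  have ca: "countably_additive (sets borel) p"
  proof (rule countably_additiveI)
    fix B :: "nat \<Rightarrow> 'a set"
    assume B: "range B \<subseteq> sets borel" "disjoint_family B"
    have "(\<Sum>n. p (B n)) = (SUP K\<in>{K. compact K}. \<Sum>n. q (B n \<inter> K))"
      unfolding p_def
    proof (rule ennreal_suminf_SUP_eq_directed)
      fix N :: "nat set" and K L :: "'a set" assume KL: "K \<in> {K. compact K}" "L \<in> {K. compact K}"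
      have "q (B n \<inter> K) \<le> q (B n \<inter> (K \<union> L))" "q (B n \<inter> L) \<le> q (B n \<inter> (K \<union> L))" for n
        using B KL cs by (intro mono[of "K \<union> L"]; auto)+
      then show "\<exists>C\<in>{K. compact K}. \<forall>n\<in>N. q (B n \<inter> K) \<le> q (B n \<inter> C) \<and> q (B n \<inter> L) \<le> q (B n \<inter> C)"
        using KL by (intro bexI[of _ "K \<union> L"]) auto
    qed
    also have "\<dots> = p (\<Union> (range B))"
      unfolding p_def
    proof (rule SUP_cong[OF refl])
      fix K :: "'a set" assume "K \<in> {K. compact K}"
      then show "(\<Sum>n. q (B n \<inter> K)) = q (\<Union> (range B) \<inter> K)"
        using add[of K] B by (auto simp: countably_additive_def)
    qed
    finally show "(\<Sum>n. p (B n)) = p (\<Union> (range B))" .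
  qed
  have sM: "sets M = sets borel" unfolding M_def using sets.sigma_sets_eq[of borel] by simp
  have "p {} \<le> 0" unfolding p_def by (intro SUP_least) (simp add: q0)
  then have p0: "p {} = 0" by simp
  have eM: "emeasure M B = p B" if "B \<in> sets borel" for B
    by (rule emeasure_measure_of[OF M_def]) (use ca that sM p0 in \<open>auto simp: positive_def\<close>)
  have pq: "p B = q B" if "compact K" "B \<in> sets borel" "B \<subseteq> K" for K B
  proof (rule antisym)
    show "p B \<le> q B" unfolding p_def
      using that cs by (intro SUP_least mono[OF that(1)]) auto
    show "q B \<le> p B" unfolding p_def
      using that by (intro SUP_upper2[of K]) (auto simp: Int_absorb2)
  qed
  have cfin: "emeasure M K < \<infinity>" if "compact K" for K
    using le[OF that cs[OF that] order_refl] radon_compact_finite[OF S that] eM[OF cs[OF that]] pq[OF that cs[OF that]]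
    by (simp add: le_less_trans)
  have inner: "\<exists>K. compact K \<and> K \<subseteq> U \<and> r < emeasure M K" if U: "open U" "r < emeasure M U" for U r
  proof -
    have "r < p U" using U eM by simp
    then obtain C where C: "compact C" "r < q (U \<inter> C)" by (auto simp: p_def less_SUP_iff)
    have UC: "U \<inter> C \<in> sets borel" using U cs[OF C(1)] by auto
    have "q (U \<inter> C) \<le> q C" using UC cs[OF C(1)] by (intro mono[OF C(1)]) auto
    then have fin: "q (U \<inter> C) < top"
      using le[OF C(1) cs[OF C(1)] order_refl] radon_compact_finite[OF S C(1)] by (auto intro: le_less_trans)
    obtain a b where ab: "r = ennreal a" "0 \<le> a" "q (U \<inter> C) = ennreal b" "a < b"
      using C(2) fin by (cases r; cases "q (U \<inter> C)") (auto simp: ennreal_less_iff)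
    \<comment> \<open>As \<open>q\<close> is dominated by \<open>S\<close>, passing from
      \<open>U \<inter> C\<close> to \<open>K\<close> costs at most half of the gap
      \<open>b - a\<close>.\<close>
    obtain K where K: "compact K" "K \<subseteq> U \<inter> C" "emeasure S (U \<inter> C - K) \<le> ennreal ((b - a) / 2)"
      using radon_inner_finite[OF S C(1) UC _, of "(b - a) / 2"] ab by auto
    have KC: "U \<inter> C - K \<in> sets borel" using UC cs[OF K(1)] by auto
    have "q K + q (U \<inter> C - K) = q (K \<union> (U \<inter> C - K))"
      using K KC cs[OF K(1)] by (intro sum2[OF C(1)]) auto
    also have "K \<union> (U \<inter> C - K) = U \<inter> C" using K by auto
    finally have "ennreal b = q K + q (U \<inter> C - K)" using ab by simp
    moreover have "q (U \<inter> C - K) < ennreal (b - a)"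
      using ab by (intro le_less_trans[OF order_trans[OF le[OF C(1) KC] K(3)]]) (auto simp: ennreal_less_iff)
    ultimately have "ennreal a < q K"
      using ab by (cases "q K"; cases "q (U \<inter> C - K)") (auto simp: ennreal_less_iff ennreal_plus[symmetric] simp del: ennreal_plus)
    then show ?thesis using K ab eM[OF cs[OF K(1)]] pq[OF K(1) cs[OF K(1)]] by auto
  qed
  show thesis
  proof (rule that)
    show "radon (outer_regularization M)" by (rule outer_regularization(1)[OF sM cfin inner lc])
    show "emeasure (outer_regularization M) B = q B" if "compact K" "B \<in> sets borel" "B \<subseteq> K" for K B
      using outer_regularization(2)[OF sM cfin inner lc that] eM[OF that(2)] pq[OF that] by simp
  qed
qed

section \<open>Hahn decompositions on compact sets and the Jordan decomposition\<close>

definition hahn :: "'a::t2_space measure \<Rightarrow> 'a measure \<Rightarrow> 'a set \<Rightarrow> 'a set \<Rightarrow> bool" where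
  "hahn M N K Y \<longleftrightarrow> Y \<in> sets borel \<and> Y \<subseteq> K \<and> (\<forall>X\<in>sets borel. X \<subseteq> Y \<longrightarrow> emeasure N X \<le> emeasure M X) \<and>
     (\<forall>X\<in>sets borel. X \<subseteq> K \<longrightarrow> X \<inter> Y = {} \<longrightarrow> emeasure M X \<le> emeasure N X)"

text \<open>The positive part of \<open>M - N\<close>, provided that \<open>B\<close> is contained in a compact set; in general
  sets \<open>Z\<close> with \<open>emeasure M Z = \<infinity>\<close> spoil the formula.\<close>

definition excess :: "'a::t2_space measure \<Rightarrow> 'a measure \<Rightarrow> 'a set \<Rightarrow> ennreal" where
  "excess M N B = (SUP Z\<in>{Z \<in> sets borel. Z \<subseteq> B}. emeasure M Z - emeasure N Z)"

lemma radon_sub_compact_finite: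
  assumes "radon (M :: 'a::t2_space measure)" "compact K" "B \<subseteq> K"
  shows "emeasure M B < top"
  using emeasure_mono[OF assms(3) radon_compact_sets[OF assms(1,2)]] radon_compact_finite[OF assms(1,2)]
  by (auto intro: le_less_trans)

lemma hahn_exists:
  assumes "radon M" "radon N" "compact K"
  shows "\<exists>Y. hahn M N K Y"
proof -
  have "emeasure M K \<noteq> top" "emeasure N K \<noteq> top"
    using radon_compact_finite[OF assms(1,3)] radon_compact_finite[OF assms(2,3)] by auto
  then show ?thesis
    using unsigned_Hahn_decomposition[of N M K] assms compact_borel[OF assms(3)] by (auto simp: hahn_def)
qed

lemma hahnD:
  assumes "hahn M N K Y"
  shows "Y \<in> sets borel" "Y \<subseteq> K"
    "\<And>X. X \<in> sets borel \<Longrightarrow> X \<subseteq> Y \<Longrightarrow> emeasure N X \<le> emeasure M X"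
    "\<And>X. X \<in> sets borel \<Longrightarrow> X \<subseteq> K \<Longrightarrow> X \<inter> Y = {} \<Longrightarrow> emeasure M X \<le> emeasure N X"
  using assms unfolding hahn_def by blast+

lemma hahn_swap:
  assumes h: "hahn M N K Y" and K: "K \<in> sets borel"
  shows "hahn N M K (K - Y)"
  unfolding hahn_def
proof (intro conjI ballI impI)
  show "K - Y \<in> sets borel" "K - Y \<subseteq> K" using hahnD(1)[OF h] K by auto
  show "emeasure M X \<le> emeasure N X" if "X \<in> sets borel" "X \<subseteq> K - Y" for X
    using that by (intro hahnD(4)[OF h]) auto
  show "emeasure N X \<le> emeasure M X" if "X \<in> sets borel" "X \<subseteq> K" "X \<inter> (K - Y) = {}" for X
    using that by (intro hahnD(3)[OF h]) auto
qed

text \<open>Removing \<open>Z - Y\<close> from a competitor \<open>Z\<close> and adding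
  \<open>(B - Z) \<inter> Y\<close> can only increase the difference, so \<open>B \<inter> Y\<close>
  is optimal. All values are finite inside \<open>K\<close>, which permits the computation in the
  reals.\<close>

lemma excess_eq:
  assumes h: "hahn M N K Y" and M: "radon M" and N: "radon N" and K: "compact K"
    and B: "B \<in> sets borel" "B \<subseteq> K"
  shows "excess M N B = emeasure M (B \<inter> Y) - emeasure N (B \<inter> Y)"
proof (rule antisym)
  have Y: "Y \<in> sets borel" "Y \<subseteq> K" using hahnD(1,2)[OF h] by auto
  show "emeasure M (B \<inter> Y) - emeasure N (B \<inter> Y) \<le> excess M N B"
    unfolding excess_def using B Y by (intro SUP_upper) auto
  show "excess M N B \<le> emeasure M (B \<inter> Y) - emeasure N (B \<inter> Y)"
    unfolding excess_def
  proof (rule SUP_least, clarify)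
    fix Z assume Z: "Z \<in> sets borel" "Z \<subseteq> B"
    have em: "emeasure L X = ennreal (measure L X)" if "radon L" "X \<subseteq> K" for L X
      using radon_sub_compact_finite[OF that(1) K that(2)] by (simp add: emeasure_eq_ennreal_measure less_top)
    have un: "measure L (X \<union> X') = measure L X + measure L X'"
      if "radon L" "X \<in> sets borel" "X' \<in> sets borel" "X \<subseteq> K" "X' \<subseteq> K" "X \<inter> X' = {}" for L X X'
      using that radon_sub_compact_finite[OF that(1) K] by (intro measure_Union) (auto simp: less_top)
    have 1: "measure L Z = measure L (Z \<inter> Y) + measure L (Z - Y)" if "radon L" for L
      using un[OF that, of "Z \<inter> Y" "Z - Y"] Z B Y by (auto simp: Int_Diff_Un)
    have 2: "measure L (B \<inter> Y) = measure L (Z \<inter> Y) + measure L ((B - Z) \<inter> Y)" if "radon L" for L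
    proof -
      have "B \<inter> Y = (Z \<inter> Y) \<union> ((B - Z) \<inter> Y)" using Z by auto
      then show ?thesis using un[OF that, of "Z \<inter> Y" "(B - Z) \<inter> Y"] Z B Y by auto
    qed
    have "emeasure M (Z - Y) \<le> emeasure N (Z - Y)" "emeasure N ((B - Z) \<inter> Y) \<le> emeasure M ((B - Z) \<inter> Y)"
      by (rule hahnD(4)[OF h], use Z B Y in auto) (rule hahnD(3)[OF h], use Z B Y in auto)
    then have "measure M (Z - Y) \<le> measure N (Z - Y)" "measure N ((B - Z) \<inter> Y) \<le> measure M ((B - Z) \<inter> Y)"
    proof -
      have sK: "Z - Y \<subseteq> K" "(B - Z) \<inter> Y \<subseteq> K" using Z B by auto
      show "measure M (Z - Y) \<le> measure N (Z - Y)" "measure N ((B - Z) \<inter> Y) \<le> measure M ((B - Z) \<inter> Y)"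
        using \<open>emeasure M (Z - Y) \<le> _\<close> \<open>emeasure N ((B - Z) \<inter> Y) \<le> _\<close>
        by (simp_all add: em[OF M sK(1)] em[OF N sK(1)] em[OF M sK(2)] em[OF N sK(2)])
    qed
    then have "measure M Z - measure N Z \<le> measure M (B \<inter> Y) - measure N (B \<inter> Y)"
      using 1[OF M] 1[OF N] 2[OF M] 2[OF N] by linarith
    moreover have "Z \<subseteq> K" "B \<inter> Y \<subseteq> K" using Z B by auto
    ultimately show "emeasure M Z - emeasure N Z \<le> emeasure M (B \<inter> Y) - emeasure N (B \<inter> Y)"
      by (simp add: em[OF M] em[OF N] ennreal_minus ennreal_leI)
  qed
qed

lemma countably_additive_diff:
  fixes M N :: "'a::t2_space measure"
  assumes M: "radon M" and N: "radon N" and K: "compact K" and X: "X \<in> sets borel" "X \<subseteq> K"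
    and le: "\<And>B. B \<in> sets borel \<Longrightarrow> B \<subseteq> X \<Longrightarrow> emeasure N B \<le> emeasure M B"
  shows "countably_additive (sets borel) (\<lambda>B. emeasure M (B \<inter> X) - emeasure N (B \<inter> X))"
proof (rule countably_additiveI)
  fix B :: "nat \<Rightarrow> 'a set" assume B: "range B \<subseteq> sets borel" "disjoint_family B"
  have sum: "(\<Sum>n. emeasure L (B n \<inter> X)) = emeasure L (\<Union> (range B) \<inter> X)" if "radon L" for L
  proof -
    have "disjoint_family (\<lambda>n. B n \<inter> X)" using B(2) by (auto simp: disjoint_family_on_def)
    then show ?thesis using that B(1) X(1) by (subst suminf_emeasure) auto
  qed
  have fin: "(\<Sum>n. emeasure L (B n \<inter> X)) \<noteq> top" if "radon L" for L
    using sum[OF that] radon_sub_compact_finite[OF that K, of "\<Union> (range B) \<inter> X"] X(2) by (auto simp: less_top)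
  have "emeasure N (B n \<inter> X) \<le> emeasure M (B n \<inter> X)" for n using B(1) X(1) by (intro le) auto
  then have "(\<Sum>n. emeasure M (B n \<inter> X) - emeasure N (B n \<inter> X)) =
      (\<Sum>n. emeasure M (B n \<inter> X)) - (\<Sum>n. emeasure N (B n \<inter> X))"
    using fin[OF M] fin[OF N] by (rule ennreal_suminf_minus)
  then show "(\<Sum>n. emeasure M (B n \<inter> X) - emeasure N (B n \<inter> X)) =
      emeasure M (\<Union> (range B) \<inter> X) - emeasure N (\<Union> (range B) \<inter> X)"
    by (simp add: sum M N)
qed

lemma countably_additive_excess:
  assumes M: "radon M" and N: "radon N" and K: "compact K"
  shows "countably_additive (sets borel) (\<lambda>B. excess M N (B \<inter> K))"
proof -
  obtain Y where h: "hahn M N K Y" using hahn_exists[OF assms] by blast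
  note Y = hahnD(1,2)[OF h]
  have ex: "excess M N (B \<inter> K) = emeasure M (B \<inter> Y) - emeasure N (B \<inter> Y)" if "B \<in> sets borel" for B
    using excess_eq[OF h M N K, of "B \<inter> K"] that compact_borel[OF K] Y by (simp add: Int_assoc Int_absorb1)
  show ?thesis
    using countably_additive_diff[OF M N K Y hahnD(3)[OF h]] by (auto simp: countably_additive_def ex image_subset_iff)
qed

text \<open>\<open>C\<close> is the minimum of the two measures, \<open>P\<close> and
  \<open>Q\<close> are what exceeds it. Hahn sets of different compact sets need not match, but
  \<open>excess\<close> is defined without them, so the local pieces are automatically compatible
  and \<open>radon_of_local\<close> glues them.\<close>

lemma radon_Jordan_decomposition:
  fixes M N :: "'a::t2_space measure"
  assumes lc: "locally_compact_space (euclidean :: 'a topology)" and M: "radon M" and N: "radon N"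
  obtains C P Q where "radon C" "M = add_measure C P" "N = add_measure C Q" "(P, Q) \<in> signed_radon"
proof -
  have exle: "excess M N B \<le> emeasure M B" if "radon M" "radon N" "compact K" "B \<in> sets borel" "B \<subseteq> K" for M N K and B :: "'a set"
    unfolding excess_def
  proof (rule SUP_least, clarify)
    fix Z assume "Z \<in> sets borel" "Z \<subseteq> B"
    then have "emeasure M Z \<le> emeasure M B" using that by (intro emeasure_mono) auto
    with diff_le_self_ennreal show "emeasure M Z - emeasure N Z \<le> emeasure M B" by (rule order_trans)
  qed
  obtain P where P: "radon P" "\<And>K B. compact K \<Longrightarrow> B \<in> sets borel \<Longrightarrow> B \<subseteq> K \<Longrightarrow> emeasure P B = excess M N B"
    by (rule radon_of_local[OF lc M, where q = "excess M N"]) (rule exle[OF M N], assumption+ | rule countably_additive_excess[OF M N] | blast)+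
  obtain Q where Q: "radon Q" "\<And>K B. compact K \<Longrightarrow> B \<in> sets borel \<Longrightarrow> B \<subseteq> K \<Longrightarrow> emeasure Q B = excess N M B"
    by (rule radon_of_local[OF lc N, where q = "excess N M"]) (rule exle[OF N M], assumption+ | rule countably_additive_excess[OF N M] | blast)+
  have PM: "emeasure P B \<le> emeasure M B" if "compact K" "B \<in> sets borel" "B \<subseteq> K" for K B
    using P(2)[OF that] exle[OF M N that] by simp
  obtain C where C: "radon C" "\<And>K B. compact K \<Longrightarrow> B \<in> sets borel \<Longrightarrow> B \<subseteq> K \<Longrightarrow> emeasure C B = emeasure M B - emeasure P B"
    by (rule radon_of_local[OF lc M, where q = "\<lambda>B. emeasure M B - emeasure P B"])
      (rule diff_le_self_ennreal | rule countably_additive_diff[OF M P(1) _ compact_borel order_refl PM], assumption+ | blast)+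
  have ds: "a - b + b = a" if "b \<le> a" "a < top" for a b :: ennreal
    using that by (simp add: diff_add_self_ennreal)
  show thesis
  proof (rule that[OF C(1)])
    show "M = add_measure C P"
    proof (rule radon_eqI[OF M radon_add[OF C(1) P(1)]])
      fix K :: "'a set" assume K: "compact K"
      show "emeasure M K = emeasure (add_measure C P) K"
        using emeasure_add_measure[OF radon_sets[OF C(1)] radon_sets[OF P(1)] compact_borel[OF K]]
          P(2)[OF K compact_borel[OF K] order_refl] C(2)[OF K compact_borel[OF K] order_refl]
          ds[OF exle[OF M N K compact_borel[OF K] order_refl]] radon_compact_finite[OF M K] by simp
    qed
    show "N = add_measure C Q"
    proof (rule radon_eqI[OF N radon_add[OF C(1) Q(1)]])
      fix K :: "'a set" assume K: "compact K"
      obtain Y where h: "hahn M N K Y" using hahn_exists[OF M N K] by blast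
      have Y: "Y \<in> sets borel" "Y \<subseteq> K" "emeasure N Y \<le> emeasure M Y" "emeasure M (K - Y) \<le> emeasure N (K - Y)"
        using hahnD(1,2)[OF h] hahnD(3)[OF h, of Y] hahnD(4)[OF h, of "K - Y"] compact_borel[OF K] by auto
      have KY: "K \<inter> Y = Y" "K \<inter> (K - Y) = K - Y" using Y by auto
      have ex: "excess M N K = emeasure M Y - emeasure N Y" "excess N M K = emeasure N (K - Y) - emeasure M (K - Y)"
        using excess_eq[OF h M N K compact_borel[OF K] order_refl]
          excess_eq[OF hahn_swap[OF h compact_borel[OF K]] N M K compact_borel[OF K] order_refl] by (simp_all add: KY)
      have sp: "emeasure L K = emeasure L Y + emeasure L (K - Y)" if "radon L" for L
      proof -
        have "Y \<union> (K - Y) = K" using Y by auto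
        then show ?thesis using that Y compact_borel[OF K] plus_emeasure[of Y L "K - Y"] by auto
      qed
      have fin: "emeasure L Y < top" "emeasure L (K - Y) < top" if "radon L" for L
        using radon_sub_compact_finite[OF that K] Y by auto
      \<comment> \<open>On \<open>Y\<close> the first term leaves \<open>M - (M - N) = N\<close>; on
        \<open>K - Y\<close> the second term adds \<open>N - M\<close> to \<open>M\<close>.\<close>
      have "emeasure (add_measure C Q) K = (emeasure M K - excess M N K) + excess N M K"
        using emeasure_add_measure[OF radon_sets[OF C(1)] radon_sets[OF Q(1)] compact_borel[OF K]]
          P(2)[OF K compact_borel[OF K] order_refl] Q(2)[OF K compact_borel[OF K] order_refl]
          C(2)[OF K compact_borel[OF K] order_refl] by simp
      also have "\<dots> = emeasure N K"
        unfolding ex sp[OF M] sp[OF N] using fin[OF M] fin[OF N] Y(3,4)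
        by (cases "emeasure M Y"; cases "emeasure N Y"; cases "emeasure M (K - Y)"; cases "emeasure N (K - Y)")
          (auto simp: ennreal_plus[symmetric] ennreal_minus simp del: ennreal_plus)
      finally show "emeasure N K = emeasure (add_measure C Q) K" by simp
    qed
    have "\<exists>B\<in>sets borel. emeasure P (K \<inter> B) = 0 \<and> emeasure Q (K - B) = 0" if K: "compact K" for K
    proof -
      obtain Y where h: "hahn M N K Y" using hahn_exists[OF M N K] by blast
      have Y: "Y \<in> sets borel" "Y \<subseteq> K" using hahnD(1,2)[OF h] by auto
      have KY: "K \<inter> (K - Y) = K - Y" "K - (K - Y) = Y" "(K - Y) \<inter> Y = {}" "Y \<inter> (K - Y) = {}" using Y by auto
      have "emeasure P (K - Y) = 0"
        using P(2)[OF K, of "K - Y"] excess_eq[OF h M N K, of "K - Y"] Y compact_borel[OF K] KY by auto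
      moreover have "emeasure Q Y = 0"
        using Q(2)[OF K, of Y] excess_eq[OF hahn_swap[OF h compact_borel[OF K]] N M K, of Y] Y KY by auto
      ultimately show ?thesis using Y compact_borel[OF K] KY by (intro bexI[of _ "K - Y"]) auto
    qed
    then show "(P, Q) \<in> signed_radon" using P(1) Q(1) by (auto simp: signed_radon_def)
  qed
qed

section \<open>The energy inner product\<close>

context kernel_space
begin

lemma npot_measurable: "radon M \<Longrightarrow> npot k M \<in> borel_measurable borel"
  using lsc_measurable[OF lsc_npot[OF lc lsc_k]] by simp

lemma k_section_measurable: "(\<lambda>y. k (x, y)) \<in> borel_measurable borel"
  by (rule lsc_measurable[OF lsc_compose[OF lsc_k] refl])
    (intro continuous_on_Pair continuous_on_const continuous_on_id)

lemma nenergy_add_left: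
  "radon M \<Longrightarrow> radon N \<Longrightarrow> radon L \<Longrightarrow> nenergy k (add_measure M N) L = nenergy k M L + nenergy k N L"
  unfolding nenergy_def by (intro nn_integral_add_measure npot_measurable) auto

lemma nenergy_scale_left:
  "radon M \<Longrightarrow> radon L \<Longrightarrow> nenergy k (scale_measure r M) L = r * nenergy k M L"
  unfolding nenergy_def
  by (rule nn_integral_scale_measure) (rule measurable_borel_sets[OF npot_measurable radon_sets])

lemmas nenergy_commute' = nenergy_commute[OF lc lsc_k k_commute]

lemma nenergy_add_right:
  "radon M \<Longrightarrow> radon N \<Longrightarrow> radon L \<Longrightarrow> nenergy k L (add_measure M N) = nenergy k L M + nenergy k L N"
  using nenergy_add_left[of M N L] by (simp add: nenergy_commute'[of L] radon_add)

lemma nenergy_scale_right: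
  "radon M \<Longrightarrow> radon L \<Longrightarrow> 0 < r \<Longrightarrow> nenergy k L (scale_measure (ennreal r) M) = ennreal r * nenergy k L M"
  using nenergy_scale_left[of M L "ennreal r"] by (simp add: nenergy_commute'[of L] radon_scale)

lemma nenergy_null [simp]: "nenergy k (null_measure borel) M = 0"
  by (simp add: nenergy_def)

lemma nenergy_null' [simp]: "radon M \<Longrightarrow> nenergy k M (null_measure borel) = 0"
  by (simp add: nenergy_def npot_def)

text \<open>\<open>measure\<close> assigns 0 to sets of infinite measure, so masses need not be
  additive; the factor \<open>c\<close> vanishes unless all masses are finite.\<close>

lemma c_mass_add: "radon M \<Longrightarrow> radon N \<Longrightarrow> c * mass (add_measure M N) = c * mass M + c * mass N"
proof (cases "c = 0")
  case False
  assume MN: "radon M" "radon N"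
  interpret M: finite_measure M using radon_finite MN False by blast
  interpret N: finite_measure N using radon_finite MN False by blast
  have "emeasure (add_measure M N) UNIV = ennreal (mass M + mass N)"
    using MN by (simp add: emeasure_add_measure M.emeasure_eq_measure N.emeasure_eq_measure)
  then show ?thesis by (simp add: measure_def[of "add_measure M N"] distrib_left enn2real_plus)
qed simp

definition finite_energy :: "'a measure set" where
  "finite_energy = {M. radon M \<and> nenergy k M M < top}"

text \<open>The mutual energy as a real number, with the shift by \<open>c\<close> undone. Since
  \<open>enn2real\<close> sends \<infinity> to 0, the value is meaningful only if
  \<open>nenergy k M N\<close> is finite.\<close>

definition ip :: "'a measure \<Rightarrow> 'a measure \<Rightarrow> real" where
  "ip M N = enn2real (nenergy k M N) - c * mass M * mass N"

lemma finite_energyD: "M \<in> finite_energy \<Longrightarrow> radon M" "M \<in> finite_energy \<Longrightarrow> nenergy k M M < top"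
  by (auto simp: finite_energy_def)

lemma pos_energy_ip:
  assumes "radon M" "radon N"
  shows "pos_energy \<kappa> M N = (if nenergy k M N < top then ereal (ip M N) else \<infinity>)"
  unfolding pos_energy_eq[OF assms] ip_def by (cases "nenergy k M N") auto

lemma ip_commute: "radon M \<Longrightarrow> radon N \<Longrightarrow> ip M N = ip N M"
  by (simp add: ip_def nenergy_commute'[of M N])

lemma ip_null [simp]: "ip (null_measure borel) M = 0" "radon M \<Longrightarrow> ip M (null_measure borel) = 0"
  by (simp_all add: ip_def)

lemma null_finite_energy: "null_measure borel \<in> finite_energy"
  by (simp add: finite_energy_def radon_null)

lemma ip_add_left:
  assumes "radon M" "radon N" "radon L" "nenergy k M L < top" "nenergy k N L < top"
  shows "ip (add_measure M N) L = ip M L + ip N L"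
proof -
  have "c * mass (add_measure M N) * mass L = c * mass M * mass L + c * mass N * mass L"
    using c_mass_add[OF assms(1,2)] by (simp add: distrib_right)
  then show ?thesis using assms by (simp add: ip_def nenergy_add_left enn2real_plus)
qed

lemma ip_add_right:
  assumes "radon M" "radon N" "radon L" "nenergy k L M < top" "nenergy k L N < top"
  shows "ip L (add_measure M N) = ip L M + ip L N"
  using ip_add_left[OF assms(1-3)] assms by (simp add: ip_commute[of L] radon_add nenergy_commute'[of L])

lemma ip_scale_left:
  assumes "radon M" "radon L" "0 < r"
  shows "ip (scale_measure (ennreal r) M) L = r * ip M L"
  using assms by (simp add: ip_def nenergy_scale_left enn2real_mult right_diff_distrib)

lemma ip_scale_right:
  assumes "radon M" "radon L" "0 < r"
  shows "ip L (scale_measure (ennreal r) M) = r * ip L M"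
  using ip_scale_left[OF assms] assms by (simp add: ip_commute[of L] radon_scale)

lemma fin_energy_pos_eq: "fin_energy_pos \<kappa> = finite_energy"
proof -
  have sr: "pos M \<in> signed_radon \<longleftrightarrow> radon M" for M :: "'a measure"
    using radon_null by (auto simp: signed_radon_def intro!: bexI[of _ "{}"])
  have "energy_defined \<kappa> (pos M) (pos M)" "energy \<kappa> (pos M) (pos M) = pos_energy \<kappa> M M" if "radon M" for M
    using that by (simp_all add: energy_defined_def energy_def pos_energy_ip[OF that radon_null]
        pos_energy_ip[OF radon_null that] pos_energy_ip[OF radon_null radon_null] radon_null flip: zero_ereal_def)
  then show ?thesis
    by (auto simp: fin_energy_pos_def fin_energy_def finite_energy_def sr pos_energy_ip split: if_splits)
qed

lemma energy_pos_eq: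
  assumes "M \<in> finite_energy"
  shows "energy \<kappa> (pos M) (pos M) = ereal (ip M M)"
  using finite_energyD[OF assms]
  by (simp add: energy_def pos_energy_ip radon_null flip: zero_ereal_def)

lemma energy_pair_eq:
  assumes "radon M" "radon N" "nenergy k M M < top" "nenergy k N N < top" "nenergy k M N < top"
  shows "energy \<kappa> (M, N) (M, N) = ereal (ip M M + ip N N - 2 * ip M N)"
  using assms nenergy_commute'[of M N] ip_commute[of M N]
  by (simp add: energy_def pos_energy_ip)

end

locale energy_kernel_space = kernel_space +
  assumes energy: "energy_principle \<kappa>"
begin

text \<open>Finite self-energies alone make the energy of \<open>P - Q\<close> well defined, so the
  energy principle applies before the mutual term is known to be finite; an infinite one would give
  the value -\<infinity>.\<close>

lemma signed_energy:
  assumes s: "(P, Q) \<in> signed_radon" and P: "nenergy k P P < top" and Q: "nenergy k Q Q < top"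
  shows "nenergy k P Q < top" "0 \<le> ip P P + ip Q Q - 2 * ip P Q"
    "ip P P + ip Q Q - 2 * ip P Q = 0 \<Longrightarrow> P = null_measure borel \<and> Q = null_measure borel"
proof -
  have r: "radon P" "radon Q" using s by (auto simp: signed_radon_def)
  have "energy_defined \<kappa> (P, Q) (P, Q)" using P Q r by (simp add: energy_defined_def pos_energy_ip)
  then have e: "0 \<le> energy \<kappa> (P, Q) (P, Q)" "energy \<kappa> (P, Q) (P, Q) = 0 \<Longrightarrow> (P, Q) = pos (null_measure borel)"
    using energy s unfolding energy_principle_def by blast+
  show PQ: "nenergy k P Q < top"
  proof (rule ccontr)
    assume n: "\<not> nenergy k P Q < top"
    then have "\<not> nenergy k Q P < top" using nenergy_commute' r by metis
    then have "energy \<kappa> (P, Q) (P, Q) = - \<infinity>"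
      using n P Q r by (simp add: energy_def pos_energy_ip)
    then show False using e(1) by simp
  qed
  note eq = energy_pair_eq[OF r P Q PQ]
  show "0 \<le> ip P P + ip Q Q - 2 * ip P Q" using e(1) eq by simp
  show "P = null_measure borel \<and> Q = null_measure borel" if "ip P P + ip Q Q - 2 * ip P Q = 0"
    using e(2) eq that by (simp add: zero_ereal_def)
qed

text \<open>In \<open>M = C + P\<close> and \<open>N = C + Q\<close> the terms with \<open>C\<close>
  occur in the finite self-energies of \<open>M\<close> and \<open>N\<close>, and they cancel in the
  square of the difference, which leaves the energy of the Jordan decomposition.\<close>

lemma ip_diff:
  assumes M: "M \<in> finite_energy" and N: "N \<in> finite_energy"
  shows "nenergy k M N < top" "0 \<le> ip M M + ip N N - 2 * ip M N"
    "ip M M + ip N N - 2 * ip M N = 0 \<Longrightarrow> M = N"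
proof -
  note MN = finite_energyD[OF M] finite_energyD[OF N]
  obtain C P Q where C: "radon C" "M = add_measure C P" "N = add_measure C Q" "(P, Q) \<in> signed_radon"
    using radon_Jordan_decomposition[OF lc MN(1,3)] by blast
  have r: "radon P" "radon Q" using C(4) by (auto simp: signed_radon_def)
  have M': "nenergy k M M = (nenergy k C C + nenergy k P C) + (nenergy k C P + nenergy k P P)"
    using C(1,2) r by (simp add: nenergy_add_left nenergy_add_right radon_add)
  have N': "nenergy k N N = (nenergy k C C + nenergy k Q C) + (nenergy k C Q + nenergy k Q Q)"
    using C(1,3) r by (simp add: nenergy_add_left nenergy_add_right radon_add)
  have fin: "nenergy k C C < top" "nenergy k P C < top" "nenergy k C P < top" "nenergy k P P < top"
    "nenergy k Q C < top" "nenergy k C Q < top" "nenergy k Q Q < top"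
    using MN(2,4) unfolding M' N' by (simp_all add: ennreal_add_less_top)
  note PQ = signed_energy[OF C(4) fin(4,7)]
  have "nenergy k M N = (nenergy k C C + nenergy k P C) + (nenergy k C Q + nenergy k P Q)"
    using C(1,2,3) r by (simp add: nenergy_add_left nenergy_add_right radon_add)
  then show "nenergy k M N < top" using fin PQ(1) by (simp add: ennreal_add_less_top)
  have 1: "ip M M = ip C C + ip P C + (ip C P + ip P P)"
    using C(1,2) r fin by (simp add: ip_add_left ip_add_right radon_add nenergy_add_left nenergy_add_right ennreal_add_less_top)
  have 2: "ip N N = ip C C + ip Q C + (ip C Q + ip Q Q)"
    using C(1,3) r fin by (simp add: ip_add_left ip_add_right radon_add nenergy_add_left nenergy_add_right ennreal_add_less_top)
  have 3: "ip M N = ip C C + ip P C + (ip C Q + ip P Q)"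
    using C(1,2,3) r fin PQ(1) by (simp add: ip_add_left ip_add_right radon_add nenergy_add_left nenergy_add_right ennreal_add_less_top)
  have eq: "ip M M + ip N N - 2 * ip M N = ip P P + ip Q Q - 2 * ip P Q"
    using ip_commute[OF C(1) r(1)] ip_commute[OF C(1) r(2)] 1 2 3 by simp
  show "0 \<le> ip M M + ip N N - 2 * ip M N" using eq PQ(2) by simp
  show "M = N" if "ip M M + ip N N - 2 * ip M N = 0"
    using PQ(3) that eq C(2,3) by simp
qed

lemma finite_energy_add:
  assumes M: "M \<in> finite_energy" and N: "N \<in> finite_energy"
  shows "add_measure M N \<in> finite_energy"
  using finite_energyD[OF M] finite_energyD[OF N] ip_diff(1)[OF M N] ip_diff(1)[OF N M]
  by (simp add: finite_energy_def radon_add nenergy_add_left nenergy_add_right ennreal_add_less_top)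

lemma finite_energy_scale:
  assumes M: "M \<in> finite_energy" and "0 < r"
  shows "scale_measure (ennreal r) M \<in> finite_energy"
  using finite_energyD[OF M] assms(2)
  by (simp add: finite_energy_def radon_scale nenergy_scale_left nenergy_scale_right ennreal_mult_less_top)

lemma ip_add:
  assumes "M \<in> finite_energy" "N \<in> finite_energy" "L \<in> finite_energy"
  shows "ip (add_measure M N) L = ip M L + ip N L" "ip L (add_measure M N) = ip L M + ip L N"
  using assms by (simp_all add: ip_add_left ip_add_right finite_energyD ip_diff(1))

lemma ip_scale:
  assumes "M \<in> finite_energy" "L \<in> finite_energy" "0 < r"
  shows "ip (scale_measure (ennreal r) M) L = r * ip M L" "ip L (scale_measure (ennreal r) M) = r * ip L M"
  using assms by (simp_all add: ip_scale_left ip_scale_right finite_energyD)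

section \<open>Cauchy-Schwarz inequality and the strong metric\<close>

definition sqdist :: "'a measure \<Rightarrow> 'a measure \<Rightarrow> real" where
  "sqdist M N = ip M M + ip N N - 2 * ip M N"

lemma strong_dist_eq:
  assumes "M \<in> finite_energy" "N \<in> finite_energy"
  shows "strong_dist \<kappa> M N = sqrt (sqdist M N)"
  using assms energy_pair_eq[of M N] finite_energyD ip_diff(1)
  by (simp add: strong_dist_def fin_energy_pos_eq sqdist_def)

lemma sqdist_nonneg: "M \<in> finite_energy \<Longrightarrow> N \<in> finite_energy \<Longrightarrow> 0 \<le> sqdist M N"
  unfolding sqdist_def by (rule ip_diff)

text \<open>Only positive \<open>t\<close> are tested, as measures are scaled by positive factors:
  for \<open>h \<le> 0\<close> the bound is trivial, and otherwise the minimum point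
  \<open>h / b\<close> is positive.\<close>

lemma discriminant_le:
  fixes a b h :: real
  assumes "0 \<le> a" "0 \<le> b" and pos: "\<And>t. 0 < t \<Longrightarrow> 0 \<le> a + t\<^sup>2 * b - 2 * t * h"
  shows "h \<le> sqrt a * sqrt b"
proof (cases "h \<le> 0")
  case True
  then show ?thesis using assms(1,2) by (meson mult_nonneg_nonneg order_trans real_sqrt_ge_zero)
next
  case False
  then have h: "0 < h" by simp
  show ?thesis
  proof (cases "b = 0")
    case True
    \<comment> \<open>Without a quadratic term this value of \<open>t\<close> makes the expression
      equal to -1.\<close>
    have "0 < (a + 1) / (2 * h)" using h assms(1) by simp
    from pos[OF this] have "0 \<le> a - (a + 1)" using True h by (simp add: field_simps)
    then show ?thesis by simp
  next
    case False
    then have b: "0 < b" using assms(2) by simp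
    have "0 < h / b" using h b by simp
    from pos[OF this] have "0 \<le> a - h\<^sup>2 / b" using b by (simp add: field_simps power2_eq_square)
    then have "h\<^sup>2 \<le> a * b" using b by (simp add: field_simps)
    then have "\<bar>h\<bar> \<le> sqrt (a * b)" using real_le_rsqrt by (metis power2_abs)
    then show ?thesis by (simp add: real_sqrt_mult)
  qed
qed

text \<open>Cauchy-Schwarz for the signed measures \<open>M - N\<close> and \<open>S - T\<close>: positivity is applied to
  \<open>(M - N) - t (S - T) = (M + t T) - (N + t S)\<close>.\<close>

lemma ip_Cauchy_Schwarz:
  assumes M: "M \<in> finite_energy" and N: "N \<in> finite_energy" and S: "S \<in> finite_energy" and T: "T \<in> finite_energy"
  shows "ip M S - ip M T - ip N S + ip N T \<le> sqrt (sqdist M N) * sqrt (sqdist S T)"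
proof (rule discriminant_le)
  show "0 \<le> sqdist M N" "0 \<le> sqdist S T" by (intro sqdist_nonneg assms)+
  fix t :: real assume t: "0 < t"
  let ?A = "add_measure M (scale_measure (ennreal t) T)" and ?B = "add_measure N (scale_measure (ennreal t) S)"
  note sc = finite_energy_scale[OF S t] finite_energy_scale[OF T t]
  have AB: "?A \<in> finite_energy" "?B \<in> finite_energy" by (intro finite_energy_add M N sc)+
  have "0 \<le> sqdist ?A ?B" by (rule sqdist_nonneg[OF AB])
  also have "sqdist ?A ?B = sqdist M N + t\<^sup>2 * sqdist S T - 2 * t * (ip M S - ip M T - ip N S + ip N T)"
    unfolding sqdist_def using M N S T sc AB t
    by (simp add: ip_add ip_scale ip_commute[of T M] ip_commute[of S N] ip_commute[of T N] ip_commute[of S M]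
        ip_commute[of T S] finite_energyD power2_eq_square algebra_simps)
  finally show "0 \<le> sqdist M N + t\<^sup>2 * sqdist S T - 2 * t * (ip M S - ip M T - ip N S + ip N T)" .
qed

lemma Metric_space_strong: "Metric_space finite_energy (strong_dist \<kappa>)"
proof
  fix M N L :: "'a measure"
  have z: "strong_dist \<kappa> M N = 0" if "\<not> (M \<in> finite_energy \<and> N \<in> finite_energy)" for M N
    using that by (auto simp: strong_dist_def fin_energy_pos_eq)
  show "0 \<le> strong_dist \<kappa> M N"
    by (cases "M \<in> finite_energy \<and> N \<in> finite_energy") (auto simp: strong_dist_eq sqdist_nonneg z)
  show "strong_dist \<kappa> M N = strong_dist \<kappa> N M"
    by (cases "M \<in> finite_energy \<and> N \<in> finite_energy")
      (auto simp: strong_dist_eq sqdist_def ip_commute[of M N] finite_energyD z)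
  show "(strong_dist \<kappa> M N = 0) = (M = N)" if "M \<in> finite_energy" "N \<in> finite_energy"
    using that ip_diff(3)[OF that] by (auto simp: strong_dist_eq sqdist_def)
  show "strong_dist \<kappa> M L \<le> strong_dist \<kappa> M N + strong_dist \<kappa> N L"
    if "M \<in> finite_energy" "N \<in> finite_energy" "L \<in> finite_energy"
  proof -
    \<comment> \<open>The square of \<open>(M - N) + (N - L)\<close>; the bracket is the inner
      product of the two differences in the form bounded by
      \<open>ip_Cauchy_Schwarz\<close>.\<close>
    have "sqdist M L = sqdist M N + sqdist N L + 2 * (ip M N - ip M L - ip N N + ip N L)"
      using that by (simp add: sqdist_def ip_commute[of N M] finite_energyD)
    also have "\<dots> \<le> sqdist M N + sqdist N L + 2 * (sqrt (sqdist M N) * sqrt (sqdist N L))"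
      using ip_Cauchy_Schwarz[OF that(1,2,2,3)] by simp
    also have "\<dots> = (sqrt (sqdist M N) + sqrt (sqdist N L))\<^sup>2"
      using that by (simp add: power2_sum sqdist_nonneg)
    finally have "sqrt (sqdist M L) \<le> sqrt (sqdist M N) + sqrt (sqdist N L)"
      using that by (intro real_le_lsqrt) (auto simp: sqdist_nonneg)
    then show ?thesis using that by (simp add: strong_dist_eq)
  qed
qed

lemma ip_diff_bound:
  assumes M: "M \<in> finite_energy" and N: "N \<in> finite_energy" and S: "S \<in> finite_energy"
  shows "\<bar>ip M S - ip N S\<bar> \<le> sqrt (sqdist M N) * sqrt (ip S S)"
proof -
  have "sqdist S (null_measure borel) = ip S S" "sqdist N M = sqdist M N"
    using assms by (simp_all add: sqdist_def finite_energyD ip_commute[of N M])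
  then show ?thesis
    using ip_Cauchy_Schwarz[OF M N S null_finite_energy] ip_Cauchy_Schwarz[OF N M S null_finite_energy]
      finite_energyD(1)[OF M] finite_energyD(1)[OF N] by (simp add: abs_le_iff)
qed

lemma ip_tendsto:
  assumes ev: "\<forall>\<^sub>F i in F. m i \<in> finite_energy" and M: "M \<in> finite_energy" and S: "S \<in> finite_energy"
    and lim: "((\<lambda>i. sqdist (m i) M) \<longlongrightarrow> 0) F"
  shows "((\<lambda>i. ip (m i) S) \<longlongrightarrow> ip M S) F"
proof -
  have "((\<lambda>i. sqrt (sqdist (m i) M) * sqrt (ip S S)) \<longlongrightarrow> sqrt 0 * sqrt (ip S S)) F"
    by (intro tendsto_intros lim)
  then have "((\<lambda>i. sqrt (sqdist (m i) M) * sqrt (ip S S)) \<longlongrightarrow> 0) F" by simp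
  then have "((\<lambda>i. ip (m i) S - ip M S) \<longlongrightarrow> 0) F"
    by (rule Lim_null_comparison[rotated]) (use ev in eventually_elim, use ip_diff_bound[OF _ M S] in simp)
  then show ?thesis by (simp add: LIM_zero_iff)
qed

lemma ip_self_tendsto:
  assumes ev: "\<forall>\<^sub>F i in F. m i \<in> finite_energy" and M: "M \<in> finite_energy"
    and lim: "((\<lambda>i. sqdist (m i) M) \<longlongrightarrow> 0) F"
  shows "((\<lambda>i. ip (m i) (m i)) \<longlongrightarrow> ip M M) F"
proof -
  \<comment> \<open>By definition of \<open>sqdist\<close> this combination equals
    \<open>ip (m i) (m i)\<close>, so convergence of products with the fixed measure
    \<open>M\<close> is enough.\<close>
  have "((\<lambda>i. sqdist (m i) M - ip M M + 2 * ip (m i) M) \<longlongrightarrow> 0 - ip M M + 2 * ip M M) F"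
    by (intro tendsto_intros lim ip_tendsto[OF ev M M lim])
  then show ?thesis by (simp add: sqdist_def algebra_simps)
qed

text \<open>If a part had infinite self-energy, well-definedness would force the cross terms to be
  finite and the total energy to be \<infinity>.\<close>

lemma fin_energyD:
  assumes "\<theta> \<in> fin_energy \<kappa>"
  shows "fst \<theta> \<in> finite_energy" "snd \<theta> \<in> finite_energy"
proof -
  obtain P Q where PQ: "\<theta> = (P, Q)" by (cases \<theta>)
  have s: "(P, Q) \<in> signed_radon" "energy_defined \<kappa> (P, Q) (P, Q)" "energy \<kappa> (P, Q) (P, Q) < \<infinity>"
    using assms by (auto simp: fin_energy_def PQ)
  have r: "radon P" "radon Q" using s by (auto simp: signed_radon_def)
  have "nenergy k P P < top \<and> nenergy k Q Q < top"
  proof (rule ccontr)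
    assume n: "\<not> ?thesis"
    then have "pos_energy \<kappa> P P + pos_energy \<kappa> Q Q = \<infinity>" using r by (auto simp: pos_energy_ip)
    then show False using s(2,3) by (auto simp: energy_defined_def energy_def)
  qed
  then show "fst \<theta> \<in> finite_energy" "snd \<theta> \<in> finite_energy"
    using r by (auto simp: PQ finite_energy_def)
qed

end

section \<open>The Gauss functional\<close>

lemma enn2real_integral:
  assumes g: "g \<in> borel_measurable M" and fin: "(\<integral>\<^sup>+x. g x \<partial>M) < top"
  shows "AE x in M. g x < top" "integrable M (\<lambda>x. enn2real (g x))"
    "(\<integral>x. enn2real (g x) \<partial>M) = enn2real (\<integral>\<^sup>+x. g x \<partial>M)"
proof -
  show ae: "AE x in M. g x < top"
    using nn_integral_noteq_infinite[OF g] fin by (auto simp: less_top)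
  have "(\<integral>\<^sup>+x. ennreal (enn2real (g x)) \<partial>M) = (\<integral>\<^sup>+x. g x \<partial>M)"
    using ae by (intro nn_integral_cong_AE) auto
  then have "has_bochner_integral M (\<lambda>x. enn2real (g x)) (enn2real (\<integral>\<^sup>+x. g x \<partial>M))"
    using g fin by (intro has_bochner_integral_nn_integral) auto
  then show "integrable M (\<lambda>x. enn2real (g x))" "(\<integral>x. enn2real (g x) \<partial>M) = enn2real (\<integral>\<^sup>+x. g x \<partial>M)"
    by (auto simp: has_bochner_integral_iff)
qed

section \<open>Concentration and vague limits\<close>

lemma concentrated_on_mono: "concentrated_on M A \<Longrightarrow> A \<subseteq> B \<Longrightarrow> concentrated_on M B"
  unfolding concentrated_on_def by (meson Diff_mono order_refl order_trans)

text \<open>The complement of a compact set is open, so inner regularity upgrades local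
  negligibility to measure zero.\<close>

lemma concentrated_on_compact_iff:
  fixes M :: "'a::t2_space measure"
  assumes M: "radon M" and K: "compact K"
  shows "concentrated_on M K \<longleftrightarrow> emeasure M (- K) = 0"
proof
  have op: "open (- K)" using K by (simp add: compact_imp_closed open_Compl)
  show "emeasure M (- K) = 0" if c: "concentrated_on M K"
  proof (rule ccontr)
    assume "emeasure M (- K) \<noteq> 0"
    then have "0 < emeasure M (- K)" by (simp add: zero_less_iff_neq_zero)
    then obtain C where C: "compact C" "C \<subseteq> - K" "0 < emeasure M C" using radon_inner[OF M op] by blast
    obtain Z where "Z \<in> null_sets M" "C - K \<subseteq> Z" using c C(1) unfolding concentrated_on_def by blast
    moreover have "C - K = C" using C(2) by auto
    ultimately have "C \<in> null_sets M" using null_sets_subset radon_compact_sets[OF M C(1)] by metis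
    then show False using C(3) by auto
  qed
  show "concentrated_on M K" if "emeasure M (- K) = 0"
    unfolding concentrated_on_def using that op M
    by (intro allI impI bexI[of _ "- K"]) (auto simp: null_sets_def)
qed

text \<open>A null set of one measure may be charged by the other, but the intersection of the two
  covers is null for both.\<close>

lemma concentrated_on_add:
  fixes M N :: "'a::t2_space measure"
  assumes M: "radon M" "concentrated_on M A" and N: "radon N" "concentrated_on N A"
  shows "concentrated_on (add_measure M N) A"
  unfolding concentrated_on_def
proof (intro allI impI)
  fix K :: "'a set" assume K: "compact K"
  obtain Z Z' where Z: "Z \<in> null_sets M" "K - A \<subseteq> Z" "Z' \<in> null_sets N" "K - A \<subseteq> Z'"
    using M(2) N(2) K unfolding concentrated_on_def by meson
  have s: "Z \<in> sets borel" "Z' \<in> sets borel" using Z M N by auto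
  have "emeasure M (Z \<inter> Z') = 0" "emeasure N (Z \<inter> Z') = 0"
    using Z s M N emeasure_mono[of "Z \<inter> Z'" Z M] emeasure_mono[of "Z \<inter> Z'" Z' N] by auto
  then have "Z \<inter> Z' \<in> null_sets (add_measure M N)"
    using s M N by (auto simp: null_sets_def emeasure_add_measure)
  then show "\<exists>Z\<in>null_sets (add_measure M N). K - A \<subseteq> Z" using Z by (intro bexI[of _ "Z \<inter> Z'"]) auto
qed

lemma concentrated_on_scale: "concentrated_on M A \<Longrightarrow> concentrated_on (scale_measure r M) A"
  unfolding concentrated_on_def null_sets_def by fastforce

lemma topspace_vague: "topspace vague_topology = {M. radon M}"
  by (auto simp: vague_topology_def topspace_pullback_topology PiE_def)

lemma vague_integral_tendsto:
  assumes lim: "limitin (subtopology vague_topology S) m M F" and \<phi>: "\<phi> \<in> Cc"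
  shows "((\<lambda>i. integral\<^sup>L (m i) \<phi>) \<longlongrightarrow> integral\<^sup>L M \<phi>) F"
proof (rule topological_tendstoI)
  fix W :: "real set" assume W: "open W" "integral\<^sup>L M \<phi> \<in> W"
  have "openin (product_topology (\<lambda>_. euclideanreal) Cc) {x \<in> topspace (product_topology (\<lambda>_. euclideanreal) Cc). x \<phi> \<in> W}"
    using W \<phi> by (intro openin_continuous_map_preimage[OF continuous_map_product_projection]) auto
  then have "openin vague_topology {M. radon M \<and> integral\<^sup>L M \<phi> \<in> W}"
    unfolding vague_topology_def openin_pullback_topology using \<phi>
    by (intro exI conjI) (assumption, auto)
  moreover have "limitin vague_topology m M F" using lim by (auto simp: limitin_subtopology)
  moreover have "M \<in> {M. radon M \<and> integral\<^sup>L M \<phi> \<in> W}"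
    using W limitin_topspace[OF lim] by (auto simp: topspace_vague)
  ultimately have "\<forall>\<^sub>F i in F. m i \<in> {M. radon M \<and> integral\<^sup>L M \<phi> \<in> W}"
    unfolding limitin_def by blast
  then show "\<forall>\<^sub>F i in F. integral\<^sup>L (m i) \<phi> \<in> W" by eventually_elim simp
qed

text \<open>Each minorant in \<open>Cc\<close> has an integral that converges, and its limit is at
  most \<open>s\<close>; the supremum over minorants inherits the bound. It serves for open sets and
  for the field alike.\<close>

lemma nn_integral_lsc_vague_limit:
  fixes g :: "'a::t2_space \<Rightarrow> ennreal"
  assumes lc: "locally_compact_space (euclidean :: 'a topology)" and g: "lsc g"
    and m: "\<And>n. radon (m n)" and M: "radon M"
    and lim: "\<And>\<phi>. \<phi> \<in> Cc \<Longrightarrow> (\<lambda>n. integral\<^sup>L (m n) \<phi>) \<longlonglongrightarrow> integral\<^sup>L M \<phi>"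
    and r: "\<And>n. 0 \<le> r n" "r \<longlonglongrightarrow> s" "\<And>n. (\<integral>\<^sup>+x. g x \<partial>m n) \<le> ennreal (r n)"
  shows "(\<integral>\<^sup>+x. g x \<partial>M) \<le> ennreal s"
  unfolding nn_integral_lsc_eq_SUP[OF lc M g]
proof (rule SUP_least)
  fix \<phi> assume \<phi>: "\<phi> \<in> Cc_below g"
  then have \<phi>': "\<phi> \<in> Cc" "\<And>z. 0 \<le> \<phi> z" by (auto simp: Cc_below_def)
  have eq: "(\<integral>\<^sup>+x. ennreal (\<phi> x) \<partial>L) = ennreal (integral\<^sup>L L \<phi>)" if "radon L" for L
    using Cc_integrable[OF \<phi>'(1) that] \<phi>'(2) by (intro nn_integral_eq_integral) auto
  have "integral\<^sup>L (m n) \<phi> \<le> r n" for n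
  proof -
    have "ennreal (integral\<^sup>L (m n) \<phi>) \<le> (\<integral>\<^sup>+x. g x \<partial>m n)"
      unfolding eq[OF m, symmetric] using \<phi> by (intro nn_integral_mono) (auto simp: Cc_below_def)
    then have "ennreal (integral\<^sup>L (m n) \<phi>) \<le> ennreal (r n)" using r(3) order_trans by blast
    then show ?thesis using r(1) by (simp add: ennreal_le_iff)
  qed
  then have "integral\<^sup>L M \<phi> \<le> s" by (intro LIMSEQ_le[OF lim[OF \<phi>'(1)] r(2)]) auto
  then show "(\<integral>\<^sup>+x. ennreal (\<phi> x) \<partial>M) \<le> ennreal s" unfolding eq[OF M] by (rule ennreal_leI)
qed

text \<open>The shift of \<open>\<psi>\<close> by \<open>b\<close> is harmless, since on measures of
  mass one it contributes exactly \<open>b\<close>.\<close>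

locale gauss_problem = energy_kernel_space \<kappa> c
  for \<kappa> :: "'a::t2_space \<times> 'a \<Rightarrow> ereal" and c +
  fixes \<psi> f :: "'a \<Rightarrow> ereal" and \<theta> :: "'a measure \<times> 'a measure" and b :: real
  assumes perfect: "perfect_kernel \<kappa>"
    and psi: "\<psi> \<in> lsc_class" and theta: "\<theta> \<in> fin_energy \<kappa>"
    and f_eq: "f = (\<lambda>x. \<psi> x + potential \<kappa> \<theta> x)"
    and b_nonneg: "0 \<le> b" and psi_plus_b: "\<And>x. 0 \<le> \<psi> x + ereal b"
begin

definition \<Psi> :: "'a \<Rightarrow> ennreal" where
  "\<Psi> x = e2ennreal (\<psi> x + ereal b)"

lemma lsc_Psi: "lsc \<Psi>"
  using lsc_e2ennreal_shift[OF psi, of b] unfolding \<Psi>_def[abs_def] .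

section \<open>The Gauss functional as a real-valued function\<close>

definition unit_measures :: "'a measure set" where
  "unit_measures = {M \<in> finite_energy. emeasure M UNIV = 1 \<and> (\<integral>\<^sup>+x. \<Psi> x \<partial>M) < top}"

text \<open>The integral of \<open>f\<close> for a measure of mass one: the shift is removed, and
  the potential of \<open>\<theta>\<close> is integrated as a difference of mutual energies.\<close>

definition field_integral :: "'a measure \<Rightarrow> real" where
  "field_integral M = enn2real (\<integral>\<^sup>+x. \<Psi> x \<partial>M) - b + ip M (fst \<theta>) - ip M (snd \<theta>)"

definition gauss :: "'a measure \<Rightarrow> real" where
  "gauss M = ip M M + 2 * field_integral M"

lemma pos_potential_measurable: "radon N \<Longrightarrow> pos_potential \<kappa> N \<in> borel_measurable borel"
proof -
  assume N: "radon N"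
  have "(\<lambda>x. enn2ereal (npot k N x) - ereal (c * mass N)) \<in> borel_measurable borel"
    using npot_measurable[OF N] by (intro borel_measurable_ereal_diff measurable_compose[OF _ measurable_enn2ereal]) auto
  then show ?thesis by (simp add: pos_potential_eq[OF N, abs_def])
qed

lemma pos_potential_integral:
  assumes M: "M \<in> finite_energy" "emeasure M UNIV = 1" and N: "N \<in> finite_energy"
  shows "AE x in M. \<bar>pos_potential \<kappa> N x\<bar> \<noteq> \<infinity>"
    "integrable M (\<lambda>x. real_of_ereal (pos_potential \<kappa> N x))"
    "(\<integral>x. real_of_ereal (pos_potential \<kappa> N x) \<partial>M) = ip M N"
proof -
  note r = finite_energyD(1)[OF M(1)] finite_energyD(1)[OF N]
  interpret prob: finite_measure M using M(2) r(1) by (intro finite_measureI) auto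
  have m: "npot k N \<in> borel_measurable M" by (rule measurable_borel_sets[OF npot_measurable[OF r(2)] radon_sets[OF r(1)]])
  have fin: "(\<integral>\<^sup>+x. npot k N x \<partial>M) < top" using ip_diff(1)[OF M(1) N] by (simp add: nenergy_def)
  note i = enn2real_integral[OF m fin]
  show ae: "AE x in M. \<bar>pos_potential \<kappa> N x\<bar> \<noteq> \<infinity>"
    using i(1)
  proof eventually_elim
    case (elim x)
    then show ?case unfolding pos_potential_eq[OF r(2)] by (cases "npot k N x") auto
  qed
  have eq: "real_of_ereal (pos_potential \<kappa> N x) = enn2real (npot k N x) - c * mass N" if "npot k N x < top" for x
    using that unfolding pos_potential_eq[OF r(2)] by (cases "npot k N x") auto
  have "(\<lambda>x. real_of_ereal (pos_potential \<kappa> N x)) \<in> borel_measurable M"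
    by (intro borel_measurable_real_of_ereal measurable_borel_sets[OF pos_potential_measurable[OF r(2)] radon_sets[OF r(1)]])
  moreover have "AE x in M. enn2real (npot k N x) - c * mass N = real_of_ereal (pos_potential \<kappa> N x)"
    using i(1) by eventually_elim (simp add: eq)
  moreover have h: "has_bochner_integral M (\<lambda>x. enn2real (npot k N x) - c * mass N) (enn2real (nenergy k M N) - mass M * (c * mass N))"
    using i(2,3) integral_const_mass[OF r(1)] unfolding has_bochner_integral_iff nenergy_def by simp
  ultimately have "has_bochner_integral M (\<lambda>x. real_of_ereal (pos_potential \<kappa> N x)) (enn2real (nenergy k M N) - mass M * (c * mass N))"
    by (subst has_bochner_integralI_AE[OF h]) auto
  then show "integrable M (\<lambda>x. real_of_ereal (pos_potential \<kappa> N x))"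
    "(\<integral>x. real_of_ereal (pos_potential \<kappa> N x) \<partial>M) = ip M N"
    by (auto simp: has_bochner_integral_iff ip_def)
qed

lemma potential_integral:
  assumes M: "M \<in> finite_energy" "emeasure M UNIV = 1"
  shows "AE x in M. \<bar>potential \<kappa> \<theta> x\<bar> \<noteq> \<infinity>"
    "has_bochner_integral M (\<lambda>x. real_of_ereal (potential \<kappa> \<theta> x)) (ip M (fst \<theta>) - ip M (snd \<theta>))"
proof -
  note t = fin_energyD[OF theta]
  note p = pos_potential_integral[OF M t(1)] and q = pos_potential_integral[OF M t(2)]
  show "AE x in M. \<bar>potential \<kappa> \<theta> x\<bar> \<noteq> \<infinity>"
    using p(1) q(1) by eventually_elim (auto simp: potential_def)
  have h: "has_bochner_integral M (\<lambda>x. real_of_ereal (pos_potential \<kappa> (fst \<theta>) x) - real_of_ereal (pos_potential \<kappa> (snd \<theta>) x))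
      (ip M (fst \<theta>) - ip M (snd \<theta>))"
    using p q by (simp add: has_bochner_integral_iff)
  show "has_bochner_integral M (\<lambda>x. real_of_ereal (potential \<kappa> \<theta> x)) (ip M (fst \<theta>) - ip M (snd \<theta>))"
  proof (rule has_bochner_integralI_AE[OF h])
    show "(\<lambda>x. real_of_ereal (potential \<kappa> \<theta> x)) \<in> borel_measurable M"
      unfolding potential_def using t finite_energyD
      by (intro borel_measurable_real_of_ereal borel_measurable_ereal_diff
          measurable_borel_sets[OF pos_potential_measurable radon_sets[OF finite_energyD(1)[OF M(1)]]]) auto
    show "AE x in M. real_of_ereal (pos_potential \<kappa> (fst \<theta>) x) - real_of_ereal (pos_potential \<kappa> (snd \<theta>) x) = real_of_ereal (potential \<kappa> \<theta> x)"
      using p(1) q(1) by eventually_elim (auto simp: potential_def)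
  qed
qed

lemma field_measurable: "f \<in> borel_measurable borel"
proof -
  have "potential \<kappa> \<theta> \<in> borel_measurable borel"
    unfolding potential_def[abs_def] using fin_energyD[OF theta] finite_energyD
    by (intro borel_measurable_ereal_diff pos_potential_measurable) auto
  then show ?thesis unfolding f_eq using lsc_class_measurable[OF psi] by (intro borel_measurable_ereal_add)
qed

text \<open>Finite mutual energies make the potential of \<open>\<theta>\<close> integrable for
  every unit measure of finite energy. Thus integrability of \<open>f\<close> depends on
  \<open>\<psi>\<close> alone, and for the nonnegative function \<open>\<Psi>\<close> it means a
  finite integral.\<close>

lemma field_integral_eq:
  assumes M: "M \<in> finite_energy" "emeasure M UNIV = 1"
  shows "eintegrable M f \<longleftrightarrow> (\<integral>\<^sup>+x. \<Psi> x \<partial>M) < top"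
    "eintegrable M f \<Longrightarrow> eintegral M f = field_integral M"
proof -
  note r = finite_energyD(1)[OF M(1)]
  interpret prob: finite_measure M using M(2) r(1) by (intro finite_measureI) auto
  have m1: "mass M = 1" using M(2) by (simp add: measure_def)
  note u = potential_integral[OF M]
  have Pm: "\<Psi> \<in> borel_measurable M" by (rule lsc_measurable[OF lsc_Psi radon_sets[OF r]])
  have fm: "(\<lambda>x. real_of_ereal (f x)) \<in> borel_measurable M"
    by (intro borel_measurable_real_of_ereal measurable_borel_sets[OF field_measurable radon_sets[OF r]])
  have ninf: "\<psi> x \<noteq> - \<infinity>" for x using psi by (auto simp: lsc_class_def)
  have Ptop: "\<Psi> x < top \<longleftrightarrow> \<psi> x \<noteq> \<infinity>" for x
    using ninf[of x] by (cases "\<psi> x") (auto simp: \<Psi>_def)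
  have Preal: "enn2real (\<Psi> x) = real_of_ereal (\<psi> x) + b" if "\<psi> x \<noteq> \<infinity>" for x
    using ninf[of x] that psi_plus_b[of x] by (cases "\<psi> x") (auto simp: \<Psi>_def)
  have dir: "eintegrable M f \<and> eintegral M f = field_integral M" if fin: "(\<integral>\<^sup>+x. \<Psi> x \<partial>M) < top"
  proof -
    note i = enn2real_integral[OF Pm fin]
    have h: "has_bochner_integral M (\<lambda>x. (enn2real (\<Psi> x) - b) + real_of_ereal (potential \<kappa> \<theta> x)) (field_integral M)"
      using i(2,3) u(2) integral_const_mass[OF r] m1 by (simp add: has_bochner_integral_iff field_integral_def)
    have ae: "AE x in M. \<bar>f x\<bar> \<noteq> \<infinity> \<and> enn2real (\<Psi> x) - b + real_of_ereal (potential \<kappa> \<theta> x) = real_of_ereal (f x)"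
      using i(1) u(1)
    proof eventually_elim
      case (elim x)
      then show ?case using ninf[of x] Preal[of x] unfolding Ptop f_eq
        by (cases "\<psi> x"; cases "potential \<kappa> \<theta> x") auto
    qed
    have "has_bochner_integral M (\<lambda>x. real_of_ereal (f x)) (field_integral M)"
      using ae by (intro has_bochner_integralI_AE[OF h fm]) auto
    then show ?thesis using ae by (auto simp: eintegrable_def eintegral_def has_bochner_integral_iff)
  qed
  moreover have "(\<integral>\<^sup>+x. \<Psi> x \<partial>M) < top" if e: "eintegrable M f"
  proof -
    have i: "integrable M (\<lambda>x. real_of_ereal (f x) - real_of_ereal (potential \<kappa> \<theta> x) + b)"
      using e u(2) by (simp add: eintegrable_def has_bochner_integral_iff)
    have "AE x in M. \<bar>f x\<bar> \<noteq> \<infinity>" using e by (simp add: eintegrable_def)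
    then have "AE x in M. \<Psi> x = ennreal (real_of_ereal (f x) - real_of_ereal (potential \<kappa> \<theta> x) + b)"
      using u(1)
    proof eventually_elim
      case (elim x)
      then show ?case using ninf[of x] unfolding f_eq
        by (cases "\<psi> x"; cases "potential \<kappa> \<theta> x") (auto simp: \<Psi>_def)
    qed
    then have "(\<integral>\<^sup>+x. \<Psi> x \<partial>M) = (\<integral>\<^sup>+x. ennreal (real_of_ereal (f x) - real_of_ereal (potential \<kappa> \<theta> x) + b) \<partial>M)"
      by (rule nn_integral_cong_AE)
    also have "\<dots> \<le> (\<integral>\<^sup>+x. ennreal (norm (real_of_ereal (f x) - real_of_ereal (potential \<kappa> \<theta> x) + b)) \<partial>M)"
      by (intro nn_integral_mono ennreal_leI) auto
    also have "\<dots> < top" using i by (simp add: integrable_iff_bounded)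
    finally show ?thesis .
  qed
  ultimately show "eintegrable M f \<longleftrightarrow> (\<integral>\<^sup>+x. \<Psi> x \<partial>M) < top"
    "eintegrable M f \<Longrightarrow> eintegral M f = field_integral M" by blast+
qed

lemma unit_class_eq: "unit_class \<kappa> f Q = {M \<in> unit_measures. concentrated_on M Q}"
  using field_integral_eq(1) by (auto simp: unit_class_def unit_measures_def fin_energy_pos_eq)

lemma unit_measuresD:
  assumes "M \<in> unit_measures"
  shows "M \<in> finite_energy" "radon M" "emeasure M UNIV = 1" "mass M = 1" "(\<integral>\<^sup>+x. \<Psi> x \<partial>M) < top"
  using assms finite_energyD by (auto simp: unit_measures_def measure_def)

lemma eintegral_field: "M \<in> unit_measures \<Longrightarrow> eintegral M f = field_integral M"
  using field_integral_eq unit_measuresD by blast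

lemma gauss_functional_eq: "M \<in> unit_measures \<Longrightarrow> gauss_functional \<kappa> f M = ereal (gauss M)"
  by (simp add: gauss_functional_def eintegral_field energy_pos_eq unit_measuresD gauss_def)

lemma eq_const_eq:
  assumes M: "M \<in> unit_measures"
  shows "eq_const \<kappa> f M = ip M M + field_integral M"
proof -
  note D = unit_measuresD[OF M]
  have z: "pos_potential \<kappa> (null_measure borel) x = 0" for x by (simp add: pos_potential_def)
  note p = pos_potential_integral[OF D(1,3,1)]
  have e: "eintegrable M f" using field_integral_eq(1)[OF D(1,3)] D(5) by blast
  have "has_bochner_integral M (\<lambda>x. real_of_ereal (pos_potential \<kappa> M x) + real_of_ereal (f x)) (ip M M + field_integral M)"
    using p e eintegral_field[OF M] by (simp add: has_bochner_integral_iff eintegrable_def eintegral_def)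
  moreover have "(\<lambda>x. real_of_ereal (weighted_potential \<kappa> f M x)) \<in> borel_measurable M"
    unfolding weighted_potential_def potential_def using D(2)
    by (intro borel_measurable_real_of_ereal borel_measurable_ereal_add borel_measurable_ereal_diff
        measurable_borel_sets[OF pos_potential_measurable radon_sets]
        measurable_borel_sets[OF field_measurable radon_sets]) (simp_all add: radon_null)
  moreover have "AE x in M. real_of_ereal (pos_potential \<kappa> M x) + real_of_ereal (f x) = real_of_ereal (weighted_potential \<kappa> f M x)"
    using p(1) conjunct1[OF e[unfolded eintegrable_def]]
    by eventually_elim (auto simp: weighted_potential_def potential_def z)
  ultimately have "has_bochner_integral M (\<lambda>x. real_of_ereal (weighted_potential \<kappa> f M x)) (ip M M + field_integral M)"
    by (rule has_bochner_integralI_AE)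
  then show ?thesis by (simp add: eq_const_def eintegral_def has_bochner_integral_iff)
qed

lemma is_minimizer_iff:
  "is_minimizer \<kappa> f Q M \<longleftrightarrow> M \<in> unit_class \<kappa> f Q \<and> (\<forall>L\<in>unit_class \<kappa> f Q. gauss M \<le> gauss L)"
proof -
  have g: "gauss_functional \<kappa> f L = ereal (gauss L)" if "L \<in> unit_class \<kappa> f Q" for L
    using that gauss_functional_eq by (simp add: unit_class_eq)
  show ?thesis
  proof (cases "M \<in> unit_class \<kappa> f Q")
    case True
    have "gauss_inf \<kappa> f Q \<le> gauss_functional \<kappa> f M" unfolding gauss_inf_def using True by (rule INF_lower)
    then have "gauss_functional \<kappa> f M = gauss_inf \<kappa> f Q \<longleftrightarrow> gauss_functional \<kappa> f M \<le> gauss_inf \<kappa> f Q" by auto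
    also have "\<dots> \<longleftrightarrow> (\<forall>L\<in>unit_class \<kappa> f Q. gauss_functional \<kappa> f M \<le> gauss_functional \<kappa> f L)"
      unfolding gauss_inf_def le_INF_iff ..
    finally show ?thesis using True g by (simp add: is_minimizer_def)
  qed (simp add: is_minimizer_def)
qed

definition midpoint_measure :: "'a measure \<Rightarrow> 'a measure \<Rightarrow> 'a measure" where
  "midpoint_measure M N = scale_measure (ennreal (1 / 2)) (add_measure M N)"

text \<open>The field integral is affine along the segment and cancels, so that only the
  parallelogram identity for \<open>ip\<close> remains.\<close>

lemma midpoint_measure:
  assumes M: "M \<in> unit_measures" and N: "N \<in> unit_measures"
  shows "midpoint_measure M N \<in> unit_measures"
    "sqdist M N = 2 * gauss M + 2 * gauss N - 4 * gauss (midpoint_measure M N)"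
proof -
  note D = unit_measuresD[OF M] and E = unit_measuresD[OF N]
  let ?S = "add_measure M N" and ?H = "midpoint_measure M N"
  have S: "?S \<in> finite_energy" by (rule finite_energy_add[OF D(1) E(1)])
  have H: "?H \<in> finite_energy" unfolding midpoint_measure_def by (rule finite_energy_scale[OF S]) simp
  have P: "(\<integral>\<^sup>+x. \<Psi> x \<partial>?H) = ennreal (1 / 2) * ((\<integral>\<^sup>+x. \<Psi> x \<partial>M) + (\<integral>\<^sup>+x. \<Psi> x \<partial>N))"
    unfolding midpoint_measure_def using D(2) E(2)
    by (simp add: nn_integral_scale_measure lsc_measurable[OF lsc_Psi] nn_integral_add_measure)
  have "emeasure ?H UNIV = ennreal (1 / 2) * 2"
    unfolding midpoint_measure_def using D E by (simp add: emeasure_add_measure)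
  also have "\<dots> = ennreal (1 / 2 * 2)" by (subst ennreal_mult) auto
  also have "\<dots> = 1" by simp
  finally have one: "emeasure ?H UNIV = 1" .
  show "?H \<in> unit_measures"
    using H one P D(5) E(5) ennreal_less_top[of "1 / 2"] by (auto simp: unit_measures_def ennreal_mult_less_top ennreal_add_less_top)
  have ips: "ip ?H L = (ip M L + ip N L) / 2" "ip L ?H = (ip L M + ip L N) / 2" if "L \<in> finite_energy" for L
  proof -
    have h: "0 < (1 / 2 :: real)" by simp
    show "ip ?H L = (ip M L + ip N L) / 2" "ip L ?H = (ip L M + ip L N) / 2"
      unfolding midpoint_measure_def ip_scale[OF S that h] ip_add[OF D(1) E(1) that] by simp_all
  qed
  have "enn2real (\<integral>\<^sup>+x. \<Psi> x \<partial>?H) = (enn2real (\<integral>\<^sup>+x. \<Psi> x \<partial>M) + enn2real (\<integral>\<^sup>+x. \<Psi> x \<partial>N)) / 2"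
    unfolding P enn2real_mult enn2real_plus[OF D(5) E(5)]
    by (subst enn2real_ennreal) simp_all
  then have "field_integral ?H = (field_integral M + field_integral N) / 2"
    using ips(1)[OF fin_energyD(1)[OF theta]] ips(1)[OF fin_energyD(2)[OF theta]]
    by (simp add: field_integral_def field_simps)
  moreover have "ip ?H ?H = (ip M M + 2 * ip M N + ip N N) / 4"
    using ips(1)[OF H] ips(2)[OF D(1)] ips(2)[OF E(1)] ip_commute[OF E(2) D(2)] by (simp add: field_simps)
  ultimately show "sqdist M N = 2 * gauss M + 2 * gauss N - 4 * gauss ?H"
    by (simp add: sqdist_def gauss_def field_simps)
qed

text \<open>An arbitrary lower bound \<open>w\<close> is allowed, since the estimate is used both
  with an infimum not yet known to be attained and with the value at a minimizer.\<close>

lemma sqdist_le_gauss: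
  assumes M: "M \<in> unit_class \<kappa> f Q" and N: "N \<in> unit_class \<kappa> f Q"
    and w: "\<And>L. L \<in> unit_class \<kappa> f Q \<Longrightarrow> w \<le> gauss L"
  shows "sqdist M N \<le> 2 * gauss M + 2 * gauss N - 4 * w"
proof -
  have MN: "M \<in> unit_measures" "N \<in> unit_measures" "concentrated_on M Q" "concentrated_on N Q"
    using M N by (auto simp: unit_class_eq)
  have "concentrated_on (midpoint_measure M N) Q"
    unfolding midpoint_measure_def using MN unit_measuresD by (intro concentrated_on_scale concentrated_on_add) auto
  then have "w \<le> gauss (midpoint_measure M N)"
    using midpoint_measure(1)[OF MN(1,2)] by (intro w) (simp add: unit_class_eq)
  then show ?thesis using midpoint_measure(2)[OF MN(1,2)] by simp
qed

lemma minimizer_unique: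
  assumes "is_minimizer \<kappa> f Q M" "is_minimizer \<kappa> f Q N"
  shows "M = N"
proof -
  have MN: "M \<in> unit_class \<kappa> f Q" "N \<in> unit_class \<kappa> f Q" "gauss M = gauss N"
    "\<And>L. L \<in> unit_class \<kappa> f Q \<Longrightarrow> gauss M \<le> gauss L"
    using assms by (auto simp: is_minimizer_iff intro: antisym)
  have F: "M \<in> finite_energy" "N \<in> finite_energy" using MN(1,2) unit_measuresD by (auto simp: unit_class_eq)
  have "sqdist M N \<le> 0" using sqdist_le_gauss[OF MN(1,2,4)] MN(3) by simp
  then show ?thesis using ip_diff(3)[OF F] sqdist_nonneg[OF F] by (simp add: sqdist_def)
qed

lemma strong_limit_iff:
  assumes "\<forall>\<^sub>F i in F. m i \<in> finite_energy" "M \<in> finite_energy"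
  shows "limitin (strong_topology \<kappa>) m M F \<longleftrightarrow> ((\<lambda>i. sqdist (m i) M) \<longlongrightarrow> 0) F"
proof -
  interpret S: Metric_space finite_energy "strong_dist \<kappa>" by (rule Metric_space_strong)
  have "limitin (strong_topology \<kappa>) m M F \<longleftrightarrow> ((\<lambda>i. strong_dist \<kappa> (m i) M) \<longlongrightarrow> 0) F"
    using assms by (simp add: strong_topology_def fin_energy_pos_eq S.limitin_metric_dist_null)
  also have "\<dots> \<longleftrightarrow> ((\<lambda>i. sqrt (sqdist (m i) M)) \<longlongrightarrow> 0) F"
    by (intro tendsto_cong eventually_mono[OF assms(1)]) (simp add: strong_dist_eq assms(2))
  also have "\<dots> \<longleftrightarrow> ((\<lambda>i. sqdist (m i) M) \<longlongrightarrow> 0) F"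
  proof
    assume "((\<lambda>i. sqrt (sqdist (m i) M)) \<longlongrightarrow> 0) F"
    then have "((\<lambda>i. (sqrt (sqdist (m i) M))\<^sup>2) \<longlongrightarrow> 0\<^sup>2) F" by (rule tendsto_power)
    then have l: "((\<lambda>i. (sqrt (sqdist (m i) M))\<^sup>2) \<longlongrightarrow> 0) F" by simp
    show "((\<lambda>i. sqdist (m i) M) \<longlongrightarrow> 0) F"
      by (rule Lim_transform_eventually[OF l])
        (use assms(1) in eventually_elim, use assms(2) sqdist_nonneg in simp)
  next
    assume "((\<lambda>i. sqdist (m i) M) \<longlongrightarrow> 0) F"
    then show "((\<lambda>i. sqrt (sqdist (m i) M)) \<longlongrightarrow> 0) F" using tendsto_real_sqrt by fastforce
  qed
  finally show ?thesis .
qed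

lemma strong_imp_vague:
  assumes "limitin (strong_topology \<kappa>) m M F"
  shows "limitin (subtopology vague_topology (fin_energy_pos \<kappa>)) m M F"
proof -
  interpret S: Metric_space finite_energy "strong_dist \<kappa>" by (rule Metric_space_strong)
  have "M \<in> finite_energy"
    using limitin_topspace[OF assms] by (simp add: strong_topology_def fin_energy_pos_eq)
  then have "M \<in> topspace (subtopology vague_topology (fin_energy_pos \<kappa>))"
    using finite_energyD by (simp add: topspace_vague fin_energy_pos_eq)
  moreover have "\<And>S. openin (subtopology vague_topology (fin_energy_pos \<kappa>)) S \<Longrightarrow> openin (strong_topology \<kappa>) S"
    using perfect by (simp add: perfect_kernel_def)
  ultimately show ?thesis using assms unfolding limitin_def by blast
qed

end

section \<open>Minimizers on compact sets and their convergence\<close>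

text \<open>Unions of compact subsets make the principal filters in the definition directed, so a
  single \<open>K0\<close> witnesses each event.\<close>

lemma eventually_compact_subsets_at_top:
  "eventually P (compact_subsets_at_top A) \<longleftrightarrow>
    (\<exists>K0. compact K0 \<and> K0 \<subseteq> A \<and> (\<forall>K. compact K \<longrightarrow> K0 \<subseteq> K \<longrightarrow> K \<subseteq> A \<longrightarrow> P K))"
  unfolding compact_subsets_at_top_def
proof (subst eventually_INF_base)
  show "{K. compact K \<and> K \<subseteq> A} \<noteq> {}" by auto
  fix K L assume "K \<in> {K. compact K \<and> K \<subseteq> A}" "L \<in> {K. compact K \<and> K \<subseteq> A}"
  then show "\<exists>C\<in>{K. compact K \<and> K \<subseteq> A}. principal {K. compact K \<and> C \<subseteq> K \<and> K \<subseteq> A} \<le>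
      inf (principal {C. compact C \<and> K \<subseteq> C \<and> C \<subseteq> A}) (principal {K. compact K \<and> L \<subseteq> K \<and> K \<subseteq> A})"
    by (intro bexI[of _ "K \<union> L"]) auto
qed (auto simp: eventually_principal)

context gauss_problem
begin

text \<open>A minimizing sequence is strongly Cauchy by the parallelogram identity. Its strong limit is
  also its vague limit, so it is concentrated on the compact set, has mass one, and does not
  increase the integral of the lower semicontinuous part of the field.\<close>

lemma minimizer_exists_compact:
  assumes K: "compact K" and ne: "unit_class \<kappa> f K \<noteq> {}"
    and bd: "\<And>L. L \<in> unit_class \<kappa> f K \<Longrightarrow> w0 \<le> gauss L"
  shows "\<exists>M. is_minimizer \<kappa> f K M"
proof -
  interpret S: Metric_space finite_energy "strong_dist \<kappa>" by (rule Metric_space_strong)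
  define w where "w = (INF L\<in>unit_class \<kappa> f K. gauss L)"
  have bb: "bdd_below (gauss ` unit_class \<kappa> f K)" using bd by (auto simp: bdd_below_def)
  have wle: "w \<le> gauss L" if "L \<in> unit_class \<kappa> f K" for L
    unfolding w_def by (rule cINF_lower[OF bb that])
  have "\<exists>L\<in>unit_class \<kappa> f K. gauss L < w + 1 / real (Suc n)" for n
    using cINF_less_iff[OF ne bb, of "w + 1 / real (Suc n)"] by (simp add: w_def)
  then obtain m where m: "\<And>n. m n \<in> unit_class \<kappa> f K" "\<And>n. gauss (m n) < w + 1 / real (Suc n)" by metis
  have mu: "m n \<in> unit_measures" "concentrated_on (m n) K" for n using m(1) by (auto simp: unit_class_eq)
  note mD = unit_measuresD[OF mu(1)]
  have gl: "(\<lambda>n. gauss (m n)) \<longlonglongrightarrow> w"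
  proof (rule tendsto_sandwich)
    show "\<forall>\<^sub>F n in sequentially. w \<le> gauss (m n)" using wle m(1) by simp
    show "\<forall>\<^sub>F n in sequentially. gauss (m n) \<le> w + 1 / real (Suc n)" by (intro always_eventually allI less_imp_le m(2))
    show "(\<lambda>n. w + 1 / real (Suc n)) \<longlonglongrightarrow> w"
      using tendsto_add[OF tendsto_const LIMSEQ_inverse_real_of_nat, of w] by (simp add: inverse_eq_divide)
  qed simp
  have "S.MCauchy m"
    unfolding S.MCauchy_def
  proof (intro conjI allI impI)
    show "range m \<subseteq> finite_energy" using mD(1) by auto
    fix e :: real assume e: "0 < e"
    \<comment> \<open>\<open>sqdist_le_gauss\<close> bounds the squared distance by
      \<open>2 / (n + 1) + 2 / (n' + 1)\<close>, which is at most
      \<open>4 / (N + 1)\<close>.\<close>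
    obtain N where N: "inverse (real (Suc N)) < e\<^sup>2 / 4" using reals_Archimedean[of "e\<^sup>2 / 4"] e by auto
    have "strong_dist \<kappa> (m n) (m n') < e" if "N \<le> n" "N \<le> n'" for n n'
    proof -
      have "1 / real (Suc n) \<le> inverse (real (Suc N))" "1 / real (Suc n') \<le> inverse (real (Suc N))"
        using that by (auto simp: inverse_eq_divide intro!: divide_left_mono)
      then have "sqdist (m n) (m n') < e\<^sup>2"
        using sqdist_le_gauss[OF m(1) m(1) wle, of n n'] m(2)[of n] m(2)[of n'] N by linarith
      then show ?thesis using e mD(1) by (simp add: strong_dist_eq real_less_lsqrt sqdist_nonneg)
    qed
    then show "\<exists>N. \<forall>n n'. N \<le> n \<longrightarrow> N \<le> n' \<longrightarrow> strong_dist \<kappa> (m n) (m n') < e" by blast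
  qed
  moreover have "S.mcomplete" using perfect by (simp add: perfect_kernel_def fin_energy_pos_eq)
  ultimately obtain M where lim: "limitin S.mtopology m M sequentially"
    unfolding S.mcomplete_def by blast
  then have lim': "limitin (strong_topology \<kappa>) m M sequentially" by (simp add: strong_topology_def fin_energy_pos_eq)
  have MF: "M \<in> finite_energy" using limitin_topspace[OF lim] by simp
  note Mr = finite_energyD(1)[OF MF]
  have mF: "\<forall>\<^sub>F n in sequentially. m n \<in> finite_energy" using mD(1) by simp
  have sq: "(\<lambda>n. sqdist (m n) M) \<longlonglongrightarrow> 0" using strong_limit_iff[OF mF MF] lim' by simp
  have vague: "(\<lambda>n. integral\<^sup>L (m n) \<phi>) \<longlonglongrightarrow> integral\<^sup>L M \<phi>" if "\<phi> \<in> Cc" for \<phi>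
    by (rule vague_integral_tendsto[OF strong_imp_vague[OF lim'] that])
  have lscl: "(\<integral>\<^sup>+x. g x \<partial>M) \<le> ennreal s"
    if "lsc g" "\<And>n. 0 \<le> r n" "r \<longlonglongrightarrow> s" "\<And>n. (\<integral>\<^sup>+x. g x \<partial>m n) \<le> ennreal (r n)" for g r s
    by (rule nn_integral_lsc_vague_limit[OF lc that(1) mD(2) Mr vague that(2-4)])
  have opK: "open (- K)" using K by (simp add: compact_imp_closed open_Compl)
  have mK: "emeasure (m n) (- K) = 0" for n using mu(2) concentrated_on_compact_iff[OF mD(2) K] by blast
  \<comment> \<open>The mass of an open set is lower semicontinuous for vague convergence; here the
    bounds are constantly 0.\<close>
  have MK: "emeasure M (- K) = 0"
    using lscl[OF lsc_indicator[OF opK], of "\<lambda>_. 0" 0] mK mD(2) opK Mr by simp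
  have M1: "emeasure M UNIV = 1"
  proof (rule antisym)
    show "emeasure M UNIV \<le> 1"
      using lscl[OF lsc_indicator[OF open_UNIV], of "\<lambda>_. 1" 1] mD(2,3) Mr by simp
    \<comment> \<open>Semicontinuity bounds the total mass only from above. For the converse,
      \<open>\<phi>\<close> equals 1 on \<open>K\<close> and has integral 1 for every
      \<open>m n\<close>; being in \<open>Cc\<close>, it keeps this integral in the limit.\<close>
    obtain \<phi> where \<phi>: "\<phi> \<in> Cc" "\<And>z. 0 \<le> \<phi> z" "\<And>z. \<phi> z \<le> 1" "\<And>z. z \<in> K \<Longrightarrow> \<phi> z = (1::real)"
      using lc_Urysohn[OF lc K open_UNIV] by auto
    have "integral\<^sup>L (m n) \<phi> = 1" for n
    proof -
      have "- K \<in> null_sets (m n)" using mK mD(2) opK by (auto simp: null_sets_def)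
      then have "AE x in m n. \<phi> x = 1" by (rule AE_I') (use \<phi>(4) in auto)
      then have "integral\<^sup>L (m n) \<phi> = (\<integral>x. 1 \<partial>m n)"
        using continuous_borel_measurable_radon[OF Cc_continuous[OF \<phi>(1)] mD(2)]
        by (intro integral_cong_AE) auto
      then show ?thesis using mD(2,4) by simp
    qed
    then have "integral\<^sup>L M \<phi> = 1" using vague[OF \<phi>(1)] by (simp add: LIMSEQ_const_iff)
    moreover have "(\<integral>\<^sup>+x. ennreal (\<phi> x) \<partial>M) = ennreal (integral\<^sup>L M \<phi>)"
      using Cc_integrable[OF \<phi>(1) Mr] \<phi>(2) by (intro nn_integral_eq_integral) auto
    moreover have "(\<integral>\<^sup>+x. ennreal (\<phi> x) \<partial>M) \<le> (\<integral>\<^sup>+x. 1 \<partial>M)"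
      using \<phi>(3) by (intro nn_integral_mono) simp
    ultimately show "1 \<le> emeasure M UNIV" using Mr by simp
  qed
  define e where "e L = ip L (fst \<theta>) - ip L (snd \<theta>) - b" for L
  \<comment> \<open>The definition of \<open>gauss\<close> solved for the integral of
    \<open>\<Psi>\<close>. All terms on the right converge, so these exact values serve as the
    bounds that semicontinuity requires.\<close>
  define r where "r n = (gauss (m n) - ip (m n) (m n)) / 2 - e (m n)" for n
  have rP: "r n = enn2real (\<integral>\<^sup>+x. \<Psi> x \<partial>m n)" for n
    by (simp add: r_def gauss_def field_integral_def e_def field_simps)
  have r_lim: "r \<longlonglongrightarrow> (w - ip M M) / 2 - e M"
    unfolding r_def[abs_def] e_def
    by (intro tendsto_intros gl ip_self_tendsto[OF mF MF sq] ip_tendsto[OF mF MF _ sq] fin_energyD[OF theta]) simp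
  have Psi_le: "(\<integral>\<^sup>+x. \<Psi> x \<partial>M) \<le> ennreal ((w - ip M M) / 2 - e M)"
    using lscl[OF lsc_Psi _ r_lim] rP mD(5) by simp
  have nn: "0 \<le> (w - ip M M) / 2 - e M"
    by (rule LIMSEQ_le_const[OF r_lim]) (simp add: rP)
  have Mu: "M \<in> unit_measures"
    using MF M1 le_less_trans[OF Psi_le ennreal_less_top] by (simp add: unit_measures_def)
  then have MC: "M \<in> unit_class \<kappa> f K" using concentrated_on_compact_iff[OF Mr K] MK by (simp add: unit_class_eq)
  have "enn2real (\<integral>\<^sup>+x. \<Psi> x \<partial>M) \<le> (w - ip M M) / 2 - e M"
    using enn2real_mono[OF Psi_le] nn by simp
  then have "gauss M \<le> w" by (simp add: gauss_def field_integral_def e_def field_simps)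
  then show ?thesis using MC wle order_trans unfolding is_minimizer_iff by blast
qed

text \<open>For mass one, \<open>ip M M + c\<close> is the energy for the nonnegative kernel
  \<open>k\<close>, which restriction cannot increase and scaling by \<open>x\<close> multiplies by
  \<open>x\<close> squared. Signs of \<open>\<kappa>\<close> would spoil this comparison without the
  shift.\<close>

lemma normalized_restriction:
  assumes M: "M \<in> unit_measures" and K: "compact K" and x: "0 < x" and mK: "emeasure M K = ennreal (1 / x)"
  defines "L \<equiv> scale_measure (ennreal x) (density M (indicator K))"
  shows "L \<in> unit_measures" "concentrated_on L K" "ip L L \<le> x\<^sup>2 * (ip M M + c) - c"
    "\<And>g. g \<in> borel_measurable borel \<Longrightarrow> (\<integral>\<^sup>+y. g y \<partial>L) = ennreal x * (\<integral>\<^sup>+y. indicator K y * g y \<partial>M)"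
proof -
  note D = unit_measuresD[OF M]
  have Ks: "K \<in> sets M" "K \<in> sets borel" using radon_compact_sets[OF D(2) K] compact_borel[OF K] by auto
  show int: "(\<integral>\<^sup>+y. g y \<partial>L) = ennreal x * (\<integral>\<^sup>+y. indicator K y * g y \<partial>M)" if "g \<in> borel_measurable borel" for g
  proof -
    have "g \<in> borel_measurable M" by (rule measurable_borel_sets[OF that radon_sets[OF D(2)]])
    then show ?thesis unfolding L_def
      using Ks by (subst nn_integral_scale_measure) (auto simp: nn_integral_density)
  qed
  have sL: "sets L = sets borel" using D(2) by (simp add: L_def)
  have em: "emeasure L B = ennreal x * emeasure M (K \<inter> B)" if "B \<in> sets borel" for B
  proof -
    have "emeasure L B = (\<integral>\<^sup>+y. indicator B y \<partial>L)" using that sL by simp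
    also have "\<dots> = ennreal x * (\<integral>\<^sup>+y. indicator K y * indicator B y \<partial>M)"
      using that by (intro int) auto
    also have "(\<integral>\<^sup>+y. indicator K y * indicator B y \<partial>M) = (\<integral>\<^sup>+y. indicator (K \<inter> B) y \<partial>M)"
      by (intro nn_integral_cong) (auto split: split_indicator)
    also have "\<dots> = emeasure M (K \<inter> B)" using that Ks D(2) by (intro nn_integral_indicator) auto
    finally show ?thesis .
  qed
  have rL: "radon L"
  proof (rule radon_dominated[OF D(2) _ sL])
    show "emeasure M UNIV < top" using D(3) by simp
    show "0 \<le> x" using x by simp
    show "emeasure L B \<le> ennreal x * emeasure M B" if "B \<in> sets borel" for B
      unfolding em[OF that] using that D(2) by (intro mult_left_mono emeasure_mono) auto
  qed
  have int_le: "(\<integral>\<^sup>+y. g y \<partial>L) \<le> ennreal x * (\<integral>\<^sup>+y. g y \<partial>M)" if "g \<in> borel_measurable borel" for g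
    unfolding int[OF that] by (intro mult_left_mono nn_integral_mono) (auto split: split_indicator)
  have one: "emeasure L UNIV = 1"
    using em[of UNIV] mK x by (simp add: ennreal_mult[symmetric])
  have "npot k L y \<le> ennreal x * npot k M y" for y
    unfolding npot_def by (rule int_le[OF k_section_measurable])
  then have "nenergy k L L \<le> (\<integral>\<^sup>+y. ennreal x * npot k M y \<partial>L)"
    unfolding nenergy_def by (intro nn_integral_mono)
  also have "\<dots> \<le> ennreal x * (\<integral>\<^sup>+y. ennreal x * npot k M y \<partial>M)"
    by (intro int_le borel_measurable_times_ennreal borel_measurable_const npot_measurable D(2))
  also have "\<dots> = ennreal x * (ennreal x * nenergy k M M)"
    unfolding nenergy_def
    by (subst nn_integral_cmult) (auto intro: measurable_borel_sets[OF npot_measurable radon_sets] D(2))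
  finally have le: "nenergy k L L \<le> ennreal x * (ennreal x * nenergy k M M)" .
  have fin: "ennreal x * (ennreal x * nenergy k M M) < top"
    using finite_energyD(2)[OF D(1)] by (simp add: ennreal_mult_less_top)
  have LF: "L \<in> finite_energy" using rL le_less_trans[OF le fin] by (simp add: finite_energy_def)
  have "(\<integral>\<^sup>+y. \<Psi> y \<partial>L) < top"
    using int_le[OF lsc_measurable[OF lsc_Psi refl]] D(5)
    by (auto intro: le_less_trans simp: ennreal_mult_less_top)
  then show Lu: "L \<in> unit_measures" using LF one by (simp add: unit_measures_def)
  show "concentrated_on L K"
    using em[of "- K"] Ks by (simp add: concentrated_on_compact_iff[OF rL K])
  have "enn2real (nenergy k L L) \<le> x * (x * enn2real (nenergy k M M))"
    using enn2real_mono[OF le fin] x by (simp add: enn2real_mult)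
  then show "ip L L \<le> x\<^sup>2 * (ip M M + c) - c"
    using unit_measuresD(4)[OF Lu] D(4) by (simp add: ip_def power2_eq_square)
qed

text \<open>Increasing compact subsets of \<open>A\<close> exhaust \<open>M\<close>, and monotone
  convergence handles the field terms. The energy is only bounded from above, by
  \<open>normalized_restriction\<close>, which suffices for an upper estimate of
  \<open>gauss\<close>.\<close>

lemma restriction_gauss_less:
  assumes M: "M \<in> unit_class \<kappa> f A" and e: "0 < e"
  shows "\<exists>K L. compact K \<and> K \<subseteq> A \<and> L \<in> unit_class \<kappa> f K \<and> gauss L < gauss M + e"
proof -
  have Mu: "M \<in> unit_measures" "concentrated_on M A" using M by (auto simp: unit_class_eq)
  note D = unit_measuresD[OF Mu(1)]
  interpret prob: finite_measure M using D(2,3) by (intro finite_measureI) auto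
  \<comment> \<open>The shift by 2 keeps the bound below 1 already for \<open>n = 0\<close>, so that
    every restriction has positive mass and can be normalized.\<close>
  have "\<exists>K. compact K \<and> K \<subseteq> A \<and> emeasure M (- K) \<le> ennreal (1 / real (n + 2))" for n :: nat
    by (rule concentrated_on_inner[OF D(2,3) Mu(2)]) simp
  then obtain C where C: "\<And>n :: nat. compact (C n)" "\<And>n. C n \<subseteq> A" "\<And>n. emeasure M (- C n) \<le> ennreal (1 / real (n + 2))"
    by metis
  define K where "K n = (\<Union>i\<le>n. C i)" for n
  have K: "compact (K n)" "K n \<subseteq> A" "K n \<in> sets M" for n
    using C compact_UN[of "{..n}" C] radon_compact_sets[OF D(2)] by (auto simp: K_def)
  have inc: "incseq K" by (force simp: K_def incseq_def)
  have CK: "C n \<subseteq> K n" for n by (auto simp: K_def)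
  have bound: "emeasure M (- K n) \<le> ennreal (1 / real (n + 2))" for n
  proof -
    have "emeasure M (- K n) \<le> emeasure M (- C n)"
      using CK[of n] radon_compact_sets[OF D(2) C(1)] D(2) by (intro emeasure_mono) (auto simp: Compl_eq_Diff_UNIV)
    then show ?thesis using C(3) order_trans by blast
  qed
  have null: "- (\<Union>n. K n) \<in> null_sets M"
  proof -
    have "emeasure M (- (\<Union>n. K n)) \<le> ennreal (1 / real (n + 2))" for n
      using K(3) D(2) by (intro order_trans[OF emeasure_mono bound[of n]]) (auto simp: Compl_eq_Diff_UNIV)
    moreover have "(\<lambda>n. ennreal (1 / real (n + 2))) \<longlonglongrightarrow> ennreal 0"
      using LIMSEQ_ignore_initial_segment[OF lim_inverse_n', of 2] by (intro tendsto_ennrealI)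
    ultimately have "emeasure M (- (\<Union>n. K n)) \<le> ennreal 0" by (intro LIMSEQ_le_const) auto
    then show ?thesis using K(3) D(2) by (auto simp: null_sets_def Compl_eq_Diff_UNIV)
  qed
  define a where "a n = measure M (K n)" for n
  define x where "x n = 1 / a n" for n
  have a_eq: "emeasure M (K n) = ennreal (a n)" for n by (simp add: a_def prob.emeasure_eq_measure)
  have lim_int: "(\<lambda>n. \<integral>\<^sup>+y. indicator (K n) y * g y \<partial>M) \<longlonglongrightarrow> (\<integral>\<^sup>+y. g y \<partial>M)"
    if g: "g \<in> borel_measurable borel" for g
  proof -
    have gm: "g \<in> borel_measurable M" by (rule measurable_borel_sets[OF g radon_sets[OF D(2)]])
    have i: "incseq (\<lambda>n y. indicator (K n) y * g y)"
      using inc by (auto simp: incseq_def le_fun_def split: split_indicator)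
    have mm: "(\<lambda>y. indicator (K n) y * g y) \<in> borel_measurable M" for n using gm K(3) by auto
    have "(\<lambda>n. \<integral>\<^sup>+y. indicator (K n) y * g y \<partial>M) \<longlonglongrightarrow> (SUP n. \<integral>\<^sup>+y. indicator (K n) y * g y \<partial>M)"
      using i by (intro LIMSEQ_SUP) (auto simp: incseq_def le_fun_def intro!: nn_integral_mono)
    also have "(SUP n. \<integral>\<^sup>+y. indicator (K n) y * g y \<partial>M) = (\<integral>\<^sup>+y. (SUP n. indicator (K n) y * g y) \<partial>M)"
      by (rule nn_integral_monotone_convergence_SUP[OF i mm, symmetric])
    also have "\<dots> = (\<integral>\<^sup>+y. g y \<partial>M)"
    proof (rule nn_integral_cong_AE)
      show "AE y in M. (SUP n. indicator (K n) y * g y) = g y"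
      proof (rule AE_I'[OF null], clarify)
        fix y n assume ne: "(SUP n. indicator (K n) y * g y) \<noteq> g y" and y: "y \<in> K n"
        have "(SUP n. indicator (K n) y * g y) = g y"
          using y by (intro antisym SUP_least SUP_upper2[of n]) (auto split: split_indicator)
        then show False using ne by simp
      qed
    qed
    finally show ?thesis .
  qed
  have a_lim: "a \<longlonglongrightarrow> 1"
  proof -
    have "(\<lambda>n. \<integral>\<^sup>+y. indicator (K n) y * 1 \<partial>M) \<longlonglongrightarrow> (\<integral>\<^sup>+y. 1 \<partial>M)" by (rule lim_int) simp
    then have "(\<lambda>n. ennreal (a n)) \<longlonglongrightarrow> ennreal 1" using K(3) D(2,3) by (simp add: a_eq)
    then show ?thesis by (rule tendsto_ennrealD) (simp_all add: a_def)
  qed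
  have x_lim: "x \<longlonglongrightarrow> 1" using tendsto_divide[OF tendsto_const a_lim, of 1] by (simp add: x_def[abs_def])
  have a_pos: "0 < a n" for n
  proof (rule ccontr)
    assume "\<not> 0 < a n"
    then have "emeasure M (K n) = 0" using a_eq by (simp add: ennreal_neg)
    moreover have "emeasure M UNIV = emeasure M (K n) + emeasure M (- K n)"
      using plus_emeasure[of "K n" M "- K n"] K(3) D(2) by (auto simp: Compl_eq_Diff_UNIV)
    ultimately have "1 \<le> ennreal (1 / real (n + 2))" using bound[of n] D(3) by simp
    then show False by (simp add: field_simps flip: ennreal_1)
  qed
  have x_pos: "0 < x n" and a_x: "emeasure M (K n) = ennreal (1 / x n)" for n
    using a_pos a_eq by (simp_all add: x_def)
  define L where "L n = scale_measure (ennreal (x n)) (density M (indicator (K n)))" for n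
  note R = normalized_restriction[OF Mu(1) K(1) x_pos a_x, folded L_def]
  have nn_lim: "(\<lambda>n. enn2real (\<integral>\<^sup>+y. g y \<partial>L n)) \<longlonglongrightarrow> enn2real (\<integral>\<^sup>+y. g y \<partial>M)"
    if g: "g \<in> borel_measurable borel" and fin: "(\<integral>\<^sup>+y. g y \<partial>M) < top" for g
  proof -
    have "(\<lambda>n. enn2real (\<integral>\<^sup>+y. indicator (K n) y * g y \<partial>M)) \<longlonglongrightarrow> enn2real (\<integral>\<^sup>+y. g y \<partial>M)"
      using lim_int[OF g] fin by (intro tendsto_enn2real) (auto simp: less_top)
    from tendsto_mult[OF x_lim this] show ?thesis
      using x_pos by (simp add: R(4)[OF g] enn2real_mult less_imp_le)
  qed
  have ip_lim: "(\<lambda>n. ip (L n) N) \<longlonglongrightarrow> ip M N" if N: "N \<in> finite_energy" for N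
  proof -
    have "(\<lambda>n. enn2real (\<integral>\<^sup>+y. npot k N y \<partial>L n) - c * mass N) \<longlonglongrightarrow> enn2real (\<integral>\<^sup>+y. npot k N y \<partial>M) - c * mass N"
      using ip_diff(1)[OF D(1) N]
      by (intro tendsto_diff tendsto_const nn_lim npot_measurable finite_energyD(1)[OF N]) (simp add: nenergy_def)
    then show ?thesis using D(4) unit_measuresD(4)[OF R(1)] by (simp add: ip_def nenergy_def)
  qed
  \<comment> \<open>The left-hand side dominates \<open>gauss (L n)\<close>; its limit is
    \<open>gauss M\<close> because \<open>x n\<close> tends to 1.\<close>
  have "(\<lambda>n. (x n)\<^sup>2 * (ip M M + c) - c + 2 * field_integral (L n)) \<longlonglongrightarrow> 1\<^sup>2 * (ip M M + c) - c + 2 * field_integral M"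
    unfolding field_integral_def
    by (intro tendsto_intros x_lim ip_lim fin_energyD[OF theta] nn_lim lsc_measurable[OF lsc_Psi] D(5)) simp
  then have "(\<lambda>n. (x n)\<^sup>2 * (ip M M + c) - c + 2 * field_integral (L n)) \<longlonglongrightarrow> gauss M"
    by (simp add: gauss_def)
  from order_tendstoD(2)[OF this, of "gauss M + e"] e
  obtain n where "(x n)\<^sup>2 * (ip M M + c) - c + 2 * field_integral (L n) < gauss M + e"
    by (auto simp: eventually_sequentially)
  then have "gauss (L n) < gauss M + e" using R(3)[of n] by (simp add: gauss_def)
  then show ?thesis using K(1,2)[of n] R(1,2)[of n]
    by (intro exI[of _ "K n"] exI[of _ "L n"]) (auto simp: unit_class_eq)
qed

section \<open>Convergence along compact subsets\<close>

lemma unit_class_mono: "Q \<subseteq> R \<Longrightarrow> unit_class \<kappa> f Q \<subseteq> unit_class \<kappa> f R"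
  using concentrated_on_mono by (auto simp: unit_class_eq)

lemma minimizer_eq: "is_minimizer \<kappa> f Q M \<Longrightarrow> minimizer \<kappa> f Q = M"
  unfolding minimizer_def using minimizer_unique by blast

lemma eq_const_minimizer:
  assumes "is_minimizer \<kappa> f Q M"
  shows "ereal (eq_const \<kappa> f M) = gauss_inf \<kappa> f Q - ereal (eintegral M f)"
proof -
  have M: "M \<in> unit_measures" using assms by (simp add: is_minimizer_def unit_class_eq)
  have "gauss_inf \<kappa> f Q = ereal (gauss M)" using assms gauss_functional_eq[OF M] by (simp add: is_minimizer_def)
  then show ?thesis by (simp add: eq_const_eq[OF M] eintegral_field[OF M] gauss_def)
qed

context
  fixes A :: "'a set" and lamA :: "'a measure"
  assumes minA: "is_minimizer \<kappa> f A lamA"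
begin

lemma lamA: "lamA \<in> unit_class \<kappa> f A" "\<And>L. L \<in> unit_class \<kappa> f A \<Longrightarrow> gauss lamA \<le> gauss L"
  using minA by (auto simp: is_minimizer_iff)

text \<open>One nearly optimal competitor \<open>L\<close> carried by \<open>K0\<close> remains
  admissible for every larger \<open>K\<close>. It makes the class nonempty and bounds the minimum
  from above, while \<open>gauss lamA\<close> bounds it from below because the classes are
  nested.\<close>

lemma eventually_minimizer:
  assumes "0 < e"
  shows "\<forall>\<^sub>F K in compact_subsets_at_top A.
    is_minimizer \<kappa> f K (minimizer \<kappa> f K) \<and> minimizer \<kappa> f K \<in> unit_class \<kappa> f A \<and> gauss (minimizer \<kappa> f K) < gauss lamA + e"
proof -
  obtain K0 L where K0: "compact K0" "K0 \<subseteq> A" "L \<in> unit_class \<kappa> f K0" "gauss L < gauss lamA + e"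
    using restriction_gauss_less[OF lamA(1) assms] by blast
  show ?thesis unfolding eventually_compact_subsets_at_top
  proof (intro exI[of _ K0] conjI allI impI K0(1,2))
    fix K assume K: "compact K" "K0 \<subseteq> K" "K \<subseteq> A"
    have L: "L \<in> unit_class \<kappa> f K" using K0(3) unit_class_mono[OF K(2)] by blast
    obtain M where M: "is_minimizer \<kappa> f K M"
      using minimizer_exists_compact[OF K(1), of "gauss lamA"] L lamA(2) unit_class_mono[OF K(3)] by blast
    then show "is_minimizer \<kappa> f K (minimizer \<kappa> f K)" by (simp add: minimizer_eq)
    show "minimizer \<kappa> f K \<in> unit_class \<kappa> f A"
      using M unit_class_mono[OF K(3)] by (auto simp: minimizer_eq is_minimizer_iff)
    show "gauss (minimizer \<kappa> f K) < gauss lamA + e"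
      using M L K0(4) by (auto simp: minimizer_eq is_minimizer_iff intro: le_less_trans)
  qed
qed

text \<open>The minimizers for \<open>K\<close> and for \<open>A\<close> both compete in the class
  of \<open>A\<close>, so with \<open>gauss lamA\<close> as lower bound the distance estimate
  collapses to twice the difference of the minima.\<close>

lemma minimizer_convergence:
  "\<forall>\<^sub>F K in compact_subsets_at_top A. \<exists>!M. is_minimizer \<kappa> f K M"
  "limitin (strong_topology \<kappa>) (minimizer \<kappa> f) lamA (compact_subsets_at_top A)"
  "((\<lambda>K. eq_const \<kappa> f (minimizer \<kappa> f K)) \<longlongrightarrow> eq_const \<kappa> f lamA) (compact_subsets_at_top A)"
  "\<forall>\<^sub>F K in compact_subsets_at_top A. ereal (eq_const \<kappa> f (minimizer \<kappa> f K)) =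
    gauss_inf \<kappa> f K - ereal (eintegral (minimizer \<kappa> f K) f)"
proof -
  let ?F = "compact_subsets_at_top A" and ?m = "minimizer \<kappa> f"
  note ev = eventually_minimizer
  have ev1: "\<forall>\<^sub>F K in ?F. is_minimizer \<kappa> f K (?m K)" "\<forall>\<^sub>F K in ?F. ?m K \<in> unit_class \<kappa> f A"
    using ev[of 1] by (auto elim: eventually_mono)
  show "\<forall>\<^sub>F K in ?F. \<exists>!M. is_minimizer \<kappa> f K M"
    using ev1(1) by eventually_elim (use minimizer_unique in blast)
  show "\<forall>\<^sub>F K in ?F. ereal (eq_const \<kappa> f (?m K)) = gauss_inf \<kappa> f K - ereal (eintegral (?m K) f)"
    using ev1(1) by eventually_elim (rule eq_const_minimizer)
  have g: "((\<lambda>K. gauss (?m K)) \<longlongrightarrow> gauss lamA) ?F"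
  proof (rule order_tendstoI)
    show "\<forall>\<^sub>F K in ?F. a < gauss (?m K)" if "a < gauss lamA" for a
      using ev1(2) by eventually_elim (use that lamA(2) in \<open>auto intro: less_le_trans\<close>)
    show "\<forall>\<^sub>F K in ?F. gauss (?m K) < a" if "gauss lamA < a" for a
      using ev[of "a - gauss lamA"] that by (auto elim: eventually_mono)
  qed
  have lu: "lamA \<in> unit_measures" using lamA(1) by (simp add: unit_class_eq)
  note lF = unit_measuresD(1)[OF lu]
  have evu: "\<forall>\<^sub>F K in ?F. ?m K \<in> unit_measures" using ev1(2) by eventually_elim (simp add: unit_class_eq)
  then have evF: "\<forall>\<^sub>F K in ?F. ?m K \<in> finite_energy" by eventually_elim (rule unit_measuresD)
  have sq: "((\<lambda>K. sqdist (?m K) lamA) \<longlongrightarrow> 0) ?F"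
  proof (rule tendsto_sandwich)
    show "\<forall>\<^sub>F K in ?F. 0 \<le> sqdist (?m K) lamA" using evF by eventually_elim (rule sqdist_nonneg[OF _ lF])
    show "\<forall>\<^sub>F K in ?F. sqdist (?m K) lamA \<le> 2 * gauss (?m K) + 2 * gauss lamA - 4 * gauss lamA"
      using ev1(2) by eventually_elim (rule sqdist_le_gauss[OF _ lamA])
    have "((\<lambda>K. 2 * gauss (?m K) + 2 * gauss lamA - 4 * gauss lamA) \<longlongrightarrow> 2 * gauss lamA + 2 * gauss lamA - 4 * gauss lamA) ?F"
      by (intro tendsto_intros g)
    then show "((\<lambda>K. 2 * gauss (?m K) + 2 * gauss lamA - 4 * gauss lamA) \<longlongrightarrow> 0) ?F" by simp
  qed simp
  show "limitin (strong_topology \<kappa>) ?m lamA ?F" using strong_limit_iff[OF evF lF] sq by simp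
  have ecg: "eq_const \<kappa> f M = (gauss M + ip M M) / 2" if "M \<in> unit_measures" for M
    by (simp add: eq_const_eq[OF that] gauss_def)
  have "((\<lambda>K. (gauss (?m K) + ip (?m K) (?m K)) / 2) \<longlongrightarrow> (gauss lamA + ip lamA lamA) / 2) ?F"
    by (intro tendsto_intros g ip_self_tendsto[OF evF lF sq]) simp
  then show "((\<lambda>K. eq_const \<kappa> f (?m K)) \<longlongrightarrow> eq_const \<kappa> f lamA) ?F"
    unfolding ecg[OF lu, symmetric]
    by (rule Lim_transform_eventually) (use evu in eventually_elim, simp add: ecg)
qed

end

end

theorem theorem1p4:
  fixes \<kappa> :: "'a::t2_space \<times> 'a \<Rightarrow> ereal"
    and \<psi> f :: "'a \<Rightarrow> ereal"
    and \<theta> :: "'a measure \<times> 'a measure"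
    and A :: "'a set"
    and lamA :: "'a measure"
  assumes "locally_compact_space (euclidean :: 'a topology)"
    and "perfect_kernel \<kappa>"
    and "\<psi> \<in> lsc_class"
    and "\<theta> \<in> fin_energy \<kappa>"
    and "f = (\<lambda>x. \<psi> x + potential \<kappa> \<theta> x)"
    and "- \<infinity> < gauss_inf \<kappa> f A" and "gauss_inf \<kappa> f A < \<infinity>"
    and "is_minimizer \<kappa> f A lamA"
  shows "(\<forall>\<^sub>F K in compact_subsets_at_top A. \<exists>!M. is_minimizer \<kappa> f K M) \<and>
    limitin (strong_topology \<kappa>) (minimizer \<kappa> f) lamA (compact_subsets_at_top A) \<and>
    limitin (subtopology vague_topology (fin_energy_pos \<kappa>)) (minimizer \<kappa> f) lamA
      (compact_subsets_at_top A) \<and>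
    ((\<exists>\<theta>' \<in> fin_energy \<kappa>. f = potential \<kappa> \<theta>') \<longrightarrow>
      ((\<lambda>K. eq_const \<kappa> f (minimizer \<kappa> f K)) \<longlongrightarrow> eq_const \<kappa> f lamA) (compact_subsets_at_top A) \<and>
      ereal (eq_const \<kappa> f lamA) = gauss_inf \<kappa> f A - ereal (eintegral lamA f) \<and>
      (\<forall>\<^sub>F K in compact_subsets_at_top A.
         ereal (eq_const \<kappa> f (minimizer \<kappa> f K)) =
           gauss_inf \<kappa> f K - ereal (eintegral (minimizer \<kappa> f K) f)))"
proof -
  have kern: "kernel \<kappa>" "\<kappa> \<in> lsc_class" "energy_principle \<kappa>"
    using assms(2) by (auto simp: perfect_kernel_def kernel_def)
  obtain c :: real where c: "0 \<le> c" "c = 0 \<or> compact (UNIV :: ('a \<times> 'a) set)" "\<And>z. 0 \<le> \<kappa> z + ereal c"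
    by (rule lsc_class_bounded_below[OF kern(2)], rule that)
  \<comment> \<open>Boundedness of \<open>\<kappa>\<close> refers to compactness of the square;
    projecting gives compactness of the space.\<close>
  have c': "c = 0 \<or> compact (UNIV :: 'a set)"
  proof (rule disj_forward[OF c(2)])
    assume "compact (UNIV :: ('a \<times> 'a) set)"
    then have "compact (fst ` (UNIV :: ('a \<times> 'a) set))"
      by (intro compact_continuous_image continuous_on_fst continuous_on_id)
    then show "compact (UNIV :: 'a set)" by simp
  qed
  obtain b :: real where b: "0 \<le> b" "b = 0 \<or> compact (UNIV :: 'a set)" "\<And>x. 0 \<le> \<psi> x + ereal b"
    by (rule lsc_class_bounded_below[OF assms(3)], rule that)
  interpret gauss_problem \<kappa> c \<psi> f \<theta> b
    by (unfold_locales; fact)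
  note conv = minimizer_convergence[OF assms(8)]
  show ?thesis
    using conv strong_imp_vague[OF conv(2)] eq_const_minimizer[OF assms(8)] by blast
qed

end
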